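(* Assume in addition $\mathbb E X_0^3<\infty$ and $\mathbb E\varepsilon_1^3<\infty$. Then $\sqrt n(\tilde\alpha_n-\alpha)\to\mathcal N(0,\sigma_{\alpha,\varepsilon}^2)$ in distribution. Moreover, conditionally on the values $(Y_{s-1},Y_{s+2})$, $$\begin{bmatrix}\sqrt n(\tilde\theta_{1,n}-L_1)\\ \sqrt n(\tilde\theta_{2,n}-L_2)\end{bmatrix}\to\mathcal N\Big(\begin{bmatrix}0\\0\end{bmatrix},\sigma_{\alpha,\varepsilon}^2\,f_{\alpha,\varepsilon}f_{\alpha,\varepsilon}^\top\Big),$$ where $L_1=Y_s+\frac{-\alpha(1+\alpha^2)Y_{s-1}-\alpha^2Y_{s+2}-(1-\alpha^3)\mu_\varepsilon}{1+\alpha^2+\alpha^4}$, $L_2=Y_{s+1}+\frac{-\alpha^2Y_{s-1}-\alpha(1+\alpha^2)Y_{s+2}-(1-\alpha^3)\mu_\varepsilon}{1+\alpha^2+\alpha^4}$, and $$f_{\alpha,\varepsilon}=\frac{1}{(1+\alpha^2+\alpha^4)^2}\begin{bmatrix}(\alpha^2-1)(\alpha^4+3\alpha^2+1)Y_{s-1}+2\alpha(\alpha^4-1)Y_{s+2}+\alpha(2-\alpha)(1+\alpha+\alpha^2)^2\mu_\varepsilon\\ 2\alpha(\alpha^4-1)Y_{s-1}+(\alpha^2-1)(\alpha^4+3\alpha^2+1)Y_{s+2}+\alpha(2-\alpha)(1+\alpha+\alpha^2)^2\mu_\varepsilon\end{bmatrix}.$$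
   Context: INAR(1) process: Let $\alpha\in(0,1)$. Let $(\varepsilon_k)_{k\in\mathbb N}$ be i.i.d. non-negative integer-valued random variables with $\mathbb E\varepsilon_1^2<\infty$ and $\mathbb P(\varepsilon_1\ne 0)>0$; write $\mu_\varepsilon=\mathbb E\varepsilon_1$ (assumed known), $\sigma_\varepsilon^2=\operatorname{Var}\varepsilon_1$. For each $k\in\mathbb N$ let $(\xi_{k,j})_{j\in\mathbb N}$ be i.i.d. Bernoulli random variables with mean $\alpha$, these sequences being mutually independent and independent of $(\varepsilon_k)$. Let $X_0$ be a non-negative integer-valued random variable with $\mathbb E X_0^2<\infty$, independent of all $\xi_{k,j}$ and $\varepsilon_k$, and set $X_k=\sum_{j=1}^{X_{k-1}}\xi_{k,j}+\varepsilon_k$ for $k\in\mathbb N$. This Markov chain has a unique stationary distribution; $\tilde X$ denotes a random variable with it, and $\sigma_{\alpha,\varepsilon}^2=\frac{\alpha(1-\alpha)\mathbb E\tilde X^3+\sigma_\varepsilon^2\mathbb E\tilde X^2}{(\mathbb E\tilde X^2)^2}$. Two neighbouring additive outliers: fix known $s\in\mathbb N$ and $\theta_1,\theta_2\in\mathbb N$; $Y_k=X_k+\delta_{k,s}\theta_1+\delta_{k,s+1}\theta_2$; $\mathbf Y_n=(Y_0,\dots,Y_n)$. For $n\ge s+2$, $$Q_n(\mathbf y_n;\alpha',\theta_1',\theta_2')=\sum_{\substack{k=1\\k\notin\{s,s+1,s+2\}}}^n(y_k-\alpha'y_{k-1}-\mu_\varepsilon)^2+(y_s-\alpha'y_{s-1}-\mu_\varepsilon-\theta_1')^2+(y_{s+1}-\alpha'y_s-\mu_\varepsilon+\alpha'\theta_1'-\theta_2')^2+(y_{s+2}-\alpha'y_{s+1}-\mu_\varepsilon+\alpha'\theta_2')^2,$$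 and $(\tilde\alpha_n,\tilde\theta_{1,n},\tilde\theta_{2,n})$ is the unique global minimizer over $\mathbb R^3$ of $Q_n(\mathbf Y_n;\cdot)$ when it exists uniquely, and $(0,0,0)$ otherwise. Conditional convergence: for random vectors $\zeta_n$ and a random vector $\eta$ with values in $\mathbb Z_+^d$, "conditionally on the values $\eta$, $\zeta_n\to\mathcal N(0,\Sigma(\eta))$" means: for every $m$ with $\mathbb P(\eta=m)>0$, the conditional distribution of $\zeta_n$ given $\{\eta=m\}$ converges weakly to $\mathcal N(0,\Sigma(m))$. *)

theory Defs
  imports "HOL-Probability.Probability"
begin

text \<open>Index type for the family of primitive random variables of the INAR(1) model:
  the initial value X0, the innovations eps k and the Bernoulli counting variables xi k j.\<close>
datatype inar_idx = IX0 | IEps nat | IXi nat nat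

primrec inar :: "('a \<Rightarrow> nat) \<Rightarrow> (nat \<Rightarrow> 'a \<Rightarrow> nat) \<Rightarrow> (nat \<Rightarrow> nat \<Rightarrow> 'a \<Rightarrow> nat) \<Rightarrow> nat \<Rightarrow> 'a \<Rightarrow> nat"
  where
  "inar X0 eps xi 0 \<omega> = X0 \<omega>"
| "inar X0 eps xi (Suc k) \<omega> = (\<Sum>j = 1..inar X0 eps xi k \<omega>. xi (Suc k) j \<omega>) + eps (Suc k) \<omega>"

definition inar_kernel :: "real \<Rightarrow> nat pmf \<Rightarrow> nat \<Rightarrow> nat pmf" where
  "inar_kernel \<alpha> e x = map_pmf (\<lambda>(b, c). b + c) (pair_pmf (binomial_pmf x \<alpha>) e)"

definition inar_stationary :: "real \<Rightarrow> nat pmf \<Rightarrow> nat pmf \<Rightarrow> bool" where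
  "inar_stationary \<alpha> e \<pi> \<longleftrightarrow> bind_pmf \<pi> (inar_kernel \<alpha> e) = \<pi>"

definition inar_sigma2 :: "real \<Rightarrow> nat pmf \<Rightarrow> nat pmf \<Rightarrow> real" where
  "inar_sigma2 \<alpha> e \<pi> =
     (\<alpha> * (1 - \<alpha>) * measure_pmf.expectation \<pi> (\<lambda>x. real x ^ 3)
      + measure_pmf.variance e real * measure_pmf.expectation \<pi> (\<lambda>x. real x ^ 2))
     / (measure_pmf.expectation \<pi> (\<lambda>x. real x ^ 2)) ^ 2"

definition outl_Y :: "nat \<Rightarrow> nat \<Rightarrow> nat \<Rightarrow> (nat \<Rightarrow> 'a \<Rightarrow> nat) \<Rightarrow> nat \<Rightarrow> 'a \<Rightarrow> real" where
  "outl_Y s \<theta>1 \<theta>2 X k \<omega> =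
     real (X k \<omega>) + (if k = s then real \<theta>1 else 0) + (if k = s + 1 then real \<theta>2 else 0)"

definition Qn :: "nat \<Rightarrow> real \<Rightarrow> nat \<Rightarrow> (nat \<Rightarrow> real) \<Rightarrow> real \<Rightarrow> real \<Rightarrow> real \<Rightarrow> real" where
  "Qn s \<mu> n y a t1 t2 =
     (\<Sum>k \<in> {1..n} - {s, s + 1, s + 2}. (y k - a * y (k - 1) - \<mu>)\<^sup>2)
     + (y s - a * y (s - 1) - \<mu> - t1)\<^sup>2
     + (y (s + 1) - a * y s - \<mu> + a * t1 - t2)\<^sup>2
     + (y (s + 2) - a * y (s + 1) - \<mu> + a * t2)\<^sup>2"

definition Qn_minimizer :: "nat \<Rightarrow> real \<Rightarrow> nat \<Rightarrow> (nat \<Rightarrow> real) \<Rightarrow> real \<times> real \<times> real \<Rightarrow> bool" where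
  "Qn_minimizer s \<mu> n y p \<longleftrightarrow>
     (\<forall>a t1 t2. Qn s \<mu> n y (fst p) (fst (snd p)) (snd (snd p)) \<le> Qn s \<mu> n y a t1 t2)"

definition cls_est :: "nat \<Rightarrow> real \<Rightarrow> nat \<Rightarrow> (nat \<Rightarrow> real) \<Rightarrow> real \<times> real \<times> real" where
  "cls_est s \<mu> n y =
     (if \<exists>!p. Qn_minimizer s \<mu> n y p then THE p. Qn_minimizer s \<mu> n y p else (0, 0, 0))"

definition weak_conv_gen :: "(nat \<Rightarrow> 'b::topological_space measure) \<Rightarrow> 'b measure \<Rightarrow> bool" where
  "weak_conv_gen Ms M \<longleftrightarrow>
     (\<forall>f :: 'b \<Rightarrow> real. continuous_on UNIV f \<and> bounded (range f) \<longrightarrow>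
        (\<lambda>n. integral\<^sup>L (Ms n) f) \<longlonglongrightarrow> integral\<^sup>L M f)"

text \<open>The centred normal law N(0, v v^T) on R^2 (covariance of rank at most one):
  the law of Z v with Z standard normal.\<close>
definition normal2_rank1 :: "real \<times> real \<Rightarrow> (real \<times> real) measure" where
  "normal2_rank1 v = distr std_normal_distribution borel (\<lambda>z. (z * fst v, z * snd v))"

end

theory Submission
  imports Defs "HOL-Real_Asymp.Real_Asymp"
begin

text \<open>For fixed \<open>a\<close> the criterion is minimised explicitly in the outlier sizes, leaving
  \<open>A\<^sub>n a\<^sup>2 - 2 B\<^sub>n a + g a\<close> up to a constant, where \<open>A\<^sub>n\<close> is the sum of the squared unaffected
  regressors and \<open>g\<close> is a fixed rational function with bounded second derivative. Once \<open>A\<^sub>n\<close> is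
  large this is strictly convex, so that the event \<open>sqrt n (a\<^sub>n - \<alpha>) \<le> x\<close> is \<^emph>\<open>equal\<close> to
  \<open>S\<^sub>n / sqrt n - x A\<^sub>n / n - g' (\<alpha> + x / sqrt n) / (2 sqrt n) \<le> 0\<close> with
  \<open>S\<^sub>n = B\<^sub>n - \<alpha> A\<^sub>n\<close>, and no Slutsky argument is needed.

  The joint characteristic function of \<open>S\<^sub>n / sqrt n\<close> and \<open>A\<^sub>n / n\<close> is followed step by step along
  the Markov chain. The state dependent part of each conditional increment is removed by a corrector
  solving the Poisson equation of the kernel, which is polynomial because the kernel maps polynomials
  to polynomials of the same degree; the remainders vanish uniformly because the chain is
  stochastically dominated by the independent sum of its initial value and its stationary law.
  This requires third moments only, and as it applies to any initial law, in particular to the chain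
  restarted at time \<open>s + 2\<close> under a conditional measure, it also yields the conditional statement.\<close>

subsection \<open>Functions of cubic growth and the transition kernel\<close>

text \<open>Cubes enter because the martingale increment
  \<open>x * (y - \<alpha> * x - \<mu>)\<close> has conditional variance \<open>v0 x\<close>, cubic
  in the current state; bounding a power of the increment above the second would cost further
  moments. A second order expansion of each conditional characteristic function, dominated by a
  conditional second moment, stays within the cube. Numerator and denominator are treated jointly
  because the threshold \<open>x\<close> of the event identity enters as a weight: the combination
  with weights \<open>1\<close> and \<open>- x\<close> has limit
  \<open>sqrt V * Z - x * EX2\<close>, and the probability that this is at most 0 is the normal
  distribution function with variance \<open>V / EX2 ^ 2\<close>. The rank one covariance comes from
  conditioning: once the states at times \<open>s - 1\<close> and \<open>s + 2\<close> are fixed,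
  both outlier estimates are, off an event of vanishing probability, the observations plus
  deterministic functions of the estimate of \<alpha>, so one scalar error drives both. The
  conditioning reaches forward to \<open>s + 2\<close>, but this is the initial time of the
  restarted chain, and the terms with index below \<open>s\<close> do not grow with
  \<open>n\<close>, so scaling removes them.\<close>

lemma integral_bind_pmf_integrable:
  fixes f :: "'b \<Rightarrow> real"
  assumes f: "integrable (measure_pmf (bind_pmf p k)) f"
    and fk: "\<And>x. integrable (measure_pmf (k x)) f"
  shows "integrable (measure_pmf p) (\<lambda>x. measure_pmf.expectation (k x) f)"
    and "measure_pmf.expectation (bind_pmf p k) f
           = measure_pmf.expectation p (\<lambda>x. measure_pmf.expectation (k x) f)"
proof -
  \<comment> \<open>Tonelli for nonnegative integrands yields integrability of the inner expectation
    together with the identity; positive and negative parts of \<open>f\<close> then give the signed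
    case.\<close>
  have pos: "integrable p (\<lambda>x. \<integral>y. g y \<partial>k x) \<and> (\<integral>y. g y \<partial>bind_pmf p k) = (\<integral>x. \<integral>y. g y \<partial>k x \<partial>p)"
    if g: "integrable (bind_pmf p k) g" and gk: "\<And>x. integrable (k x) g" and nn: "\<And>y. 0 \<le> g y"
    for g :: "'b \<Rightarrow> real"
  proof
    have eq: "(\<integral>\<^sup>+x. ennreal (\<integral>y. g y \<partial>k x) \<partial>p) = (\<integral>\<^sup>+y. g y \<partial>bind_pmf p k)"
      by (simp add: nn_integral_eq_integral[OF gk] nn)
    also have "\<dots> = ennreal (\<integral>y. g y \<partial>bind_pmf p k)"
      by (rule nn_integral_eq_integral[OF g]) (simp add: nn)
    finally have *: "(\<integral>\<^sup>+x. ennreal (\<integral>y. g y \<partial>k x) \<partial>p) = ennreal (\<integral>y. g y \<partial>bind_pmf p k)" .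
    then show i: "integrable p (\<lambda>x. \<integral>y. g y \<partial>k x)"
      by (intro integrableI_bounded) (auto simp: nn)
    from * show "(\<integral>y. g y \<partial>bind_pmf p k) = (\<integral>x. \<integral>y. g y \<partial>k x \<partial>p)"
      by (subst (asm) nn_integral_eq_integral[OF i]) (auto simp: nn intro!: integral_nonneg_AE)
  qed
  let ?f1 = "\<lambda>y. max 0 (f y)" and ?f2 = "\<lambda>y. max 0 (- f y)"
  have 1: "integrable p (\<lambda>x. \<integral>y. ?f1 y \<partial>k x) \<and> (\<integral>y. ?f1 y \<partial>bind_pmf p k) = (\<integral>x. \<integral>y. ?f1 y \<partial>k x \<partial>p)"
    using f fk by (intro pos) auto
  have 2: "integrable p (\<lambda>x. \<integral>y. ?f2 y \<partial>k x) \<and> (\<integral>y. ?f2 y \<partial>bind_pmf p k) = (\<integral>x. \<integral>y. ?f2 y \<partial>k x \<partial>p)"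
    using f fk by (intro pos) auto
  have d: "f y = ?f1 y - ?f2 y" for y by auto
  have dk: "(\<integral>y. f y \<partial>k x) = (\<integral>y. ?f1 y \<partial>k x) - (\<integral>y. ?f2 y \<partial>k x)" for x
    using fk by (subst Bochner_Integration.integral_diff[symmetric]) (auto simp: d[symmetric])
  have db: "(\<integral>y. f y \<partial>bind_pmf p k) = (\<integral>y. ?f1 y \<partial>bind_pmf p k) - (\<integral>y. ?f2 y \<partial>bind_pmf p k)"
    using f by (subst Bochner_Integration.integral_diff[symmetric]) (auto simp: d[symmetric])
  show "integrable p (\<lambda>x. \<integral>y. f y \<partial>k x)"
    unfolding dk using 1 2 by (intro Bochner_Integration.integrable_diff) auto
  show "(\<integral>y. f y \<partial>bind_pmf p k) = (\<integral>x. \<integral>y. f y \<partial>k x \<partial>p)"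
    unfolding dk db using 1 2 by (subst Bochner_Integration.integral_diff) auto
qed

text \<open>The growth class that the assumed third moments integrate. It is stable under shifts and
  under the kernel, and it contains the polynomials and the correctors used below.\<close>

definition cubic_growth :: "(nat \<Rightarrow> 'b::real_normed_vector) \<Rightarrow> bool" where
  "cubic_growth f \<longleftrightarrow> (\<exists>C. \<forall>x. norm (f x) \<le> C * (1 + real x ^ 3))"

lemma cubic_growthI: "(\<And>x. norm (f x) \<le> C * (1 + real x ^ 3)) \<Longrightarrow> cubic_growth f"
  by (auto simp: cubic_growth_def)

lemma cubic_growth_ex:
  assumes "cubic_growth f"
  shows "\<exists>C. 0 \<le> C \<and> (\<forall>x. norm (f x) \<le> C * (1 + real x ^ 3))"
proof -
  from assms obtain C where C: "\<forall>x. norm (f x) \<le> C * (1 + real x ^ 3)"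
    unfolding cubic_growth_def by blast
  have "0 \<le> C" using order_trans[OF norm_ge_zero C[rule_format, of 0]] by simp
  with C show ?thesis by blast
qed

lemma power_le_cubic: "j \<le> 3 \<Longrightarrow> real x ^ j \<le> 1 + real x ^ 3"
proof (cases "x = 0")
  case False
  assume "j \<le> 3"
  then have "real x ^ j \<le> real x ^ 3" using False by (intro power_increasing) auto
  then show ?thesis by simp
qed (auto simp: power_0_left)

lemma cubic_growth_power: "j \<le> 3 \<Longrightarrow> cubic_growth (\<lambda>x. real x ^ j)"
  using power_le_cubic by (intro cubic_growthI[of _ 1]) auto

lemma cubic_growth_const: "cubic_growth (\<lambda>x. c)"
  by (intro cubic_growthI[of _ "norm c"]) (simp add: mult_le_cancel_left1)

lemma cubic_growth_add:
  assumes "cubic_growth f" "cubic_growth g"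
  shows "cubic_growth (\<lambda>x. f x + g x)"
proof -
  obtain C where C: "0 \<le> C" "\<And>x. norm (f x) \<le> C * (1 + real x ^ 3)" using cubic_growth_ex[OF assms(1)] by blast
  obtain D where D: "0 \<le> D" "\<And>x. norm (g x) \<le> D * (1 + real x ^ 3)" using cubic_growth_ex[OF assms(2)] by blast
  show ?thesis
  proof (rule cubic_growthI)
    fix x show "norm (f x + g x) \<le> (C + D) * (1 + real x ^ 3)"
      using norm_triangle_ineq[of "f x" "g x"] C(2)[of x] D(2)[of x] unfolding distrib_right by linarith
  qed
qed

lemma cubic_growth_mult:
  fixes f :: "nat \<Rightarrow> 'b::real_normed_algebra"
  assumes "cubic_growth f"
  shows "cubic_growth (\<lambda>x. c * f x)"
proof -
  obtain C where C: "0 \<le> C" "\<And>x. norm (f x) \<le> C * (1 + real x ^ 3)" using cubic_growth_ex[OF assms] by blast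
  show ?thesis
  proof (rule cubic_growthI)
    fix x show "norm (c * f x) \<le> (norm c * C) * (1 + real x ^ 3)"
      using norm_mult_ineq[of c "f x"] mult_left_mono[OF C(2)[of x] norm_ge_zero[of c]] by simp
  qed
qed

lemma cubic_growth_diff:
  fixes f g :: "nat \<Rightarrow> 'b::real_normed_vector"
  assumes "cubic_growth f" "cubic_growth g"
  shows "cubic_growth (\<lambda>x. f x - g x)"
proof -
  have "cubic_growth (\<lambda>x. - g x)" using assms(2) by (simp add: cubic_growth_def)
  from cubic_growth_add[OF assms(1) this] show ?thesis by simp
qed

lemma cubic_growth_of_real:
  "cubic_growth f \<Longrightarrow> cubic_growth (\<lambda>x. of_real (f x) :: 'b::real_normed_algebra_1)"
  by (simp add: cubic_growth_def)

lemma cubic_growth_norm: "cubic_growth f \<Longrightarrow> cubic_growth (\<lambda>x. norm (f x))"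
  by (simp add: cubic_growth_def)

lemma cubic_growth_mono:
  "cubic_growth g \<Longrightarrow> (\<And>x. norm (f x) \<le> norm (g x)) \<Longrightarrow> cubic_growth f"
  unfolding cubic_growth_def using order_trans by blast

lemma cube_Suc_le: "real (Suc x) ^ 3 \<le> 8 * (1 + real x ^ 3)"
proof (cases "x = 0")
  case False
  then have "real (Suc x) ^ 3 \<le> (2 * real x) ^ 3" by (intro power_mono) auto
  then show ?thesis by (simp add: power_mult_distrib)
qed auto

lemma cubic_growth_Suc:
  assumes "cubic_growth f" shows "cubic_growth (\<lambda>x. f (Suc x))"
proof -
  obtain C where C: "0 \<le> C" "\<And>x. norm (f x) \<le> C * (1 + real x ^ 3)" using cubic_growth_ex[OF assms] by blast
  show ?thesis
  proof (rule cubic_growthI)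
    fix x
    have "C * (1 + real (Suc x) ^ 3) \<le> C * (9 * (1 + real x ^ 3))"
    proof (intro mult_left_mono C(1))
      show "1 + real (Suc x) ^ 3 \<le> 9 * (1 + real x ^ 3)"
        using order_trans[OF add_left_mono[OF cube_Suc_le[of x], of 1], of "9 * (1 + real x ^ 3)"] by simp
    qed
    then have "norm (f (Suc x)) \<le> C * (9 * (1 + real x ^ 3))"
      using C(2)[of "Suc x"] by (rule order_trans[rotated])
    then show "norm (f (Suc x)) \<le> (9 * C) * (1 + real x ^ 3)"
      by (simp only: mult.assoc mult.left_commute)
  qed
qed

lemma integrable_cubic_growth:
  fixes f :: "nat \<Rightarrow> 'b::{banach, second_countable_topology}"
  assumes f: "cubic_growth f" and p: "integrable (measure_pmf p) (\<lambda>x. real x ^ 3)"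
  shows "integrable (measure_pmf p) f"
proof -
  obtain C where C: "0 \<le> C" "\<And>x. norm (f x) \<le> C * (1 + real x ^ 3)" using cubic_growth_ex[OF f] by blast
  have "integrable p (\<lambda>x. C * (1 + real x ^ 3))" using p by auto
  then show ?thesis by (rule Bochner_Integration.integrable_bound) (use C in auto)
qed

section \<open>The transition kernel and its conditional moments\<close>

locale inar_law =
  fixes \<alpha> :: real and e \<pi> :: "nat pmf"
  assumes \<alpha>_pos: "0 < \<alpha>" and \<alpha>_less_1: "\<alpha> < 1"
    and e_cube: "integrable (measure_pmf e) (\<lambda>x. real x ^ 3)"
    and e_nontriv: "pmf e 0 < 1"
    and stat: "inar_stationary \<alpha> e \<pi>"
begin

abbreviation K :: "nat \<Rightarrow> nat pmf" where "K \<equiv> inar_kernel \<alpha> e"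

abbreviation KE :: "(nat \<Rightarrow> 'b::{banach, second_countable_topology}) \<Rightarrow> nat \<Rightarrow> 'b" where
  "KE f x \<equiv> measure_pmf.expectation (K x) f"

lemma K_0: "K 0 = e"
  using \<alpha>_pos \<alpha>_less_1
  by (simp add: inar_kernel_def binomial_pmf_0 pair_return_pmf1 map_pmf_comp)

text \<open>One more individual is one more coin peeled off the binomial. Every kernel moment below
  is computed by induction on the state through this recursion.\<close>

lemma K_Suc: "K (Suc x) = bind_pmf (bernoulli_pmf \<alpha>) (\<lambda>b. map_pmf (if b then Suc else id) (K x))"
  using \<alpha>_pos \<alpha>_less_1
  by (auto simp: inar_kernel_def binomial_pmf_Suc pair_pmf_def map_pmf_def bind_assoc_pmf bind_return_pmf
      intro!: bind_pmf_cong)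

lemma nn_integral_K_Suc:
  "(\<integral>\<^sup>+y. g y \<partial>K (Suc x)) = (\<integral>\<^sup>+y. g (Suc y) \<partial>K x) * \<alpha> + (\<integral>\<^sup>+y. g y \<partial>K x) * (1 - \<alpha>)"
  using \<alpha>_pos \<alpha>_less_1 by (simp add: K_Suc)

lemma nn_integral_K_mono:
  assumes "mono g" shows "(\<integral>\<^sup>+y. g y \<partial>K x) \<le> (\<integral>\<^sup>+y. g y \<partial>K (Suc x))"
proof -
  have le: "(\<integral>\<^sup>+y. g y \<partial>K x) \<le> (\<integral>\<^sup>+y. g (Suc y) \<partial>K x)"
    using assms by (intro nn_integral_mono) (auto simp: mono_def)
  have "(\<integral>\<^sup>+y. g y \<partial>K x) = (\<integral>\<^sup>+y. g y \<partial>K x) * \<alpha> + (\<integral>\<^sup>+y. g y \<partial>K x) * (1 - \<alpha>)"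
    using \<alpha>_pos \<alpha>_less_1 by (simp flip: distrib_left ennreal_plus)
  also have "\<dots> \<le> (\<integral>\<^sup>+y. g y \<partial>K (Suc x))"
    unfolding nn_integral_K_Suc using le by (intro add_right_mono mult_right_mono) auto
  finally show ?thesis .
qed

lemma mono_nn_integral_K: "mono g \<Longrightarrow> mono (\<lambda>x. \<integral>\<^sup>+y. g y \<partial>K x)"
  by (rule incseq_SucI) (rule nn_integral_K_mono)

text \<open>At most \<open>x\<close> of the first \<open>x\<close> individuals survive, so leaving
  these unthinned can only increase the next state. The induction moves one shift at a time into
  \<open>g\<close>, which therefore has to vary.\<close>

lemma nn_integral_K_add_le:
  assumes "mono g" shows "(\<integral>\<^sup>+z. g z \<partial>K (x + y)) \<le> (\<integral>\<^sup>+z. g (x + z) \<partial>K y)"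
  using assms
proof (induction x arbitrary: g)
  case (Suc x)
  have m: "mono (\<lambda>z. g (Suc z))" using Suc.prems by (auto simp: mono_def)
  have le: "(\<integral>\<^sup>+z. g z \<partial>K (x + y)) \<le> (\<integral>\<^sup>+z. g (Suc z) \<partial>K (x + y))"
    using Suc.prems by (intro nn_integral_mono) (auto simp: mono_def)
  have "(\<integral>\<^sup>+z. g z \<partial>K (Suc x + y)) \<le> (\<integral>\<^sup>+z. g (Suc z) \<partial>K (x + y)) * \<alpha> + (\<integral>\<^sup>+z. g (Suc z) \<partial>K (x + y)) * (1 - \<alpha>)"
    using le unfolding add_Suc nn_integral_K_Suc by (intro add_left_mono mult_right_mono) auto
  also have "\<dots> = (\<integral>\<^sup>+z. g (Suc z) \<partial>K (x + y))"
    using \<alpha>_pos \<alpha>_less_1 by (simp flip: distrib_left ennreal_plus)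
  also have "\<dots> \<le> (\<integral>\<^sup>+z. g (Suc (x + z)) \<partial>K y)"
    using Suc.IH[OF m] by simp
  finally show ?case by simp
qed simp

lemma integrable_K_cube: "integrable (K x) (\<lambda>y. real y ^ 3)"
proof (induction x)
  case 0 then show ?case by (simp add: K_0 e_cube)
next
  case (Suc x)
  have i: "integrable (K x) (\<lambda>y. real (Suc y) ^ 3)"
    by (intro integrable_cubic_growth[OF _ Suc] cubic_growth_Suc[of "\<lambda>y. real y ^ 3"] cubic_growth_power) auto
  show ?case
    using i Suc by (auto simp: integrable_iff_bounded nn_integral_K_Suc[where g="\<lambda>y. ennreal (real y ^ 3)"]
        ennreal_mult_less_top simp del: of_nat_Suc)
qed

lemma integrable_K:
  fixes f :: "nat \<Rightarrow> 'b::{banach, second_countable_topology}"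
  shows "cubic_growth f \<Longrightarrow> integrable (K x) f"
  using integrable_cubic_growth integrable_K_cube by blast

lemma KE_0: "KE f 0 = measure_pmf.expectation e f"
  by (simp add: K_0)

lemma KE_Suc:
  fixes f :: "nat \<Rightarrow> real"
  assumes "cubic_growth f"
  shows "KE f (Suc x) = \<alpha> * KE (\<lambda>y. f (Suc y)) x + (1 - \<alpha>) * KE f x"
proof -
  have "KE f (Suc x) = (\<integral>b. (\<integral>y. f y \<partial>map_pmf (if b then Suc else id) (K x)) \<partial>bernoulli_pmf \<alpha>)"
    unfolding K_Suc
  proof (rule integral_bind_pmf_integrable)
    show "integrable (measure_pmf (bind_pmf (bernoulli_pmf \<alpha>) (\<lambda>b. map_pmf (if b then Suc else id) (K x)))) f"
      unfolding K_Suc[symmetric] by (rule integrable_K[OF assms])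
    show "integrable (map_pmf (if b then Suc else id) (K x)) f" for b
      using integrable_K[OF assms] integrable_K[OF cubic_growth_Suc[OF assms]] by auto
  qed
  then show ?thesis using \<alpha>_pos \<alpha>_less_1 by simp
qed

definition "\<mu> = measure_pmf.expectation e real"
definition "m2 = measure_pmf.expectation e (\<lambda>x. real x ^ 2)"
definition "m3 = measure_pmf.expectation e (\<lambda>x. real x ^ 3)"
definition "\<sigma>e = m2 - \<mu>\<^sup>2"

lemma integrable_e:
  fixes f :: "nat \<Rightarrow> 'b::{banach, second_countable_topology}"
  shows "cubic_growth f \<Longrightarrow> integrable e f"
  using integrable_cubic_growth e_cube by blast

lemma integrable_K_power: "j \<le> 3 \<Longrightarrow> integrable (K x) (\<lambda>y. real y ^ j)"
  by (intro integrable_K cubic_growth_power)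

lemma integrable_K_real: "integrable (K x) real"
  using integrable_K_power[of 1 x] by simp

lemma integrable_K_square: "integrable (K x) (\<lambda>y. (real y)\<^sup>2)"
  using integrable_K_power[of 2 x] by simp

lemma KE_real: "KE real x = \<alpha> * real x + \<mu>"
proof (induction x)
  case (Suc x)
  have "KE real (Suc x) = \<alpha> * KE (\<lambda>y. real (Suc y)) x + (1 - \<alpha>) * KE real x"
    using cubic_growth_power[of 1] by (intro KE_Suc) simp
  also have "KE (\<lambda>y. real (Suc y)) x = KE real x + 1"
    using integrable_K_real by simp
  finally show ?case using Suc by (simp add: algebra_simps)
qed (simp add: KE_0 \<mu>_def)

lemma KE_square: "KE (\<lambda>y. (real y)\<^sup>2) x = \<alpha>\<^sup>2 * (real x)\<^sup>2 + (\<alpha> * (1 - \<alpha>) + 2 * \<mu> * \<alpha>) * real x + m2"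
proof (induction x)
  case (Suc x)
  have "KE (\<lambda>y. (real y)\<^sup>2) (Suc x) = \<alpha> * KE (\<lambda>y. (real (Suc y))\<^sup>2) x + (1 - \<alpha>) * KE (\<lambda>y. (real y)\<^sup>2) x"
    using cubic_growth_power[of 2] by (intro KE_Suc) simp
  also have "KE (\<lambda>y. (real (Suc y))\<^sup>2) x = KE (\<lambda>y. (real y)\<^sup>2 + 2 * real y + 1) x"
    by (intro Bochner_Integration.integral_cong) (auto simp: power2_eq_square algebra_simps)
  also have "\<dots> = KE (\<lambda>y. (real y)\<^sup>2) x + 2 * KE real x + 1"
    using integrable_K_real integrable_K_square by simp
  finally show ?case using Suc by (simp add: KE_real power2_eq_square algebra_simps)
qed (simp add: KE_0 m2_def)

text \<open>What matters later is the leading coefficient \<open>\<alpha> ^ 3\<close>: below 1 it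
  gives the drift, different from 1 it makes the Poisson equation solvable. The lower coefficients
  stay existential.\<close>

lemma KE_cube_ex: "\<exists>b c d. \<forall>x. KE (\<lambda>y. (real y) ^ 3) x = \<alpha> ^ 3 * (real x) ^ 3 + b * (real x)\<^sup>2 + c * real x + d"
proof -
  define f where "f = KE (\<lambda>y. (real y) ^ 3)"
  define p where "p = \<alpha> * (1 - \<alpha>) + 2 * \<mu> * \<alpha>"
  have rec: "f (Suc x) = f x + \<alpha> * (3 * (\<alpha>\<^sup>2 * (real x)\<^sup>2 + p * real x + m2) + 3 * (\<alpha> * real x + \<mu>) + 1)" for x
  proof -
    have "f (Suc x) = \<alpha> * KE (\<lambda>y. (real (Suc y)) ^ 3) x + (1 - \<alpha>) * f x"
      unfolding f_def using cubic_growth_power[of 3] by (intro KE_Suc) simp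
    also have "KE (\<lambda>y. (real (Suc y)) ^ 3) x = KE (\<lambda>y. (real y) ^ 3 + 3 * (real y)\<^sup>2 + 3 * real y + 1) x"
      by (intro Bochner_Integration.integral_cong) (auto simp: power2_eq_square power3_eq_cube algebra_simps)
    also have "\<dots> = f x + 3 * KE (\<lambda>y. (real y)\<^sup>2) x + 3 * KE real x + 1"
      unfolding f_def using integrable_K_real integrable_K_square integrable_K_cube by simp
    finally show ?thesis by (simp add: KE_real KE_square p_def algebra_simps)
  qed
  define b where "b = 3 * \<alpha> * (p + \<alpha> - \<alpha>\<^sup>2) / 2"
  define c where "c = \<alpha> * (3 * m2 + 3 * \<mu> + 1) - \<alpha> ^ 3 - b"
  text \<open>These coefficients make the cubic with leading coefficient \<open>\<alpha>\<^sup>3\<close> satisfy \<open>rec\<close>.\<close>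
  have "f x = \<alpha> ^ 3 * (real x) ^ 3 + b * (real x)\<^sup>2 + c * real x + m3" for x
  proof (induction x)
    case (Suc x)
    show ?case unfolding rec Suc c_def b_def
      by (simp add: add_divide_distrib diff_divide_distrib power2_eq_square power3_eq_cube) argo
  qed (simp add: f_def KE_0 m3_def)
  then show ?thesis unfolding f_def by blast
qed

text \<open>The variance of a binomial with \<open>x\<close> trials plus the variance of an
  innovation.\<close>

lemma KE_centered_square: "KE (\<lambda>y. (real y - \<alpha> * real x - \<mu>)\<^sup>2) x = \<alpha> * (1 - \<alpha>) * real x + \<sigma>e"
proof -
  have "KE (\<lambda>y. (real y - \<alpha> * real x - \<mu>)\<^sup>2) x
      = KE (\<lambda>y. (real y)\<^sup>2 - 2 * (\<alpha> * real x + \<mu>) * real y + (\<alpha> * real x + \<mu>)\<^sup>2) x"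
    by (intro Bochner_Integration.integral_cong refl) (simp add: power2_eq_square algebra_simps)
  also have "\<dots> = KE (\<lambda>y. (real y)\<^sup>2) x - 2 * (\<alpha> * real x + \<mu>) * KE real x + (\<alpha> * real x + \<mu>)\<^sup>2"
    using integrable_K_real integrable_K_square by simp
  finally show ?thesis
    unfolding KE_real KE_square \<sigma>e_def by (simp add: power2_eq_square algebra_simps)
qed

lemma \<sigma>e_nonneg: "0 \<le> \<sigma>e"
  using KE_centered_square[of 0] integral_nonneg_AE[of "\<lambda>y. (real y - \<mu>)\<^sup>2" "K 0"] by simp

text \<open>A cubic bound on \<open>f\<close> reduces this to \<open>KE_cube_ex\<close>. The
  stability keeps one-step errors of the corrected characteristic functions integrable along the
  chain.\<close>

lemma cubic_growth_KE:
  fixes f :: "nat \<Rightarrow> 'b::{banach, second_countable_topology}"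
  assumes f: "cubic_growth f" shows "cubic_growth (KE f)"
proof -
  obtain C where C: "0 \<le> C" "\<And>x. norm (f x) \<le> C * (1 + real x ^ 3)" using cubic_growth_ex[OF f] by blast
  obtain b c d where K: "\<And>x. KE (\<lambda>y. (real y) ^ 3) x = \<alpha> ^ 3 * (real x) ^ 3 + b * (real x)\<^sup>2 + c * real x + d"
    using KE_cube_ex by blast
  have "cubic_growth (\<lambda>x. \<alpha> ^ 3 * (real x) ^ 3 + b * (real x) ^ 2 + c * (real x) ^ 1 + d)"
    by (intro cubic_growth_add cubic_growth_mult cubic_growth_power cubic_growth_const) simp_all
  then have "cubic_growth (KE (\<lambda>y. (real y) ^ 3))"
    unfolding K power_one_right .
  then have g: "cubic_growth (\<lambda>x. C * (1 + KE (\<lambda>y. (real y) ^ 3) x))"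
    by (intro cubic_growth_add cubic_growth_mult cubic_growth_const)
  show ?thesis
  proof (rule cubic_growth_mono[OF g])
    fix x
    have "norm (KE f x) \<le> KE (\<lambda>y. norm (f y)) x" by (rule integral_norm_bound)
    also have "\<dots> \<le> KE (\<lambda>y. C * (1 + real y ^ 3)) x"
      using integrable_K_cube C f
      by (intro integral_mono integrable_K cubic_growth_norm cubic_growth_mult cubic_growth_add cubic_growth_const cubic_growth_power) auto
    also have "\<dots> = C * (1 + KE (\<lambda>y. (real y) ^ 3) x)" using integrable_K_cube by simp
    finally show "norm (KE f x) \<le> norm (C * (1 + KE (\<lambda>y. (real y) ^ 3) x))" by simp
  qed
qed

end

section \<open>Drift and the third moment of the stationary law\<close>

context inar_law
begin

lemma drift:
  "\<exists>r B. 0 < r \<and> r < 1 \<and> 0 \<le> B \<and> (\<forall>x. KE (\<lambda>y. (real y) ^ 3) x \<le> r * (real x) ^ 3 + B)"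
proof -
  obtain b c d where K: "\<And>x. KE (\<lambda>y. (real y) ^ 3) x = \<alpha> ^ 3 * (real x) ^ 3 + b * (real x)\<^sup>2 + c * real x + d"
    using KE_cube_ex by blast
  \<comment> \<open>Half of the gap between \<open>\<alpha> ^ 3\<close> and 1: one half absorbs the
    lower order terms, the other keeps the rate \<open>\<alpha> ^ 3 + \<delta>\<close> below
    1.\<close>
  define \<delta> where "\<delta> = (1 - \<alpha> ^ 3) / 2"
  have a3: "\<alpha> ^ 3 < 1" "0 < \<alpha> ^ 3" using \<alpha>_pos \<alpha>_less_1 power_Suc_less_one[of \<alpha> 2] by auto
  have \<delta>: "0 < \<delta>" using a3 by (simp add: \<delta>_def)
  define S where "S = \<bar>b\<bar> + \<bar>c\<bar> + \<bar>d\<bar>"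
  have S: "0 \<le> S" by (simp add: S_def)
  have "b * (real x)\<^sup>2 + c * real x + d \<le> \<delta> * real x ^ 3 + S * (1 + (S / \<delta>)\<^sup>2)" for x
  proof -
    have 1: "b * (real x)\<^sup>2 \<le> \<bar>b\<bar> * (1 + (real x)\<^sup>2)"
    proof -
      have "b * (real x)\<^sup>2 \<le> \<bar>b\<bar> * (real x)\<^sup>2" by (intro mult_right_mono) auto
      also have "\<dots> \<le> \<bar>b\<bar> * (1 + (real x)\<^sup>2)" by (intro mult_left_mono) auto
      finally show ?thesis .
    qed
    have 2: "c * real x \<le> \<bar>c\<bar> * (1 + (real x)\<^sup>2)"
    proof -
      have "c * real x \<le> \<bar>c\<bar> * real x" by (intro mult_right_mono) auto
      also have "real x \<le> 1 + (real x)\<^sup>2"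
        using zero_le_power2[of "real x - 1"] by (simp add: power2_diff) 
      finally show ?thesis by (simp add: mult_left_mono)
    qed
    have 3: "d \<le> \<bar>d\<bar> * (1 + (real x)\<^sup>2)"
      by (rule order_trans[of _ "\<bar>d\<bar>"]) (auto simp: mult_le_cancel_left1)
    \<comment> \<open>Beyond \<open>S / \<delta>\<close> the cubic term dominates the quadratic one;
      below it the quadratic term is bounded.\<close>
    have 4: "S * (real x)\<^sup>2 \<le> \<delta> * real x ^ 3 + S * (S / \<delta>)\<^sup>2"
    proof (cases "S / \<delta> \<le> real x")
      case True
      then have "S \<le> \<delta> * real x" using \<delta> by (simp add: pos_divide_le_eq mult.commute)
      then have "S * (real x)\<^sup>2 \<le> \<delta> * real x * (real x)\<^sup>2" by (rule mult_right_mono) simp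
      then show ?thesis using S by (simp add: power2_eq_square power3_eq_cube mult.assoc add_increasing2)
    next
      case False
      then have "(real x)\<^sup>2 \<le> (S / \<delta>)\<^sup>2" by (intro power_mono) auto
      then have "S * (real x)\<^sup>2 \<le> S * (S / \<delta>)\<^sup>2" using S by (rule mult_left_mono)
      then show ?thesis using \<delta> by (simp add: add_increasing)
    qed
    have "b * (real x)\<^sup>2 + c * real x + d \<le> S * (1 + (real x)\<^sup>2)"
      using 1 2 3 unfolding S_def distrib_right[of _ _ "1 + (real x)\<^sup>2"] by linarith
    then show ?thesis using 4 by (simp add: algebra_simps)
  qed
  then have "KE (\<lambda>y. (real y) ^ 3) x \<le> (\<alpha> ^ 3 + \<delta>) * (real x) ^ 3 + S * (1 + (S / \<delta>)\<^sup>2)" for x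
    unfolding K distrib_right[of "\<alpha> ^ 3"] by (simp add: add.assoc)
  moreover have "0 < \<alpha> ^ 3 + \<delta>" "\<alpha> ^ 3 + \<delta> < 1"
    unfolding \<delta>_def using a3 by argo+
  moreover have "0 \<le> S * (1 + (S / \<delta>)\<^sup>2)" using S by simp
  ultimately show ?thesis by blast
qed

lemma bind_\<pi>: "bind_pmf \<pi> K = \<pi>"
  using stat by (simp add: inar_stationary_def)

lemma nn_integral_\<pi>: "(\<integral>\<^sup>+x. \<integral>\<^sup>+y. g y \<partial>K x \<partial>\<pi>) = (\<integral>\<^sup>+x. g x \<partial>\<pi>)"
  using nn_integral_bind_pmf[where f=g and M=\<pi> and N=K] by (simp add: bind_\<pi>)

lemma expectation_KE_\<pi>:
  fixes f :: "nat \<Rightarrow> real"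
  assumes "integrable \<pi> f" "\<And>x. integrable (K x) f"
  shows "integrable \<pi> (KE f)" "measure_pmf.expectation \<pi> (KE f) = measure_pmf.expectation \<pi> f"
  using integral_bind_pmf_integrable[of \<pi> K f] assms by (simp_all add: bind_\<pi>)

text \<open>The drift inequality cannot be integrated against \<open>\<pi>\<close> before the third moment is known to be
  finite; it is applied to the truncations \<open>min V R\<close>, with Fatou's lemma as \<open>R\<close> grows.\<close>
lemma integrable_\<pi>_cube: "integrable \<pi> (\<lambda>x. real x ^ 3)"
proof -
  obtain r B where L: "0 < r" "r < 1" "0 \<le> B" and dr: "\<And>x. KE (\<lambda>y. (real y) ^ 3) x \<le> r * (real x) ^ 3 + B"
    using drift by blast
  define V where "V x = real x ^ 3" for x :: nat
  \<comment> \<open>By stationarity the truncation of \<open>V\<close> has the same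
    \<open>\<pi>\<close>-mean as its image under the kernel, which is at most
    \<open>min (r * V x + B) R\<close>; hence \<open>f R\<close> has mean at most \<open>B\<close>.
    The summand \<open>B\<close> keeps \<open>f R\<close> nonnegative, as Fatou requires, and for
    large \<open>R\<close> the value is exactly \<open>(1 - r) * V x\<close>.\<close>
  define f where "f R x = min (V x) (real R) + B - min (r * V x + B) (real R)" for R x :: nat
  have V0: "0 \<le> V x" for x by (simp add: V_def)
  have lV: "r * V x \<le> V x" for x using L V0[of x] by (simp add: mult_left_le_one_le)
  have f0: "0 \<le> f R x" for R x
    using lV[of x] L V0[of x] by (auto simp: f_def min_def)
  have bnd: "integrable (measure_pmf p) (\<lambda>x. min (g x) (real R))" if "\<And>x. 0 \<le> g x" for g :: "nat \<Rightarrow> real" and R p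
    using that by (intro measure_pmf.integrable_const_bound[where B="real R"]) auto
  have le: "(\<integral>\<^sup>+x. ennreal (f R x) \<partial>\<pi>) \<le> ennreal B" for R
  proof -
    have b1: "integrable (measure_pmf p) (\<lambda>x. min (V x) (real R))" for p by (rule bnd[OF V0])
    have b2: "integrable (measure_pmf p) (\<lambda>x. min (r * V x + B) (real R))" for p
      using L V0 by (intro bnd) auto
    have i: "integrable \<pi> (f R)" unfolding f_def using b1[of \<pi>] b2[of \<pi>] by auto
    have KEle: "KE (\<lambda>x. min (V x) (real R)) x \<le> min (r * V x + B) (real R)" for x
    proof (rule min.boundedI)
      have "KE (\<lambda>x. min (V x) (real R)) x \<le> KE V x"
        using b1[of "K x"] integrable_K_cube[of x] by (intro integral_mono) (auto simp: V_def[abs_def])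
      then show "KE (\<lambda>x. min (V x) (real R)) x \<le> r * V x + B" using order_trans[OF _ dr[of x]] by (simp add: V_def[abs_def])
      have "KE (\<lambda>x. min (V x) (real R)) x \<le> KE (\<lambda>_. real R) x"
        using b1[of "K x"] by (intro integral_mono) auto
      then show "KE (\<lambda>x. min (V x) (real R)) x \<le> real R" by simp
    qed
    have "(\<integral>x. min (V x) (real R) \<partial>\<pi>) \<le> (\<integral>x. min (r * V x + B) (real R) \<partial>\<pi>)"
      using integral_mono[OF expectation_KE_\<pi>(1)[OF b1 b1] b2 KEle] expectation_KE_\<pi>(2)[OF b1 b1] by simp
    then have "(\<integral>x. f R x \<partial>\<pi>) \<le> B"
      unfolding f_def using b1[of \<pi>] b2[of \<pi>] by simp
    then show ?thesis
      by (subst nn_integral_eq_integral[OF i]) (auto simp: f0 ennreal_leI)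
  qed
  have lim: "(\<lambda>R. f R x) \<longlonglongrightarrow> (1 - r) * V x" for x
  proof (rule tendsto_eventually)
    obtain R0 :: nat where R0: "V x + B \<le> real R0" using real_arch_simple by blast
    show "\<forall>\<^sub>F R in sequentially. f R x = (1 - r) * V x"
      using eventually_ge_at_top[of R0]
    proof eventually_elim
      case (elim R)
      then have "V x + B \<le> real R" using R0 by linarith
      then have "V x \<le> real R" "r * V x + B \<le> real R" using L lV[of x] by auto
      then show ?case by (simp add: f_def algebra_simps)
    qed
  qed
  have "(\<integral>\<^sup>+x. ennreal ((1 - r) * V x) \<partial>\<pi>) = (\<integral>\<^sup>+x. liminf (\<lambda>R. ennreal (f R x)) \<partial>\<pi>)"
    using lim by (intro nn_integral_cong lim_imp_Liminf[symmetric] tendsto_ennrealI) auto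
  also have "\<dots> \<le> liminf (\<lambda>R. \<integral>\<^sup>+x. ennreal (f R x) \<partial>\<pi>)"
    by (rule nn_integral_liminf) auto
  also have "\<dots> \<le> liminf (\<lambda>R. ennreal B)" using le by (intro Liminf_mono) auto
  also have "\<dots> = ennreal B" by (simp add: Liminf_const)
  finally have "integrable \<pi> (\<lambda>x. (1 - r) * V x)"
    using L V0 by (intro integrableI_bounded) (auto simp: le_less_trans)
  then show ?thesis using L by (simp add: V_def)
qed

lemma integrable_\<pi>:
  fixes f :: "nat \<Rightarrow> 'b::{banach, second_countable_topology}"
  shows "cubic_growth f \<Longrightarrow> integrable \<pi> f"
  using integrable_cubic_growth integrable_\<pi>_cube by blast

section \<open>The Poisson equation for polynomials up to degree three\<close>

definition poisson_solvable :: "(nat \<Rightarrow> real) \<Rightarrow> bool" where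
  "poisson_solvable f \<longleftrightarrow> (\<exists>u c. cubic_growth u \<and> (\<forall>x. u x - KE u x = f x - c))"

lemma poisson_solvable_const: "poisson_solvable (\<lambda>x. d)"
  unfolding poisson_solvable_def
  by (intro exI[of _ "\<lambda>x. 0"] exI[of _ d]) (auto simp: cubic_growth_const)

lemma poisson_solvable_add:
  assumes "poisson_solvable f" "poisson_solvable g"
  shows "poisson_solvable (\<lambda>x. f x + g x)"
proof -
  obtain u c where u: "cubic_growth u" "\<And>x. u x - KE u x = f x - c"
    using assms(1) unfolding poisson_solvable_def by blast
  obtain v d where v: "cubic_growth v" "\<And>x. v x - KE v x = g x - d"
    using assms(2) unfolding poisson_solvable_def by blast
  have "u x + v x - KE (\<lambda>x. u x + v x) x = f x + g x - (c + d)" for x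
    using u(2)[of x] v(2)[of x] integrable_K[OF u(1), of x] integrable_K[OF v(1), of x] by simp
  then show ?thesis
    unfolding poisson_solvable_def using cubic_growth_add[OF u(1) v(1)] by blast
qed

lemma poisson_solvable_mult:
  assumes "poisson_solvable f" shows "poisson_solvable (\<lambda>x. a * f x)"
proof -
  obtain u c where u: "cubic_growth u" "\<And>x. u x - KE u x = f x - c"
    using assms(1) unfolding poisson_solvable_def by blast
  have "a * u x - KE (\<lambda>x. a * u x) x = a * f x - a * c" for x
    using arg_cong[OF u(2)[of x], of "\<lambda>z. a * z"] by (simp add: right_diff_distrib)
  then show ?thesis
    unfolding poisson_solvable_def using cubic_growth_mult[OF u(1)] by blast
qed

text \<open>\<open>K\<close> acts triangularly on monomials, with diagonal entries \<open>\<alpha> ^ j \<noteq> 1\<close>.\<close>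
lemma poisson_solvable_step:
  assumes p: "cubic_growth p" and Kp: "\<And>x. KE p x = a * p x + l x" and a: "a \<noteq> 1"
    and l: "poisson_solvable l"
  shows "poisson_solvable p"
proof -
  obtain u c where u: "cubic_growth u" "\<And>x. u x - KE u x = l x - c"
    using l unfolding poisson_solvable_def by blast
  have "(p x + u x) - KE (\<lambda>x. p x + u x) x = (1 - a) * p x - c" for x
    using u(2)[of x] integrable_K[OF u(1), of x] integrable_K[OF p, of x] Kp[of x] by (simp add: algebra_simps)
  then have "poisson_solvable (\<lambda>x. (1 - a) * p x)"
    unfolding poisson_solvable_def using cubic_growth_add[OF p u(1)] by blast
  from poisson_solvable_mult[OF this, of "1 / (1 - a)"] a show ?thesis by simp
qed

lemma \<alpha>_power_neq_1: "0 < j \<Longrightarrow> \<alpha> ^ j \<noteq> 1"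
  using \<alpha>_pos \<alpha>_less_1 by (metis less_eq_real_def less_irrefl power_Suc_less_one power_less_one_iff)

lemma poisson_solvable_real: "poisson_solvable real"
  by (rule poisson_solvable_step[OF _ KE_real])
    (use \<alpha>_less_1 cubic_growth_power[of 1] poisson_solvable_const in auto)

lemma poisson_solvable_square: "poisson_solvable (\<lambda>x. (real x)\<^sup>2)"
proof (rule poisson_solvable_step)
  show "KE (\<lambda>y. (real y)\<^sup>2) x = \<alpha>\<^sup>2 * (real x)\<^sup>2 + ((\<alpha> * (1 - \<alpha>) + 2 * \<mu> * \<alpha>) * real x + m2)" for x
    by (simp add: KE_square)
  show "poisson_solvable (\<lambda>x. (\<alpha> * (1 - \<alpha>) + 2 * \<mu> * \<alpha>) * real x + m2)"
    by (intro poisson_solvable_add poisson_solvable_mult poisson_solvable_const poisson_solvable_real)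
qed (use \<alpha>_power_neq_1[of 2] cubic_growth_power[of 2] in auto)

lemma poisson_solvable_cube: "poisson_solvable (\<lambda>x. real x ^ 3)"
proof -
  obtain b c d where K: "\<And>x. KE (\<lambda>y. (real y) ^ 3) x = \<alpha> ^ 3 * (real x) ^ 3 + b * (real x)\<^sup>2 + c * real x + d"
    using KE_cube_ex by blast
  show ?thesis
  proof (rule poisson_solvable_step)
    show "KE (\<lambda>y. (real y) ^ 3) x = \<alpha> ^ 3 * (real x) ^ 3 + (b * (real x)\<^sup>2 + c * real x + d)" for x
      by (simp add: K)
    show "poisson_solvable (\<lambda>x. b * (real x)\<^sup>2 + c * real x + d)"
      by (intro poisson_solvable_add poisson_solvable_mult poisson_solvable_const
          poisson_solvable_real poisson_solvable_square)
  qed (use \<alpha>_power_neq_1[of 3] cubic_growth_power[of 3] in auto)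
qed

text \<open>The constant in \<open>poisson_solvable\<close> is left free and identified only here:
  \<open>u - KE u\<close> has \<open>\<pi>\<close>-mean zero, so the constant must be the stationary
  mean of \<open>f\<close>.\<close>

lemma poisson_solution:
  assumes "poisson_solvable f" "cubic_growth f"
  obtains u where "cubic_growth u" "\<And>x. u x - KE u x = f x - measure_pmf.expectation \<pi> f"
proof -
  obtain u c where u: "cubic_growth u" "\<And>x. u x - KE u x = f x - c"
    using assms(1) unfolding poisson_solvable_def by blast
  note E = expectation_KE_\<pi>[OF integrable_\<pi>[OF u(1)] integrable_K[OF u(1)]]
  have "(\<integral>x. u x - KE u x \<partial>\<pi>) = 0"
    using E integrable_\<pi>[OF u(1)] by simp
  then have "c = measure_pmf.expectation \<pi> f"
    unfolding u(2) using integrable_\<pi>[OF assms(2)] by simp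
  with u that show thesis by blast
qed

definition "EX2 = measure_pmf.expectation \<pi> (\<lambda>x. (real x)\<^sup>2)"
definition "EX3 = measure_pmf.expectation \<pi> (\<lambda>x. real x ^ 3)"
text \<open>The conditional variance of the martingale increment
  \<open>x * (y - \<alpha> * x - \<mu>)\<close> at state \<open>x\<close>; \<open>V\<close> is its
  stationary mean, so the asymptotic variance is \<open>V / EX2 ^ 2\<close>.\<close>

definition "v0 x = (real x)\<^sup>2 * (\<alpha> * (1 - \<alpha>) * real x + \<sigma>e)"
definition "V = \<alpha> * (1 - \<alpha>) * EX3 + \<sigma>e * EX2"

lemma v0_poly: "v0 x = \<alpha> * (1 - \<alpha>) * real x ^ 3 + \<sigma>e * (real x)\<^sup>2"
  by (simp add: v0_def power2_eq_square power3_eq_cube algebra_simps)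

lemma cubic_growth_v0: "cubic_growth v0"
  unfolding v0_poly by (intro cubic_growth_add cubic_growth_mult cubic_growth_power) auto

lemma expectation_v0: "measure_pmf.expectation \<pi> v0 = V"
  unfolding v0_poly V_def EX2_def EX3_def
  using integrable_\<pi>[OF cubic_growth_power[of 2]] integrable_\<pi>[OF cubic_growth_power[of 3]]
  by simp

text \<open>The right-hand side is the limit of \<open>n\<close> times the conditional
  characteristic function minus one, centred at its stationary mean. Two real Poisson equations are
  combined linearly.\<close>

lemma poisson_complex:
  fixes a b :: real
  obtains u :: "nat \<Rightarrow> complex" where "cubic_growth u"
    "\<And>x. u x - KE u x = (of_real (- (a\<^sup>2) / 2 * v0 x) + \<i> * of_real (b * (real x)\<^sup>2))
           - (of_real (- (a\<^sup>2) / 2 * V) + \<i> * of_real (b * EX2))"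
proof -
  have "poisson_solvable v0"
    unfolding v0_poly
    by (intro poisson_solvable_add poisson_solvable_mult poisson_solvable_cube poisson_solvable_square)
  then obtain u where u: "cubic_growth u" "\<And>x. u x - KE u x = v0 x - V"
    using poisson_solution[OF _ cubic_growth_v0] unfolding expectation_v0 by blast
  obtain w where w: "cubic_growth w" "\<And>x. w x - KE w x = (real x)\<^sup>2 - EX2"
    using poisson_solution[OF poisson_solvable_square] cubic_growth_power[of 2] unfolding EX2_def by auto
  define g :: "nat \<Rightarrow> complex" where
    "g x = of_real (- (a\<^sup>2) / 2) * of_real (u x) + \<i> * of_real b * of_real (w x)" for x
  have g: "cubic_growth g"
    unfolding g_def using u(1) w(1) by (intro cubic_growth_add cubic_growth_mult cubic_growth_of_real)
  have iu: "integrable (K x) (\<lambda>y. of_real (u y) :: complex)" for x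
    by (intro integrable_K cubic_growth_of_real u)
  have iw: "integrable (K x) (\<lambda>y. of_real (w y) :: complex)" for x
    by (intro integrable_K cubic_growth_of_real w)
  have KEg: "KE g x = of_real (- (a\<^sup>2) / 2) * of_real (KE u x) + \<i> * of_real b * of_real (KE w x)" for x
    unfolding g_def using iu[of x] iw[of x]
    by (subst Bochner_Integration.integral_add)
      (auto simp del: of_real_divide of_real_minus of_real_power simp: integral_complex_of_real mult.assoc)
  have "g x - KE g x = of_real (- (a\<^sup>2) / 2) * of_real (u x - KE u x) + \<i> * of_real b * of_real (w x - KE w x)" for x
    unfolding KEg by (simp only: g_def of_real_diff right_diff_distrib) (simp add: algebra_simps)
  then have "g x - KE g x = (of_real (- (a\<^sup>2) / 2 * v0 x) + \<i> * of_real (b * (real x)\<^sup>2))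
           - (of_real (- (a\<^sup>2) / 2 * V) + \<i> * of_real (b * EX2))" for x
    unfolding u w by (simp add: algebra_simps)
  with g that show thesis by blast
qed

text \<open>If \<open>\<pi>\<close> sat at 0, one step from 0, which has law \<open>e\<close>, would
  stay at 0, against nontrivial innovations.\<close>

lemma \<pi>_positive: "\<exists>x>0. x \<in> set_pmf \<pi>"
proof (rule ccontr)
  assume "\<not> ?thesis"
  then have "set_pmf \<pi> \<subseteq> {0}" by auto
  then have "\<pi> = return_pmf 0" by (simp add: set_pmf_subset_singleton)
  then have "e = return_pmf 0" using bind_\<pi> by (simp add: bind_return_pmf K_0)
  then show False using e_nontriv by simp
qed

lemma EX_pos: "j \<le> 3 \<Longrightarrow> 0 < j \<Longrightarrow> 0 < measure_pmf.expectation \<pi> (\<lambda>x. real x ^ j)"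
proof -
  assume j: "j \<le> 3" "0 < j"
  have i: "integrable \<pi> (\<lambda>x. real x ^ j)" by (intro integrable_\<pi> cubic_growth_power j)
  have "measure_pmf.expectation \<pi> (\<lambda>x. real x ^ j) \<noteq> 0"
  proof
    assume "measure_pmf.expectation \<pi> (\<lambda>x. real x ^ j) = 0"
    then have "AE x in \<pi>. real x ^ j = 0"
      using integral_nonneg_eq_0_iff_AE[OF i] by simp
    then show False using \<pi>_positive j by (auto simp: AE_measure_pmf_iff)
  qed
  moreover have "0 \<le> measure_pmf.expectation \<pi> (\<lambda>x. real x ^ j)" by simp
  ultimately show ?thesis by linarith
qed

lemma EX2_pos: "0 < EX2" using EX_pos[of 2] by (simp add: EX2_def)

lemma V_pos: "0 < V"
  using EX_pos[of 3] EX2_pos \<sigma>e_nonneg \<alpha>_pos \<alpha>_less_1 unfolding V_def EX3_def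
  by (intro add_pos_nonneg mult_pos_pos mult_nonneg_nonneg) auto

end

subsection \<open>Markov chains with the transition kernel\<close>

lemma integral_bind_pmf_complex:
  fixes f :: "'b \<Rightarrow> complex"
  assumes f: "integrable (measure_pmf (bind_pmf p k)) f"
    and fk: "\<And>x. integrable (measure_pmf (k x)) f"
  shows "measure_pmf.expectation (bind_pmf p k) f
           = measure_pmf.expectation p (\<lambda>x. measure_pmf.expectation (k x) f)"
proof -
  note R = integral_bind_pmf_integrable[OF integrable_Re[OF f] integrable_Re[OF fk]]
  note I = integral_bind_pmf_integrable[OF integrable_Im[OF f] integrable_Im[OF fk]]
  have i: "integrable p (\<lambda>x. measure_pmf.expectation (k x) f)"
  proof -
    have "integrable p (\<lambda>x. of_real (\<integral>y. Re (f y) \<partial>k x) + \<i> * of_real (\<integral>y. Im (f y) \<partial>k x))"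
      using R(1) I(1) by auto
    moreover have "of_real (\<integral>y. Re (f y) \<partial>k x) + \<i> * of_real (\<integral>y. Im (f y) \<partial>k x) = (\<integral>y. f y \<partial>k x)" for x
      using fk[of x] by (simp add: complex_eq_iff)
    ultimately show ?thesis by simp
  qed
  show ?thesis
    using R(2) I(2) f fk i by (intro complex_eqI) simp_all
qed

text \<open>To be used with \<open>A\<close> of order \<open>1 / sqrt n\<close> and \<open>B\<close>
  of order \<open>1 / n\<close>: only the linear term in \<open>A\<close>, which has conditional
  mean zero, is subtracted, and the remainder is of order \<open>1 / n\<close>.\<close>

lemma iexp_perturb_bound:
  fixes A B :: real
  shows "cmod (iexp (A + B) - 1 - \<i> * A) \<le> \<bar>B\<bar> + A\<^sup>2 / 2"
proof -
  have "iexp (A + B) - 1 - \<i> * A = iexp A * (iexp B - 1) + (iexp A - 1 - \<i> * A)"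
    by (simp add: exp_add distrib_left algebra_simps)
  then have "cmod (iexp (A + B) - 1 - \<i> * A) \<le> cmod (iexp A * (iexp B - 1)) + cmod (iexp A - 1 - \<i> * A)"
    by (simp only: norm_triangle_ineq)
  also have "cmod (iexp A * (iexp B - 1)) \<le> \<bar>B\<bar>"
    using iexp_approx1[of B 0] by (simp add: norm_mult)
  also have "cmod (iexp A - 1 - \<i> * A) \<le> A\<^sup>2 / 2"
    using iexp_approx1[of A 1] by (simp add: power2_eq_square diff_diff_eq abs_mult_self_eq numeral_2_eq_2)
  finally show ?thesis by simp
qed

lemma (in prob_space) distr_eq_pmf:
  fixes f :: "'a \<Rightarrow> 'b::countable"
  assumes [measurable]: "f \<in> measurable M (count_space UNIV)"
  obtains q :: "'b pmf" where "distr M (count_space UNIV) f = measure_pmf q"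
proof -
  let ?D = "distr M (count_space UNIV) f"
  interpret D: prob_space ?D by (rule prob_space_distr) simp
  have "AE x in ?D. measure ?D {x} \<noteq> 0"
    by (subst D.AE_support_countable) (auto intro!: exI[of _ UNIV])
  then have "measure_pmf (Abs_pmf ?D) = ?D"
    by (intro Abs_pmf_inverse) (simp add: D.prob_space_axioms)
  with that show thesis by metis
qed

text \<open>The history as a single list: lists over a countable type are countable, so its law is a
  pmf and conditioning on the past becomes \<open>bind_pmf\<close>. Time 0 is included, hence the
  length \<open>Suc n\<close>.\<close>

definition traj :: "(nat \<Rightarrow> 'a \<Rightarrow> nat) \<Rightarrow> nat \<Rightarrow> 'a \<Rightarrow> nat list" where
  "traj Z n \<omega> = map (\<lambda>k. Z k \<omega>) [0..<Suc n]"

lemma length_traj[simp]: "length (traj Z n \<omega>) = Suc n"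
  by (simp add: traj_def)

lemma nth_traj[simp]: "k \<le> n \<Longrightarrow> traj Z n \<omega> ! k = Z k \<omega>"
  by (simp add: traj_def del: upt_Suc)

lemma last_traj[simp]: "last (traj Z n \<omega>) = Z n \<omega>"
  by (simp add: traj_def)

lemma measurable_traj:
  assumes "\<And>k. k \<le> n \<Longrightarrow> Z k \<in> measurable M (count_space UNIV)"
  shows "traj Z n \<in> measurable M (count_space UNIV)"
  using assms
proof (induction n)
  case 0
  then have [measurable]: "Z 0 \<in> measurable M (count_space UNIV)" by simp
  have "traj Z 0 = (\<lambda>\<omega>. [Z 0 \<omega>])" by (auto simp: traj_def)
  then show ?case by simp
next
  case (Suc n)
  then have [measurable]: "traj Z n \<in> measurable M (count_space UNIV)" "Z (Suc n) \<in> measurable M (count_space UNIV)"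
    by auto
  have "traj Z (Suc n) = (\<lambda>\<omega>. (\<lambda>(x, y). x @ [y]) (traj Z n \<omega>, Z (Suc n) \<omega>))" by (auto simp: traj_def)
  then show ?case by simp
qed

text \<open>The Markov property is required given the whole history, since the characteristic
  functions carry a product over all earlier increments. The initial law is free apart from its
  third moment, so that the original chain and its restarts under conditional measures are both
  instances.\<close>

locale inar_chain = inar_law \<alpha> e \<pi> + prob_space P
  for \<alpha> :: real and e \<pi> :: "nat pmf" and P :: "'a measure" +
  fixes Z :: "nat \<Rightarrow> 'a \<Rightarrow> nat"
  assumes Z_measurable[measurable]: "\<And>k. Z k \<in> measurable P (count_space UNIV)"
    and Z0_cube: "integrable P (\<lambda>\<omega>. real (Z 0 \<omega>) ^ 3)"
    and markov: "\<And>n xs y. length xs = Suc n \<Longrightarrow>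
      prob {\<omega>\<in>space P. traj Z n \<omega> = xs \<and> Z (Suc n) \<omega> = y}
        = prob {\<omega>\<in>space P. traj Z n \<omega> = xs} * pmf (K (last xs)) y"
begin

lemma traj_measurable[measurable]: "traj Z n \<in> measurable P (count_space UNIV)"
  by (rule measurable_traj) simp

lemma pair_measurable: "(\<lambda>\<omega>. (traj Z n \<omega>, Z (Suc n) \<omega>)) \<in> measurable P (count_space UNIV)"
proof -
  have "(\<lambda>\<omega>. (butlast (traj Z (Suc n) \<omega>), last (traj Z (Suc n) \<omega>))) \<in> measurable P (count_space UNIV)"
    by (rule measurable_compose[OF traj_measurable]) simp
  also have "(\<lambda>\<omega>. (butlast (traj Z (Suc n) \<omega>), last (traj Z (Suc n) \<omega>))) = (\<lambda>\<omega>. (traj Z n \<omega>, Z (Suc n) \<omega>))"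
    by (auto simp: traj_def butlast_append)
  finally show ?thesis .
qed

lemma step_law:
  obtains q where "distr P (count_space UNIV) (traj Z n) = measure_pmf q"
    "distr P (count_space UNIV) (\<lambda>\<omega>. (traj Z n \<omega>, Z (Suc n) \<omega>))
       = measure_pmf (bind_pmf q (\<lambda>xs. map_pmf (Pair xs) (K (last xs))))"
proof -
  obtain q where q: "distr P (count_space UNIV) (traj Z n) = measure_pmf q"
    using distr_eq_pmf[OF traj_measurable] .
  note pm = pair_measurable[of n]
  obtain q' where q': "distr P (count_space UNIV) (\<lambda>\<omega>. (traj Z n \<omega>, Z (Suc n) \<omega>)) = measure_pmf q'"
    using distr_eq_pmf[OF pm] .
  have q_pmf: "pmf q xs = prob {\<omega>\<in>space P. traj Z n \<omega> = xs}" for xs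
  proof -
    have "pmf q xs = measure (distr P (count_space UNIV) (traj Z n)) {xs}"
      by (simp add: q measure_pmf_single)
    also have "\<dots> = prob {\<omega>\<in>space P. traj Z n \<omega> = xs}"
      by (subst measure_distr) (auto intro!: arg_cong[where f=prob])
    finally show ?thesis .
  qed
  have "q' = bind_pmf q (\<lambda>xs. map_pmf (Pair xs) (K (last xs)))"
  proof (rule pmf_eqI)
    fix z :: "nat list \<times> nat"
    obtain xs y where z: "z = (xs, y)" by fastforce
    have inj: "inj (Pair xs')" for xs' :: "nat list" by (simp add: inj_on_def)
    have "pmf (bind_pmf q (\<lambda>xs. map_pmf (Pair xs) (K (last xs)))) (xs, y)
        = (\<integral>xs'. pmf (map_pmf (Pair xs') (K (last xs'))) (xs, y) \<partial>q)"
      by (simp add: pmf_bind)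
    also have "\<dots> = (\<Sum>xs'\<in>{xs}. pmf q xs' *\<^sub>R pmf (map_pmf (Pair xs') (K (last xs'))) (xs, y))"
    proof (rule integral_measure_pmf)
      fix xs' assume "pmf (map_pmf (Pair xs') (K (last xs'))) (xs, y) \<noteq> 0"
      then have "(xs, y) \<in> set_pmf (map_pmf (Pair xs') (K (last xs')))" by (simp add: set_pmf_iff del: set_map_pmf)
      then show "xs' \<in> {xs}" by auto
    qed simp
    also have "\<dots> = pmf q xs * pmf (K (last xs)) y"
      by (simp add: pmf_map_inj'[OF inj])
    also have "\<dots> = prob {\<omega>\<in>space P. traj Z n \<omega> = xs \<and> Z (Suc n) \<omega> = y}"
    proof (cases "length xs = Suc n")
      case True
      then show ?thesis by (simp add: q_pmf markov)
    next
      \<comment> \<open>A list of the wrong length is never a trajectory, so both sides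
        vanish.\<close>
      case False
      then have "{\<omega>\<in>space P. traj Z n \<omega> = xs} = {}" "{\<omega>\<in>space P. traj Z n \<omega> = xs \<and> Z (Suc n) \<omega> = y} = {}"
        by auto
      then show ?thesis unfolding q_pmf by (simp only: measure_empty mult_zero_left)
    qed
    also have "\<dots> = measure (distr P (count_space UNIV) (\<lambda>\<omega>. (traj Z n \<omega>, Z (Suc n) \<omega>))) {(xs, y)}"
      using pm by (subst measure_distr) (auto intro!: arg_cong[where f=prob])
    also have "\<dots> = pmf q' (xs, y)" by (simp add: q' measure_pmf_single)
    finally show "pmf q' z = pmf (bind_pmf q (\<lambda>xs. map_pmf (Pair xs) (K (last xs)))) z"
      by (simp add: z)
  qed
  with q q' that show thesis by simp
qed

text \<open>Conditioning on the history written as an integral against the kernel; \<open>h\<close>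
  may depend on the whole path.\<close>

lemma expectation_step:
  fixes h :: "nat list \<Rightarrow> nat \<Rightarrow> complex"
  assumes i: "integrable P (\<lambda>\<omega>. h (traj Z n \<omega>) (Z (Suc n) \<omega>))"
    and ik: "\<And>xs. integrable (K (last xs)) (h xs)"
  shows "expectation (\<lambda>\<omega>. h (traj Z n \<omega>) (Z (Suc n) \<omega>))
       = expectation (\<lambda>\<omega>. KE (h (traj Z n \<omega>)) (Z n \<omega>))"
proof -
  obtain q where q: "distr P (count_space UNIV) (traj Z n) = measure_pmf q"
    "distr P (count_space UNIV) (\<lambda>\<omega>. (traj Z n \<omega>, Z (Suc n) \<omega>))
       = measure_pmf (bind_pmf q (\<lambda>xs. map_pmf (Pair xs) (K (last xs))))"
    by (rule step_law)
  let ?h = "\<lambda>(xs, y). h xs y"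
  have "expectation (\<lambda>\<omega>. h (traj Z n \<omega>) (Z (Suc n) \<omega>))
      = (\<integral>z. ?h z \<partial>distr P (count_space UNIV) (\<lambda>\<omega>. (traj Z n \<omega>, Z (Suc n) \<omega>)))"
    by (subst integral_distr[OF pair_measurable]) auto
  also have "\<dots> = (\<integral>xs. (\<integral>z. ?h z \<partial>map_pmf (Pair xs) (K (last xs))) \<partial>q)"
    unfolding q(2)
  proof (rule integral_bind_pmf_complex)
    show "integrable (bind_pmf q (\<lambda>xs. map_pmf (Pair xs) (K (last xs)))) ?h"
      unfolding q(2)[symmetric] using i by (subst integrable_distr_eq[OF pair_measurable]) auto
    show "integrable (map_pmf (Pair xs) (K (last xs))) ?h" for xs
      using ik[of xs] by simp
  qed
  also have "\<dots> = (\<integral>xs. KE (h xs) (last xs) \<partial>q)" by simp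
  also have "\<dots> = (\<integral>xs. KE (h xs) (last xs) \<partial>distr P (count_space UNIV) (traj Z n))"
    by (simp add: q(1))
  also have "\<dots> = expectation (\<lambda>\<omega>. KE (h (traj Z n \<omega>)) (Z n \<omega>))"
    by (subst integral_distr[OF traj_measurable]) auto
  finally show ?thesis .
qed

lemma nn_integral_step: "(\<integral>\<^sup>+\<omega>. g (Z (Suc n) \<omega>) \<partial>P) = (\<integral>\<^sup>+\<omega>. (\<integral>\<^sup>+y. g y \<partial>K (Z n \<omega>)) \<partial>P)"
proof -
  obtain q where q: "distr P (count_space UNIV) (traj Z n) = measure_pmf q"
    "distr P (count_space UNIV) (\<lambda>\<omega>. (traj Z n \<omega>, Z (Suc n) \<omega>))
       = measure_pmf (bind_pmf q (\<lambda>xs. map_pmf (Pair xs) (K (last xs))))"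
    by (rule step_law)
  have "(\<integral>\<^sup>+\<omega>. g (Z (Suc n) \<omega>) \<partial>P)
      = (\<integral>\<^sup>+z. g (snd z) \<partial>distr P (count_space UNIV) (\<lambda>\<omega>. (traj Z n \<omega>, Z (Suc n) \<omega>)))"
    by (subst nn_integral_distr[OF pair_measurable]) auto
  also have "\<dots> = (\<integral>\<^sup>+xs. (\<integral>\<^sup>+y. g y \<partial>K (last xs)) \<partial>q)"
    unfolding q(2) by simp
  also have "\<dots> = (\<integral>\<^sup>+xs. (\<integral>\<^sup>+y. g y \<partial>K (last xs)) \<partial>distr P (count_space UNIV) (traj Z n))"
    by (simp add: q(1))
  also have "\<dots> = (\<integral>\<^sup>+\<omega>. (\<integral>\<^sup>+y. g y \<partial>K (Z n \<omega>)) \<partial>P)"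
    by (subst nn_integral_distr[OF traj_measurable]) auto
  finally show ?thesis .
qed

text \<open>\<open>Z 0 + \<pi>\<close> (independent sum) dominates every \<open>Z k\<close> stochastically: thinning the
  first summand only decreases it, and \<open>\<pi>\<close> absorbs the innovations.\<close>
lemma stochastic_domination:
  assumes "mono g"
  shows "(\<integral>\<^sup>+\<omega>. g (Z k \<omega>) \<partial>P) \<le> (\<integral>\<^sup>+\<omega>. (\<integral>\<^sup>+y. g (Z 0 \<omega> + y) \<partial>\<pi>) \<partial>P)"
  using assms
proof (induction k arbitrary: g)
  case 0
  have "g (Z 0 \<omega>) \<le> (\<integral>\<^sup>+y. g (Z 0 \<omega> + y) \<partial>\<pi>)" for \<omega>
  proof -
    have "(\<integral>\<^sup>+y. g (Z 0 \<omega>) \<partial>\<pi>) \<le> (\<integral>\<^sup>+y. g (Z 0 \<omega> + y) \<partial>\<pi>)"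
      using 0 by (intro nn_integral_mono) (auto simp: mono_def)
    then show ?thesis by simp
  qed
  then show ?case by (intro nn_integral_mono)
next
  case (Suc k)
  have "(\<integral>\<^sup>+\<omega>. g (Z (Suc k) \<omega>) \<partial>P) \<le> (\<integral>\<^sup>+\<omega>. (\<integral>\<^sup>+y. (\<integral>\<^sup>+z. g z \<partial>K (Z 0 \<omega> + y)) \<partial>\<pi>) \<partial>P)"
    unfolding nn_integral_step by (rule Suc.IH[OF mono_nn_integral_K[OF Suc.prems]])
  also have "\<dots> \<le> (\<integral>\<^sup>+\<omega>. (\<integral>\<^sup>+y. (\<integral>\<^sup>+z. g (Z 0 \<omega> + z) \<partial>K y) \<partial>\<pi>) \<partial>P)"
    by (intro nn_integral_mono nn_integral_K_add_le Suc.prems)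
  also have "\<dots> = (\<integral>\<^sup>+\<omega>. (\<integral>\<^sup>+y. g (Z 0 \<omega> + y) \<partial>\<pi>) \<partial>P)"
    by (intro nn_integral_cong nn_integral_\<pi>)
  finally show ?case .
qed

section \<open>Moment and tail bounds uniform in time\<close>

lemma dominating_pmf:
  obtains \<rho> :: "nat pmf" where "integrable \<rho> (\<lambda>x. real x ^ 3)"
    "\<And>g k. mono g \<Longrightarrow> (\<integral>\<^sup>+\<omega>. g (Z k \<omega>) \<partial>P) \<le> (\<integral>\<^sup>+x. g x \<partial>\<rho>)"
proof -
  obtain \<nu> where \<nu>: "distr P (count_space UNIV) (Z 0) = measure_pmf \<nu>"
    using distr_eq_pmf[OF Z_measurable] .
  define \<rho> where "\<rho> = map_pmf (\<lambda>(x, y). x + y) (pair_pmf \<nu> \<pi>)"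
  have \<rho>: "(\<integral>\<^sup>+x. g x \<partial>\<rho>) = (\<integral>\<^sup>+\<omega>. (\<integral>\<^sup>+y. g (Z 0 \<omega> + y) \<partial>\<pi>) \<partial>P)" for g
  proof -
    have "(\<integral>\<^sup>+x. g x \<partial>\<rho>) = (\<integral>\<^sup>+x. (\<integral>\<^sup>+y. g (x + y) \<partial>\<pi>) \<partial>\<nu>)"
      by (simp add: \<rho>_def nn_integral_pair_pmf')
    also have "\<dots> = (\<integral>\<^sup>+x. (\<integral>\<^sup>+y. g (x + y) \<partial>\<pi>) \<partial>distr P (count_space UNIV) (Z 0))"
      by (simp add: \<nu>)
    also have "\<dots> = (\<integral>\<^sup>+\<omega>. (\<integral>\<^sup>+y. g (Z 0 \<omega> + y) \<partial>\<pi>) \<partial>P)"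
      by (subst nn_integral_distr) auto
    finally show ?thesis .
  qed
  have "(\<integral>\<^sup>+x. ennreal (real x ^ 3) \<partial>\<rho>) < \<infinity>"
  proof -
    have c: "real (x + y) ^ 3 \<le> 8 * real x ^ 3 + 8 * real y ^ 3" for x y :: nat
    proof -
      have "real (x + y) ^ 3 \<le> (2 * max (real x) (real y)) ^ 3" by (intro power_mono) auto
      also have "\<dots> = 8 * max (real x) (real y) ^ 3" by (simp add: power_mult_distrib)
      also have "\<dots> \<le> 8 * real x ^ 3 + 8 * real y ^ 3" by (auto simp: max_def)
      finally show ?thesis .
    qed
    have e1: "(\<integral>\<^sup>+y. ennreal (8 * real y ^ 3) \<partial>\<pi>) = ennreal (8 * EX3)"
      using integrable_\<pi>_cube by (subst nn_integral_eq_integral) (auto simp: EX3_def)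
    have "(\<integral>\<^sup>+x. ennreal (real x ^ 3) \<partial>\<rho>)
        \<le> (\<integral>\<^sup>+\<omega>. (\<integral>\<^sup>+y. ennreal (8 * real (Z 0 \<omega>) ^ 3) + ennreal (8 * real y ^ 3) \<partial>\<pi>) \<partial>P)"
      unfolding \<rho> using c
      by (intro nn_integral_mono) (subst ennreal_plus[symmetric], auto intro!: ennreal_leI simp del: of_nat_add ennreal_plus)
    also have "\<dots> = (\<integral>\<^sup>+\<omega>. ennreal (8 * real (Z 0 \<omega>) ^ 3) + ennreal (8 * EX3) \<partial>P)"
      by (subst nn_integral_add) (simp_all add: e1)
    also have "\<dots> = (\<integral>\<^sup>+\<omega>. ennreal (8 * real (Z 0 \<omega>) ^ 3) \<partial>P) + ennreal (8 * EX3)"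
      by (subst nn_integral_add) (simp_all add: emeasure_space_1)
    also have "\<dots> < \<infinity>"
      using Z0_cube by (subst nn_integral_eq_integral) auto
    finally show ?thesis .
  qed
  then have "integrable \<rho> (\<lambda>x. real x ^ 3)" by (intro integrableI_bounded) auto
  moreover have "(\<integral>\<^sup>+\<omega>. g (Z k \<omega>) \<partial>P) \<le> (\<integral>\<^sup>+x. g x \<partial>\<rho>)" if "mono g" for g k
    unfolding \<rho> by (rule stochastic_domination[OF that])
  ultimately show thesis using that by blast
qed

lemma integrable_Z:
  fixes f :: "nat \<Rightarrow> 'c::{banach, second_countable_topology}"
  assumes f: "cubic_growth f"
  shows "integrable P (\<lambda>\<omega>. f (Z k \<omega>))"
    and "\<exists>B. \<forall>k. expectation (\<lambda>\<omega>. norm (f (Z k \<omega>))) \<le> B"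
proof -
  obtain \<rho> :: "nat pmf" where \<rho>: "integrable \<rho> (\<lambda>x. real x ^ 3)"
    "\<And>g k. mono g \<Longrightarrow> (\<integral>\<^sup>+\<omega>. g (Z k \<omega>) \<partial>P) \<le> (\<integral>\<^sup>+x. g x \<partial>\<rho>)"
    using dominating_pmf by blast
  obtain C where C: "0 \<le> C" "\<And>x. norm (f x) \<le> C * (1 + real x ^ 3)" using cubic_growth_ex[OF f] by blast
  define g where "g x = C * (1 + real x ^ 3)" for x :: nat
  have g0: "0 \<le> g x" for x using C by (simp add: g_def)
  have ig: "integrable \<rho> g" using \<rho>(1) unfolding g_def by auto
  have m: "mono (\<lambda>x. ennreal (g x))"
    unfolding g_def using C(1) by (intro monoI ennreal_leI mult_left_mono add_left_mono power_mono) auto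
  have le: "(\<integral>\<^sup>+\<omega>. ennreal (g (Z k \<omega>)) \<partial>P) \<le> ennreal (measure_pmf.expectation \<rho> g)" for k
    using \<rho>(2)[OF m, of k] ig g0 by (subst (asm) (2) nn_integral_eq_integral) auto
  have i: "integrable P (\<lambda>\<omega>. g (Z k \<omega>))" for k
    using le[of k] g0 by (intro integrableI_bounded) (auto simp: le_less_trans)
  show if': "integrable P (\<lambda>\<omega>. f (Z k \<omega>))" for k
    by (rule Bochner_Integration.integrable_bound[OF i[of k]]) (use C g0 in \<open>auto simp: g_def\<close>)
  have "expectation (\<lambda>\<omega>. norm (f (Z k \<omega>))) \<le> measure_pmf.expectation \<rho> g" for k
  proof -
    have "expectation (\<lambda>\<omega>. norm (f (Z k \<omega>))) \<le> expectation (\<lambda>\<omega>. g (Z k \<omega>))"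
      using if' i C by (intro integral_mono) (auto simp: g_def)
    also have "\<dots> \<le> measure_pmf.expectation \<rho> g"
      using le[of k] g0 by (subst (asm) nn_integral_eq_integral[OF i]) (auto simp: integral_nonneg_AE)
    finally show ?thesis .
  qed
  then show "\<exists>B. \<forall>k. expectation (\<lambda>\<omega>. norm (f (Z k \<omega>))) \<le> B" by blast
qed

text \<open>Domination by the single law \<open>\<rho>\<close> makes the cubes of all
  \<open>Z k\<close> uniformly integrable. Beyond a level \<open>R\<close> the tail is small for
  every \<open>k\<close>; below it only finitely many states remain, and pointwise convergence
  suffices.\<close>

lemma uniformly_vanishing:
  fixes h :: "nat \<Rightarrow> nat \<Rightarrow> real"
  assumes h0: "\<And>n x. 0 \<le> h n x" and hC: "\<And>n x. h n x \<le> C * (1 + real x ^ 3)"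
    and lim: "\<And>x. (\<lambda>n. h n x) \<longlonglongrightarrow> 0" and \<epsilon>: "0 < \<epsilon>"
  shows "\<forall>\<^sub>F n in sequentially. \<forall>k. expectation (\<lambda>\<omega>. h n (Z k \<omega>)) \<le> \<epsilon>"
proof -
  have C: "0 \<le> C" using order_trans[OF h0[of 0 0] hC[of 0 0]] by simp
  obtain \<rho> :: "nat pmf" where \<rho>: "integrable \<rho> (\<lambda>x. real x ^ 3)"
    "\<And>g k. mono g \<Longrightarrow> (\<integral>\<^sup>+\<omega>. g (Z k \<omega>) \<partial>P) \<le> (\<integral>\<^sup>+x. g x \<partial>\<rho>)"
    using dominating_pmf by blast
  \<comment> \<open>The tail of the cubic bound is monotone, as stochastic domination demands;
    \<open>h n\<close> itself need not be.\<close>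
  define g where "g R x = (if R \<le> x then C * (1 + real x ^ 3) else 0)" for R x :: nat
  have g0: "0 \<le> g R x" for R x using C by (simp add: g_def)
  have gC: "g R x \<le> C * (1 + real x ^ 3)" for R x using C by (simp add: g_def)
  have iC: "integrable \<rho> (\<lambda>x. C * (1 + real x ^ 3))" using \<rho>(1) by auto
  have ig: "integrable \<rho> (g R)" for R
    by (rule Bochner_Integration.integrable_bound[OF iC]) (use g0 gC C in auto)
  have m: "mono (\<lambda>x. ennreal (g R x))" for R
  proof (intro monoI ennreal_leI)
    fix x y :: nat assume "x \<le> y"
    then have "C * (1 + real x ^ 3) \<le> C * (1 + real y ^ 3)"
      using C by (intro mult_left_mono add_left_mono power_mono) auto
    then show "g R x \<le> g R y" using \<open>x \<le> y\<close> g0[of R y] by (auto simp: g_def)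
  qed
  have "(\<lambda>R. measure_pmf.expectation \<rho> (g R)) \<longlonglongrightarrow> measure_pmf.expectation \<rho> (\<lambda>x. 0)"
  proof (rule integral_dominated_convergence[where w="\<lambda>x. C * (1 + real x ^ 3)"])
    show "AE x in \<rho>. (\<lambda>R. g R x) \<longlonglongrightarrow> 0"
    proof (intro AE_I2 tendsto_eventually)
      fix x show "\<forall>\<^sub>F R in sequentially. g R x = 0"
        using eventually_gt_at_top[of x] by eventually_elim (simp add: g_def)
    qed
  qed (use iC g0 gC in auto)
  then have "\<forall>\<^sub>F R in sequentially. measure_pmf.expectation \<rho> (g R) < \<epsilon> / 2"
    using \<epsilon> by (intro order_tendstoD) auto
  then obtain R where R: "measure_pmf.expectation \<rho> (g R) < \<epsilon> / 2"
    using eventually_happens'[OF sequentially_bot] by blast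
  have "(\<lambda>n. \<Sum>x<R. h n x) \<longlonglongrightarrow> (\<Sum>x<R. 0)" by (intro tendsto_sum lim)
  then have "\<forall>\<^sub>F n in sequentially. (\<Sum>x<R. h n x) < \<epsilon> / 2"
    using \<epsilon> by (intro order_tendstoD) auto
  then show ?thesis
  proof eventually_elim
    case (elim n)
    show ?case
    proof
      fix k
      have pw: "h n x \<le> (\<Sum>x<R. h n x) + g R x" for x
      proof (cases "x < R")
        case True
        then have "h n x \<le> (\<Sum>x<R. h n x)" using h0 by (intro member_le_sum) auto
        then show ?thesis using g0[of R x] by simp
      next
        case False
        then show ?thesis using hC[of n x] sum_nonneg[of "{..<R}" "h n"] h0 by (simp add: g_def add_increasing)
      qed
      have igZ: "integrable P (\<lambda>\<omega>. g R (Z k \<omega>))"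
        using g0 gC by (intro integrable_Z(1) cubic_growthI[of _ C]) auto
      have ihZ: "integrable P (\<lambda>\<omega>. h n (Z k \<omega>))"
        using h0 hC by (intro integrable_Z(1) cubic_growthI[of _ C]) auto
      have "expectation (\<lambda>\<omega>. h n (Z k \<omega>)) \<le> expectation (\<lambda>\<omega>. (\<Sum>x<R. h n x) + g R (Z k \<omega>))"
        using ihZ igZ pw by (intro integral_mono) auto
      also have "\<dots> = (\<Sum>x<R. h n x) + expectation (\<lambda>\<omega>. g R (Z k \<omega>))"
        using igZ by (simp add: prob_space)
      also have "expectation (\<lambda>\<omega>. g R (Z k \<omega>)) \<le> measure_pmf.expectation \<rho> (g R)"
        using \<rho>(2)[OF m[of R], of k] g0
        by (subst (asm) nn_integral_eq_integral[OF igZ], simp, subst (asm) nn_integral_eq_integral[OF ig])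
          (auto simp: integral_nonneg_AE)
      finally show "expectation (\<lambda>\<omega>. h n (Z k \<omega>)) \<le> \<epsilon>" using elim R by linarith
    qed
  qed
qed

end

subsection \<open>Characteristic functions along the chain\<close>

lemma norm_integral_le:
  fixes f :: "'a \<Rightarrow> 'b::{banach, second_countable_topology}"
  assumes "integrable M f" "integrable M g" "\<And>x. norm (f x) \<le> g x"
  shows "norm (integral\<^sup>L M f) \<le> integral\<^sup>L M g"
  using integral_norm_bound[of M f] integral_mono[OF integrable_norm[OF assms(1)] assms(2,3)]
  by linarith

context inar_law
begin

text \<open>Increment of \<open>a \<cdot> S\<^sub>n / sqrt n + b \<cdot> A\<^sub>n / n\<close>, where \<open>S\<^sub>n\<close> is the martingale
  numerator and \<open>A\<^sub>n\<close> the quadratic denominator of the least squares estimator.\<close>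
definition incr :: "real \<Rightarrow> real \<Rightarrow> nat \<Rightarrow> nat \<Rightarrow> nat \<Rightarrow> real" where
  "incr a b n x y = a * (real x * (real y - \<alpha> * real x - \<mu>)) / sqrt (real n) + b * (real x)\<^sup>2 / real n"

lemma centered_cubic: "cubic_growth (\<lambda>y. real y - \<alpha> * real x - \<mu>)"
  using cubic_growth_power[of 1] by (intro cubic_growth_diff cubic_growth_const) simp

lemma KE_centered: "KE (\<lambda>y. real y - \<alpha> * real x - \<mu>) x = 0"
  using integrable_K_real[of x] by (simp add: KE_real)

lemma centered_square_integrable: "integrable (K x) (\<lambda>y. (real y - \<alpha> * real x - \<mu>)\<^sup>2)"
proof -
  have "(\<lambda>y. (real y - \<alpha> * real x - \<mu>)\<^sup>2)
     = (\<lambda>y. real y ^ 2 + (- 2 * (\<alpha> * real x + \<mu>)) * real y ^ 1 + (\<alpha> * real x + \<mu>)\<^sup>2)"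
    by (simp add: fun_eq_iff power2_eq_square algebra_simps)
  then show ?thesis
    by (simp only:) (intro integrable_K cubic_growth_add cubic_growth_mult cubic_growth_power cubic_growth_const, auto)
qed

lemma integrable_K_iexp: "integrable (measure_pmf (K z)) (\<lambda>y. iexp (f y))"
  by (rule measure_pmf.integrable_const_bound[where B=1]) auto

text \<open>The linear term has conditional mean zero, so subtracting it changes nothing in the
  expectation, while it removes the part of the integrand that grows like
  \<open>sqrt n\<close>.\<close>

lemma scaled_char_eq:
  assumes "0 < n"
  shows "of_nat n * (KE (\<lambda>y. iexp (incr a b n x y)) x - 1)
       = KE (\<lambda>y. of_nat n * (iexp (incr a b n x y) - 1
             - \<i> * of_real (a * (real x * (real y - \<alpha> * real x - \<mu>)) / sqrt (real n)))) x"
proof -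
  have i: "integrable (K x) (\<lambda>y. real y - \<alpha> * real x - \<mu>)"
    by (rule integrable_K[OF centered_cubic])
  have eq: "\<i> * of_real (a * (real x * (real y - \<alpha> * real x - \<mu>)) / sqrt (real n))
      = (\<i> * of_real (a * real x / sqrt (real n))) * of_real (real y - \<alpha> * real x - \<mu>)" for y
    by simp
  have i': "integrable (K x) (\<lambda>y. \<i> * of_real (a * (real x * (real y - \<alpha> * real x - \<mu>)) / sqrt (real n)))"
    unfolding eq by (intro integrable_mult_right integrable_of_real i)
  have 0: "KE (\<lambda>y. \<i> * of_real (a * (real x * (real y - \<alpha> * real x - \<mu>)) / sqrt (real n))) x = 0"
    unfolding eq integral_mult_right_zero integral_complex_of_real KE_centered by simp
  have i1: "integrable (K x) (\<lambda>y. iexp (incr a b n x y) - 1)"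
    by (intro Bochner_Integration.integrable_diff integrable_K_iexp) simp
  have "KE (\<lambda>y. iexp (incr a b n x y) - 1) x = KE (\<lambda>y. iexp (incr a b n x y)) x - KE (\<lambda>y. 1) x"
    by (rule Bochner_Integration.integral_diff[OF integrable_K_iexp]) simp
  then have "KE (\<lambda>y. iexp (incr a b n x y) - 1 - \<i> * of_real (a * (real x * (real y - \<alpha> * real x - \<mu>)) / sqrt (real n))) x
      = KE (\<lambda>y. iexp (incr a b n x y)) x - 1"
    unfolding Bochner_Integration.integral_diff[OF i1 i'] 0 by simp
  then show ?thesis by (simp only: integral_mult_right_zero)
qed

lemma scaled_char_pointwise_bound:
  assumes "0 < n"
  shows "cmod (of_nat n * (iexp (incr a b n x y) - 1
             - \<i> * of_real (a * (real x * (real y - \<alpha> * real x - \<mu>)) / sqrt (real n))))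
    \<le> \<bar>b\<bar> * (real x)\<^sup>2 + a\<^sup>2 / 2 * ((real x)\<^sup>2 * (real y - \<alpha> * real x - \<mu>)\<^sup>2)"
proof -
  have "cmod (iexp (incr a b n x y) - 1
             - \<i> * of_real (a * (real x * (real y - \<alpha> * real x - \<mu>)) / sqrt (real n)))
      \<le> \<bar>b * (real x)\<^sup>2 / real n\<bar> + (a * (real x * (real y - \<alpha> * real x - \<mu>)) / sqrt (real n))\<^sup>2 / 2"
    unfolding incr_def by (rule iexp_perturb_bound)
  also have "\<dots> = (\<bar>b\<bar> * (real x)\<^sup>2 + a\<^sup>2 / 2 * ((real x)\<^sup>2 * (real y - \<alpha> * real x - \<mu>)\<^sup>2)) / real n"
    using assms by (simp add: abs_mult power_mult_distrib power_divide add_divide_distrib)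
  finally show ?thesis
    using assms by (simp add: norm_mult pos_le_divide_eq mult.commute)
qed

text \<open>A bound of cubic growth in the state and uniform in \<open>n\<close>, as
  \<open>uniformly_vanishing\<close> demands.\<close>

lemma scaled_char_bound:
  assumes n: "0 < n"
  shows "cmod (of_nat n * (KE (\<lambda>y. iexp (incr a b n x y)) x - 1)) \<le> \<bar>b\<bar> * (real x)\<^sup>2 + a\<^sup>2 / 2 * v0 x"
proof -
  let ?w = "\<lambda>y. \<bar>b\<bar> * (real x)\<^sup>2 + a\<^sup>2 / 2 * ((real x)\<^sup>2 * (real y - \<alpha> * real x - \<mu>)\<^sup>2)"
  have i: "integrable (K x) ?w" using centered_square_integrable[of x] by auto
  have "cmod (of_nat n * (KE (\<lambda>y. iexp (incr a b n x y)) x - 1)) \<le> KE ?w x"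
    unfolding scaled_char_eq[OF n]
  proof (rule norm_integral_le)
    show "integrable (K x) (\<lambda>y. of_nat n * (iexp (incr a b n x y) - 1
             - \<i> * of_real (a * (real x * (real y - \<alpha> * real x - \<mu>)) / sqrt (real n))))"
      by (rule Bochner_Integration.integrable_bound[OF i])
        (use scaled_char_pointwise_bound[OF n] in \<open>auto intro: order_trans[OF _ abs_ge_self]\<close>)
  qed (use i scaled_char_pointwise_bound[OF n] in auto)
  also have "\<dots> = \<bar>b\<bar> * (real x)\<^sup>2 + a\<^sup>2 / 2 * v0 x"
    using centered_square_integrable[of x] by (simp add: KE_centered_square v0_def)
  finally show ?thesis .
qed

lemma scaled_increment_lim:
  fixes p q :: real
  shows "(\<lambda>n. of_nat n * (iexp (p / sqrt (real n) + q / real n) - 1 - \<i> * of_real (p / sqrt (real n))))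
     \<longlonglongrightarrow> of_real (- (p\<^sup>2) / 2) + \<i> * of_real q"
proof -
  have 1: "(\<lambda>n. real n * (cos (p / sqrt (real n) + q / real n) - 1)) \<longlonglongrightarrow> - (p\<^sup>2) / 2"
    by (real_asymp simp: power2_eq_square)
  have 2: "(\<lambda>n. real n * (sin (p / sqrt (real n) + q / real n) - p / sqrt (real n))) \<longlonglongrightarrow> q"
    by real_asymp
  have "(\<lambda>n. of_real (real n * (cos (p / sqrt (real n) + q / real n) - 1))
       + \<i> * of_real (real n * (sin (p / sqrt (real n) + q / real n) - p / sqrt (real n))))
     \<longlonglongrightarrow> of_real (- (p\<^sup>2) / 2) + \<i> * of_real q"
    by (intro tendsto_intros 1 2)
  moreover have "of_real (real n * (cos (p / sqrt (real n) + q / real n) - 1))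
       + \<i> * of_real (real n * (sin (p / sqrt (real n) + q / real n) - p / sqrt (real n)))
     = of_nat n * (iexp (p / sqrt (real n) + q / real n) - 1 - \<i> * of_real (p / sqrt (real n)))" for n
    by (rule complex_eqI) (simp_all add: Re_exp Im_exp)
  ultimately show ?thesis by (simp only:)
qed

text \<open>The dominating function is quadratic in the next state, so its kernel mean is at most
  cubic in the current one.\<close>

lemma scaled_char_lim:
  "(\<lambda>n. of_nat n * (KE (\<lambda>y. iexp (incr a b n x y)) x - 1))
     \<longlonglongrightarrow> of_real (- (a\<^sup>2) / 2 * v0 x) + \<i> * of_real (b * (real x)\<^sup>2)"
proof -
  let ?w = "\<lambda>y. \<bar>b\<bar> * (real x)\<^sup>2 + a\<^sup>2 / 2 * ((real x)\<^sup>2 * (real y - \<alpha> * real x - \<mu>)\<^sup>2)"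
  let ?f = "\<lambda>n y. of_nat n * (iexp (incr a b n x y) - 1
             - \<i> * of_real (a * (real x * (real y - \<alpha> * real x - \<mu>)) / sqrt (real n)))"
  let ?g = "\<lambda>y. complex_of_real (- ((a * (real x * (real y - \<alpha> * real x - \<mu>)))\<^sup>2) / 2) + \<i> * of_real (b * (real x)\<^sup>2)"
  have i: "integrable (K x) ?w" using centered_square_integrable[of x] by auto
  have "(\<lambda>n. KE (?f n) x) \<longlonglongrightarrow> KE ?g x"
  proof (rule integral_dominated_convergence[OF _ _ i])
    show "AE y in K x. (\<lambda>n. ?f n y) \<longlonglongrightarrow> ?g y"
      unfolding incr_def by (intro AE_I2 scaled_increment_lim)
    show "AE y in K x. norm (?f n y) \<le> ?w y" for n
    proof (cases "n = 0")
      case False then show ?thesis using scaled_char_pointwise_bound[of n] by auto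
    qed auto
  qed auto
  moreover have "KE ?g x = of_real (- (a\<^sup>2) / 2 * v0 x) + \<i> * of_real (b * (real x)\<^sup>2)"
  proof -
    have g: "?g y = of_real (- (a\<^sup>2) / 2 * (real x)\<^sup>2) * of_real ((real y - \<alpha> * real x - \<mu>)\<^sup>2) + \<i> * of_real (b * (real x)\<^sup>2)" for y
      by (simp add: power_mult_distrib)
    have i: "integrable (K x) (\<lambda>y. complex_of_real (- (a\<^sup>2) / 2 * (real x)\<^sup>2) * of_real ((real y - \<alpha> * real x - \<mu>)\<^sup>2))"
      by (intro integrable_mult_right integrable_of_real centered_square_integrable)
    have "KE ?g x = KE (\<lambda>y. complex_of_real (- (a\<^sup>2) / 2 * (real x)\<^sup>2) * of_real ((real y - \<alpha> * real x - \<mu>)\<^sup>2)) x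
        + KE (\<lambda>y. \<i> * of_real (b * (real x)\<^sup>2)) x"
      unfolding g by (rule Bochner_Integration.integral_add[OF i]) simp
    also have "\<dots> = of_real (- (a\<^sup>2) / 2 * (real x)\<^sup>2) * of_real (\<alpha> * (1 - \<alpha>) * real x + \<sigma>e) + \<i> * of_real (b * (real x)\<^sup>2)"
      unfolding integral_mult_right_zero integral_complex_of_real KE_centered_square by simp
    finally show ?thesis by (simp add: v0_def)
  qed
  ultimately have "(\<lambda>n. KE (?f n) x) \<longlonglongrightarrow> of_real (- (a\<^sup>2) / 2 * v0 x) + \<i> * of_real (b * (real x)\<^sup>2)" by simp
  then show ?thesis
    by (rule Lim_transform_eventually)
      (use eventually_gt_at_top[of 0] in \<open>eventually_elim, simp only: scaled_char_eq\<close>)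
qed

end

section \<open>The limit of the joint characteristic function\<close>

context inar_chain
begin

text \<open>The number of steps \<open>k\<close> is separate from the scale \<open>n\<close>: after
  the restart a sample of size \<open>n\<close> contributes only \<open>n - (s + 2)\<close>
  transitions, still scaled by \<open>n\<close>.\<close>

definition W :: "real \<Rightarrow> real \<Rightarrow> nat \<Rightarrow> nat \<Rightarrow> 'a \<Rightarrow> real" where
  "W a b n k \<omega> = (\<Sum>j<k. incr a b n (Z j \<omega>) (Z (Suc j) \<omega>))"

lemma W_measurable[measurable]: "W a b n k \<in> borel_measurable P"
  unfolding W_def incr_def by measurable

lemma char_function_lim:
  "(\<lambda>n. expectation (\<lambda>\<omega>. iexp (W a b n (n - N) \<omega>)))
     \<longlonglongrightarrow> exp (of_real (- (a\<^sup>2) / 2 * V) + \<i> * of_real (b * EX2))"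
proof -
  define c where "c = complex_of_real (- (a\<^sup>2) / 2 * V) + \<i> * of_real (b * EX2)"
  define w where "w x = complex_of_real (- (a\<^sup>2) / 2 * v0 x) + \<i> * of_real (b * (real x)\<^sup>2)" for x
  obtain u where u: "cubic_growth u" and pois: "\<And>x. u x - KE u x = w x - c"
    using poisson_complex[of a b] unfolding w_def c_def by blast
  \<comment> \<open>The idealised factor of one step: its \<open>n\<close>-th power is
    \<open>exp c\<close>.\<close>
  define q where "q n = exp (c / of_nat n)" for n :: nat
  \<comment> \<open>Hence \<open>q n\<close> has modulus at most 1, and errors made in earlier steps
    are not amplified by later ones.\<close>
  have Re_c: "Re c \<le> 0" using V_pos by (simp add: c_def)
  have q1: "cmod (q n) \<le> 1" for n
    using Re_c by (simp add: q_def norm_exp_eq_Re divide_nonpos_nonneg Re_divide_of_nat)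
  define H where "H n x = KE (\<lambda>y. iexp (incr a b n x y) * (1 + u y / of_nat n)) x" for n x
  have iu: "integrable (K x) (\<lambda>y. iexp (incr a b n x y) * u y)" for n x
    by (rule Bochner_Integration.integrable_bound[OF integrable_K[OF u, of x]]) (auto simp: norm_mult)
  have H_eq: "H n x = KE (\<lambda>y. iexp (incr a b n x y)) x + KE (\<lambda>y. iexp (incr a b n x y) * u y) x / of_nat n" for n x
    unfolding H_def using iu[of x n] integrable_K_iexp
    by (simp add: distrib_left)
  \<comment> \<open>The scaled defect of one corrected step. Its pointwise limit is the modulus of
    \<open>w x + KE u x - c - u x\<close>, which vanishes precisely by the Poisson equation; the
    value at \<open>n = 0\<close> only keeps the cubic bound valid there.\<close>
  define h where "h n x = (if n = 0 then 0 else cmod (of_nat n * (H n x - q n * (1 + u x / of_nat n))))" for n x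
  have h_eq: "h n x = cmod (of_nat n * (KE (\<lambda>y. iexp (incr a b n x y)) x - 1)
        + KE (\<lambda>y. iexp (incr a b n x y) * u y) x - of_nat n * (q n - 1) - q n * u x)" if "0 < n" for n x
    using that unfolding h_def H_eq by (auto simp: field_simps intro!: arg_cong[where f=cmod])
  have qlim: "(\<lambda>n. of_nat n * (q n - 1)) \<longlonglongrightarrow> c" "q \<longlonglongrightarrow> 1"
  proof -
    have 1: "(\<lambda>n. c / of_nat n) \<longlonglongrightarrow> 0" by (rule lim_const_over_n)
    show "q \<longlonglongrightarrow> 1" unfolding q_def using tendsto_exp[OF 1] by simp
    have "(\<lambda>n. of_nat n * (q n - 1)) \<longlonglongrightarrow> c"
    proof (cases "c = 0")
      case False
      have "filterlim (\<lambda>n. c / of_nat n) (at 0) sequentially"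
        using 1 False by (auto simp: filterlim_at intro: eventually_mono[OF eventually_gt_at_top[of 0]])
      from filterlim_compose[OF lim_exp_minus_1 this]
      have "(\<lambda>n. c * ((exp (c / of_nat n) - 1) / (c / of_nat n))) \<longlonglongrightarrow> c * 1"
        by (intro tendsto_intros)
      then show ?thesis using False by (simp add: q_def mult.commute)
    qed (simp add: q_def)
    then show "(\<lambda>n. of_nat n * (q n - 1)) \<longlonglongrightarrow> c" .
  qed
  have Kulim: "(\<lambda>n. KE (\<lambda>y. iexp (incr a b n x y) * u y) x) \<longlonglongrightarrow> KE u x" for x
  proof (rule integral_dominated_convergence[where w="\<lambda>y. cmod (u y)"])
    show "integrable (K x) (\<lambda>y. cmod (u y))" using integrable_K[OF u] by auto
    have "(\<lambda>n. incr a b n x y) \<longlonglongrightarrow> 0" for y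
      unfolding incr_def by real_asymp
    then have "(\<lambda>n. iexp (incr a b n x y) * u y) \<longlonglongrightarrow> iexp 0 * u y" for y
      by (intro tendsto_intros)
    then show "AE y in K x. (\<lambda>n. iexp (incr a b n x y) * u y) \<longlonglongrightarrow> u y" by simp
  qed (auto simp: norm_mult)
  have hlim: "(\<lambda>n. h n x) \<longlonglongrightarrow> 0" for x
  proof -
    have "(\<lambda>n. cmod (of_nat n * (KE (\<lambda>y. iexp (incr a b n x y)) x - 1)
        + KE (\<lambda>y. iexp (incr a b n x y) * u y) x - of_nat n * (q n - 1) - q n * u x))
      \<longlonglongrightarrow> cmod (w x + KE u x - c - 1 * u x)"
      unfolding w_def by (intro tendsto_intros scaled_char_lim Kulim qlim)
    also have "w x + KE u x - c - 1 * u x = 0" using pois[of x] by (simp add: algebra_simps)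
    finally have "(\<lambda>n. cmod (of_nat n * (KE (\<lambda>y. iexp (incr a b n x y)) x - 1)
        + KE (\<lambda>y. iexp (incr a b n x y) * u y) x - of_nat n * (q n - 1) - q n * u x)) \<longlonglongrightarrow> 0" by simp
    then show ?thesis
      by (rule Lim_transform_eventually) (use eventually_gt_at_top[of 0] in \<open>eventually_elim, simp only: h_eq\<close>)
  qed
  have h0: "0 \<le> h n x" for n x by (simp add: h_def)
  have "\<exists>C. \<forall>n x. h n x \<le> C * (1 + real x ^ 3)"
  proof -
    obtain D where D: "\<And>n. cmod (of_nat n * (q n - 1)) \<le> D"
      using convergent_imp_Bseq[OF convergentI[OF qlim(1)]] unfolding Bseq_def by blast
    have cg: "cubic_growth (\<lambda>x. \<bar>b\<bar> * (real x)\<^sup>2 + a\<^sup>2 / 2 * v0 x + KE (\<lambda>y. cmod (u y)) x + D + cmod (u x))"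
      using cubic_growth_power[of 2]
      by (intro cubic_growth_add cubic_growth_mult cubic_growth_v0 cubic_growth_const cubic_growth_KE cubic_growth_norm u) auto
    then obtain C where C: "0 \<le> C" "\<And>x. norm (\<bar>b\<bar> * (real x)\<^sup>2 + a\<^sup>2 / 2 * v0 x + KE (\<lambda>y. cmod (u y)) x + D + cmod (u x)) \<le> C * (1 + real x ^ 3)"
      using cubic_growth_ex[OF cg] by blast
    have "h n x \<le> C * (1 + real x ^ 3)" for n x
    proof (cases "n = 0")
      case False
      then have n: "0 < n" by simp
      have 1: "cmod (KE (\<lambda>y. iexp (incr a b n x y) * u y) x) \<le> KE (\<lambda>y. cmod (u y)) x"
        using integral_norm_bound[where M="K x" and f="\<lambda>y. iexp (incr a b n x y) * u y"] by (simp add: norm_mult)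
      have 2: "cmod (q n * u x) \<le> cmod (u x)"
        using mult_right_mono[OF q1[of n], of "cmod (u x)"] by (simp add: norm_mult)
      have "h n x \<le> \<bar>b\<bar> * (real x)\<^sup>2 + a\<^sup>2 / 2 * v0 x + KE (\<lambda>y. cmod (u y)) x + D + cmod (u x)"
        unfolding h_eq[OF n]
        by (intro order_trans[OF norm_triangle_ineq4] order_trans[OF norm_triangle_ineq] add_mono
            scaled_char_bound n D 1 2)
      also have "\<dots> \<le> C * (1 + real x ^ 3)" using C(2)[of x] by simp
      finally show ?thesis .
    qed (use C in \<open>simp add: h_def\<close>)
    then show ?thesis by blast
  qed
  then obtain C where hC: "\<And>n x. h n x \<le> C * (1 + real x ^ 3)" by blast
  text \<open>Correcting the characteristic function by the Poisson solution \<open>u\<close> turns its recursion in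
    \<open>k\<close> into multiplication by the constant \<open>q n\<close>, up to a uniform \<open>o(1 / n)\<close>.\<close>
  define \<psi> where "\<psi> n k = expectation (\<lambda>\<omega>. iexp (W a b n k \<omega>) * (1 + u (Z k \<omega>) / of_nat n))" for n k
  obtain B where B: "\<And>k. expectation (\<lambda>\<omega>. cmod (u (Z k \<omega>))) \<le> B"
    using integrable_Z(2)[OF u] by blast
  note iuZ = integrable_Z(1)[OF u]
  have iW: "integrable P (\<lambda>\<omega>. iexp (W a b n k \<omega>))" for n k
    by (rule integrable_const_bound[where B=1]) auto
  have iWu: "integrable P (\<lambda>\<omega>. iexp (W a b n k \<omega>) * u (Z k \<omega>))" for n k
    by (rule Bochner_Integration.integrable_bound[OF iuZ[of k]]) (auto simp: norm_mult)
  have i\<psi>: "integrable P (\<lambda>\<omega>. iexp (W a b n k \<omega>) * (1 + u (Z k \<omega>) / of_nat n))" for n k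
    using iW[of n k] iWu[of n k] by (simp add: distrib_left)
  have \<psi>_eq: "\<psi> n k = expectation (\<lambda>\<omega>. iexp (W a b n k \<omega>)) + expectation (\<lambda>\<omega>. iexp (W a b n k \<omega>) * u (Z k \<omega>)) / of_nat n" for n k
    unfolding \<psi>_def using iW[of n k] iWu[of n k] by (simp add: distrib_left)
  have near: "cmod (\<psi> n k - expectation (\<lambda>\<omega>. iexp (W a b n k \<omega>))) \<le> B / real n" for n k
  proof -
    have "cmod (expectation (\<lambda>\<omega>. iexp (W a b n k \<omega>) * u (Z k \<omega>))) \<le> expectation (\<lambda>\<omega>. cmod (u (Z k \<omega>)))"
      using integral_norm_bound[where M=P and f="\<lambda>\<omega>. iexp (W a b n k \<omega>) * u (Z k \<omega>)"] by (simp add: norm_mult)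
    also have "\<dots> \<le> B" by (rule B)
    finally show ?thesis unfolding \<psi>_eq by (simp add: norm_divide divide_right_mono)
  qed
  have step: "cmod (\<psi> n (Suc k) - q n * \<psi> n k) \<le> expectation (\<lambda>\<omega>. h n (Z k \<omega>)) / real n" if n: "0 < n" for n k
  proof -
    \<comment> \<open>The accumulated factor is rewritten as a function of the history list, the
      form that \<open>expectation_step\<close> accepts.\<close>
    define F where "F xs = iexp (\<Sum>j<k. incr a b n (xs ! j) (xs ! Suc j))" for xs
    have F: "F (traj Z k \<omega>) = iexp (W a b n k \<omega>)" for \<omega>
      unfolding F_def W_def by (intro arg_cong[where f=exp] arg_cong[where f="\<lambda>z. \<i> * of_real z"] sum.cong) auto
    define g where "g xs y = F xs * (iexp (incr a b n (last xs) y) * (1 + u y / of_nat n))" for xs y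
    have g: "g (traj Z k \<omega>) (Z (Suc k) \<omega>) = iexp (W a b n (Suc k) \<omega>) * (1 + u (Z (Suc k) \<omega>) / of_nat n)" for \<omega>
      by (simp add: g_def F W_def exp_add distrib_left mult.assoc)
    have iK: "integrable (K x) (\<lambda>y. iexp (incr a b n x y) * (1 + u y / of_nat n))" for x
      using iu[of x n] integrable_K_iexp by (simp add: distrib_left)
    have "\<psi> n (Suc k) = expectation (\<lambda>\<omega>. g (traj Z k \<omega>) (Z (Suc k) \<omega>))"
      unfolding \<psi>_def g ..
    also have "\<dots> = expectation (\<lambda>\<omega>. KE (g (traj Z k \<omega>)) (Z k \<omega>))"
    proof (rule expectation_step)
      show "integrable P (\<lambda>\<omega>. g (traj Z k \<omega>) (Z (Suc k) \<omega>))" unfolding g by (rule i\<psi>)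
      show "integrable (K (last xs)) (g xs)" for xs
        unfolding g_def by (intro integrable_mult_right iK)
    qed
    also have "\<dots> = expectation (\<lambda>\<omega>. iexp (W a b n k \<omega>) * H n (Z k \<omega>))"
      by (simp add: g_def[abs_def] F H_def)
    finally have s: "\<psi> n (Suc k) = expectation (\<lambda>\<omega>. iexp (W a b n k \<omega>) * H n (Z k \<omega>))" .
    have cH: "cubic_growth (H n)"
    proof -
      have "cubic_growth (\<lambda>x. KE (\<lambda>y. 1 + cmod (u y) / real n) x)"
        using cubic_growth_mult[OF cubic_growth_norm[OF u], of "1 / real n"]
        by (intro cubic_growth_KE cubic_growth_add cubic_growth_const) simp
      then show ?thesis
      proof (rule cubic_growth_mono)
        fix x
        have "cmod (H n x) \<le> KE (\<lambda>y. 1 + cmod (u y) / real n) x"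
          unfolding H_def
        proof (rule norm_integral_le[OF iK])
          show "integrable (K x) (\<lambda>y. 1 + cmod (u y) / real n)" using integrable_K[OF u, of x] by auto
          show "cmod (iexp (incr a b n x y) * (1 + u y / of_nat n)) \<le> 1 + cmod (u y) / real n" for y
            using norm_triangle_ineq[of 1 "u y / of_nat n"] by (simp add: norm_mult norm_divide)
        qed
        then show "cmod (H n x) \<le> norm (KE (\<lambda>y. 1 + cmod (u y) / real n) x)" by simp
      qed
    qed
    have iH: "integrable P (\<lambda>\<omega>. iexp (W a b n k \<omega>) * H n (Z k \<omega>))"
      by (rule Bochner_Integration.integrable_bound[OF integrable_Z(1)[OF cH, of k]]) (auto simp: norm_mult)
    have "\<psi> n (Suc k) - q n * \<psi> n k = expectation (\<lambda>\<omega>. iexp (W a b n k \<omega>) * H n (Z k \<omega>))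
        - expectation (\<lambda>\<omega>. q n * (iexp (W a b n k \<omega>) * (1 + u (Z k \<omega>) / of_nat n)))"
      by (simp only: s \<psi>_def[of n k] integral_mult_right_zero)
    also have "\<dots> = expectation (\<lambda>\<omega>. iexp (W a b n k \<omega>) * (H n (Z k \<omega>) - q n * (1 + u (Z k \<omega>) / of_nat n)))"
      using iH integrable_mult_right[OF i\<psi>[of n k], of "q n"]
      by (subst Bochner_Integration.integral_diff[symmetric]) (auto simp: algebra_simps)
    finally have d: "\<psi> n (Suc k) - q n * \<psi> n k
        = expectation (\<lambda>\<omega>. iexp (W a b n k \<omega>) * (H n (Z k \<omega>) - q n * (1 + u (Z k \<omega>) / of_nat n)))" .
    have "cmod (\<psi> n (Suc k) - q n * \<psi> n k)
        \<le> expectation (\<lambda>\<omega>. cmod (iexp (W a b n k \<omega>) * (H n (Z k \<omega>) - q n * (1 + u (Z k \<omega>) / of_nat n))))"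
      unfolding d by (rule integral_norm_bound)
    also have "\<dots> = expectation (\<lambda>\<omega>. h n (Z k \<omega>) / real n)"
      using n by (intro Bochner_Integration.integral_cong) (auto simp: h_def norm_mult)
    finally show ?thesis by simp
  qed
  \<comment> \<open>Each step adds a defect of at most \<open>\<epsilon> / n\<close>, and
    multiplication by \<open>q n\<close> does not enlarge what has accumulated.\<close>
  have main: "cmod (\<psi> n k - q n ^ k * \<psi> n 0) \<le> real k * (\<epsilon> / real n)"
    if n: "0 < n" and \<epsilon>: "\<And>k. expectation (\<lambda>\<omega>. h n (Z k \<omega>)) \<le> \<epsilon>" for n k \<epsilon>
  proof (induction k)
    case (Suc k)
    have "\<psi> n (Suc k) - q n ^ Suc k * \<psi> n 0 = (\<psi> n (Suc k) - q n * \<psi> n k) + q n * (\<psi> n k - q n ^ k * \<psi> n 0)"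
      by (simp add: algebra_simps)
    then have "cmod (\<psi> n (Suc k) - q n ^ Suc k * \<psi> n 0)
        \<le> cmod (\<psi> n (Suc k) - q n * \<psi> n k) + cmod (q n * (\<psi> n k - q n ^ k * \<psi> n 0))"
      by (simp only: norm_triangle_ineq)
    also have "cmod (\<psi> n (Suc k) - q n * \<psi> n k) \<le> \<epsilon> / real n"
      by (rule order_trans[OF step[OF n] divide_right_mono[OF \<epsilon>]]) simp
    also have "cmod (q n * (\<psi> n k - q n ^ k * \<psi> n 0)) \<le> 1 * cmod (\<psi> n k - q n ^ k * \<psi> n 0)"
      unfolding norm_mult by (intro mult_right_mono q1) simp
    also note Suc
    finally show ?case by (simp add: algebra_simps add_divide_distrib)
  qed simp
  have l1: "(\<lambda>n. expectation (\<lambda>\<omega>. iexp (W a b n (n - N) \<omega>)) - q n ^ (n - N)) \<longlonglongrightarrow> 0"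
  proof (rule tendstoI)
    fix r :: real assume r: "0 < r"
    have "\<forall>\<^sub>F n in sequentially. \<forall>k. expectation (\<lambda>\<omega>. h n (Z k \<omega>)) \<le> r / 4"
      by (rule uniformly_vanishing[OF h0 hC hlim]) (use r in simp)
    moreover have "(\<lambda>n. B / real n) \<longlonglongrightarrow> 0" by (rule lim_const_over_n)
    then have "\<forall>\<^sub>F n in sequentially. B / real n < r / 4"
      using r by (intro order_tendstoD) auto
    ultimately show "\<forall>\<^sub>F n in sequentially. dist (expectation (\<lambda>\<omega>. iexp (W a b n (n - N) \<omega>)) - q n ^ (n - N)) 0 < r"
      using eventually_gt_at_top[of 0]
    proof eventually_elim
      case (elim n)
      let ?k = "n - N"
      have E: "cmod (\<psi> n ?k - q n ^ ?k * \<psi> n 0) \<le> r / 4"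
      proof -
        have "cmod (\<psi> n ?k - q n ^ ?k * \<psi> n 0) \<le> real ?k * (r / 4 / real n)"
          by (rule main) (use elim in auto)
        also have "\<dots> \<le> real n * (r / 4 / real n)"
          using r by (intro mult_right_mono) auto
        also have "\<dots> = r / 4" using elim by simp
        finally show ?thesis .
      qed
      have "cmod (\<psi> n 0 - 1) \<le> B / real n"
        using near[of n 0] by (simp add: W_def prob_space)
      then have E2: "cmod (q n ^ ?k * (\<psi> n 0 - 1)) \<le> B / real n"
        using mult_mono[OF power_mono[OF q1[of n], of ?k], of "cmod (\<psi> n 0 - 1)" "B / real n"] by (simp add: norm_mult norm_power)
      let ?E = "expectation (\<lambda>\<omega>. iexp (W a b n ?k \<omega>))"
      \<comment> \<open>Three errors: removing the corrector at the final time, the accumulated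
        defect, and removing the corrector at time 0.\<close>
      have eq: "?E - q n ^ ?k = - (\<psi> n ?k - ?E) + (\<psi> n ?k - q n ^ ?k * \<psi> n 0) + q n ^ ?k * (\<psi> n 0 - 1)"
        by (simp add: algebra_simps)
      have tri: "cmod (- x + y + z) \<le> cmod x + cmod y + cmod z" for x y z
        using norm_triangle_ineq[of "- x + y" z] norm_triangle_ineq[of "- x" y] by simp
      have "cmod (?E - q n ^ ?k) \<le> cmod (\<psi> n ?k - ?E) + cmod (\<psi> n ?k - q n ^ ?k * \<psi> n 0) + cmod (q n ^ ?k * (\<psi> n 0 - 1))"
        by (subst eq) (rule tri)
      also have "\<dots> < r" using near[of n ?k] E E2 elim r by linarith
      finally show ?case by simp
    qed
  qed
  have l2: "(\<lambda>n. q n ^ (n - N)) \<longlonglongrightarrow> exp c"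
  proof -
    have "(\<lambda>n. real (n - N) / real n) \<longlonglongrightarrow> 1"
    proof (rule Lim_transform_eventually)
      show "(\<lambda>n. (real n - real N) / real n) \<longlonglongrightarrow> 1" by real_asymp
      show "\<forall>\<^sub>F n in sequentially. (real n - real N) / real n = real (n - N) / real n"
        using eventually_ge_at_top[of N] by eventually_elim (simp add: of_nat_diff)
    qed
    then have "(\<lambda>n. exp (of_real (real (n - N) / real n) * c)) \<longlonglongrightarrow> exp (of_real 1 * c)"
      by (intro tendsto_intros)
    then show ?thesis by (simp add: q_def exp_of_nat_mult[symmetric])
  qed
  show ?thesis
    using tendsto_add[OF l1 l2] by (simp add: c_def)
qed

end

subsection \<open>The least squares criterion\<close>

text \<open>Minimising the three outlier terms of \<open>Qn\<close> over the outlier sizes leaves the squared distance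
  \<open>prof_h\<^sup>2 / prof_D\<close> to a plane with normal \<open>(a\<^sup>2, a, 1)\<close>; here \<open>p\<close> and \<open>q\<close> stand for the
  observations at times \<open>s - 1\<close> and \<open>s + 2\<close>.\<close>
definition prof_D :: "real \<Rightarrow> real" where "prof_D a = 1 + a ^ 2 + a ^ 4"

definition prof_h :: "real \<Rightarrow> real \<Rightarrow> real \<Rightarrow> real \<Rightarrow> real" where
  "prof_h m p q a = q - a ^ 3 * p - (1 + a + a ^ 2) * m"

definition prof_h' :: "real \<Rightarrow> real \<Rightarrow> real \<Rightarrow> real" where
  "prof_h' m p a = - 3 * a ^ 2 * p - (1 + 2 * a) * m"

definition prof_D' :: "real \<Rightarrow> real" where "prof_D' a = 2 * a + 4 * a ^ 3"

definition prof_g' :: "real \<Rightarrow> real \<Rightarrow> real \<Rightarrow> real \<Rightarrow> real" where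
  "prof_g' m p q a = (2 * prof_h m p q a * prof_h' m p a * prof_D a - (prof_h m p q a)\<^sup>2 * prof_D' a) / (prof_D a)\<^sup>2"

text \<open>\<open>- theta1\<close> and \<open>- theta2\<close> are the least squares
  interpolations, for slope \<open>a\<close>, of the outlier-free states at times \<open>s\<close>
  and \<open>s + 1\<close> from their neighbours \<open>p\<close> and \<open>q\<close>. Added to the
  observations, \<open>theta1\<close> and \<open>theta2\<close> give the optimal outlier sizes, and
  at \<open>a = \<alpha>\<close> the centrings \<open>L1\<close> and \<open>L2\<close>.\<close>

definition theta1 :: "real \<Rightarrow> real \<Rightarrow> real \<Rightarrow> real \<Rightarrow> real" where
  "theta1 m p q a = (- a * (1 + a ^ 2) * p - a ^ 2 * q - (1 - a ^ 3) * m) / prof_D a"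

definition theta2 :: "real \<Rightarrow> real \<Rightarrow> real \<Rightarrow> real \<Rightarrow> real" where
  "theta2 m p q a = (- (a ^ 2) * p - a * (1 + a ^ 2) * q - (1 - a ^ 3) * m) / prof_D a"

lemma prof_D_pos: "0 < prof_D a"
proof -
  have "0 \<le> a ^ 2" "0 \<le> a ^ 4" by auto
  then show ?thesis unfolding prof_D_def by linarith
qed

text \<open>\<open>e1\<close> and \<open>e2\<close> are deviations from the optimal sizes. They
  change the residual vector by \<open>(- e1, a * e1 - e2, a * e2)\<close>, which is orthogonal to
  \<open>(a^2, a, 1)\<close>, so no cross terms appear.\<close>

lemma outlier_terms_eq:
  assumes "D = 1 + a ^ 2 + a ^ (4::nat)" "D \<noteq> (0::real)"
  shows "(ys - a * p - m - (ys + (- a * (1 + a ^ 2) * p - a ^ 2 * q - (1 - a ^ 3) * m) / D + e1))\<^sup>2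
     + (yt - a * ys - m + a * (ys + (- a * (1 + a ^ 2) * p - a ^ 2 * q - (1 - a ^ 3) * m) / D + e1)
          - (yt + (- (a ^ 2) * p - a * (1 + a ^ 2) * q - (1 - a ^ 3) * m) / D + e2))\<^sup>2
     + (q - a * yt - m + a * (yt + (- (a ^ 2) * p - a * (1 + a ^ 2) * q - (1 - a ^ 3) * m) / D + e2))\<^sup>2
   = (q - a ^ 3 * p - (1 + a + a ^ 2) * m)\<^sup>2 / D + (e1\<^sup>2 + (a * e1 - e2)\<^sup>2 + (a * e2)\<^sup>2)"
proof -
  \<comment> \<open>At the optimum the three residuals are \<open>a ^ 2 * r\<close>,
    \<open>a * r\<close> and \<open>r\<close>; the equations for \<open>t1\<close> and
    \<open>t2\<close> express the first two of these.\<close>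
  define r where "r = (q - a ^ 3 * p - (1 + a + a ^ 2) * m) / D"
  have rD: "r * D = q - a ^ 3 * p - (1 + a + a ^ 2) * m" using assms(2) by (simp add: r_def)
  have t1: "(- a * (1 + a ^ 2) * p - a ^ 2 * q - (1 - a ^ 3) * m) / D = - a * p - m - a ^ 2 * r"
  proof -
    have "- a * (1 + a ^ 2) * p - a ^ 2 * q - (1 - a ^ 3) * m = (- a * p - m - a ^ 2 * r) * D"
      using rD assms(1) by algebra
    then show ?thesis using assms(2) by simp
  qed
  have t2: "(- (a ^ 2) * p - a * (1 + a ^ 2) * q - (1 - a ^ 3) * m) / D = - m + a * (- a * p - m - a ^ 2 * r) - a * r"
  proof -
    have "- (a ^ 2) * p - a * (1 + a ^ 2) * q - (1 - a ^ 3) * m = (- m + a * (- a * p - m - a ^ 2 * r) - a * r) * D"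
      using rD assms(1) by algebra
    then show ?thesis using assms(2) by simp
  qed
  have q: "q = r * (1 + a ^ 2 + a ^ 4) + a ^ 3 * p + (1 + a + a ^ 2) * m" using rD assms(1) by (simp add: algebra_simps)
  have h2: "(q - a ^ 3 * p - (1 + a + a ^ 2) * m)\<^sup>2 / D = r\<^sup>2 * (1 + a ^ 2 + a ^ 4)"
    using assms by (simp add: r_def power_divide power2_eq_square)
  show ?thesis
    unfolding t1 t2 h2 unfolding q by algebra
qed

lemma prof_deriv: 
  "((\<lambda>a. (prof_h m p q a)\<^sup>2 / prof_D a) has_real_derivative prof_g' m p q a) (at a)"
proof -
  have h: "(prof_h m p q has_real_derivative prof_h' m p a) (at a)"
    unfolding prof_h_def[abs_def] prof_h'_def by (auto intro!: derivative_eq_intros simp: power2_eq_square algebra_simps)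
  have D: "(prof_D has_real_derivative prof_D' a) (at a)"
    unfolding prof_D_def[abs_def] prof_D'_def by (auto intro!: derivative_eq_intros)
  have ne: "prof_D a \<noteq> 0" using prof_D_pos[of a] by simp
  show ?thesis
    unfolding prof_g'_def
    by (rule DERIV_cong[OF DERIV_divide[OF DERIV_power[OF h, of 2] D ne]]) (simp add: power2_eq_square algebra_simps)
qed

section \<open>A global Lipschitz bound for the derivative of the profile term\<close>

lemma abs_add_le: "\<bar>x\<bar> \<le> a \<Longrightarrow> \<bar>y\<bar> \<le> b \<Longrightarrow> \<bar>x + y\<bar> \<le> a + (b::real)"
  by linarith

lemma abs_diff_le: "\<bar>x\<bar> \<le> a \<Longrightarrow> \<bar>y\<bar> \<le> b \<Longrightarrow> \<bar>x - y\<bar> \<le> a + (b::real)"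
  by linarith

lemma abs_mult_le: "\<bar>x\<bar> \<le> a \<Longrightarrow> \<bar>y\<bar> \<le> b \<Longrightarrow> \<bar>x * y\<bar> \<le> a * (b::real)"
  unfolding abs_mult by (intro mult_mono) auto

lemma prof_g'_lipschitz: "\<exists>c. \<forall>a b. \<bar>prof_g' m p q a - prof_g' m p q b\<bar> \<le> c * \<bar>a - b\<bar>"
proof -
  define h where "h = prof_h m p q"
  define h1 where "h1 = prof_h' m p"
  define h2 where "h2 a = - (6 * (a * p)) - 2 * m" for a
  define D where "D = prof_D"
  define D1 where "D1 = prof_D'"
  define D2 where "D2 a = 2 + 12 * a ^ 2" for a :: real
  define N where "N a = 2 * h a * h1 a * D a - h a * h a * D1 a" for a
  define N1 where "N1 a = 2 * (h1 a * h1 a + h a * h2 a) * D a - h a * h a * D2 a" for a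
  define g2 where "g2 a = (N1 a * (D a * D a) - N a * (2 * D a * D1 a)) / (D a * D a * (D a * D a))" for a
  have deriv: "(prof_g' m p q has_real_derivative g2 a) (at a)" for a
  proof -
    have h: "(h has_real_derivative h1 a) (at a)"
      unfolding h_def h1_def prof_h_def[abs_def] prof_h'_def by (auto intro!: derivative_eq_intros simp: power2_eq_square algebra_simps)
    have h1: "(h1 has_real_derivative h2 a) (at a)"
      unfolding h1_def h2_def prof_h'_def[abs_def] by (auto intro!: derivative_eq_intros simp: power2_eq_square algebra_simps)
    have D: "(D has_real_derivative D1 a) (at a)"
      unfolding D_def D1_def prof_D_def[abs_def] prof_D'_def by (auto intro!: derivative_eq_intros)
    have D1: "(D1 has_real_derivative D2 a) (at a)"
      unfolding D1_def D2_def prof_D'_def[abs_def] by (auto intro!: derivative_eq_intros)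
    have ne: "D a * D a \<noteq> 0" using prof_D_pos[of a] by (simp add: D_def)
    have N: "(N has_real_derivative N1 a) (at a)"
      unfolding N_def[abs_def] N1_def by (auto intro!: derivative_eq_intros h h1 D D1 simp: algebra_simps)
    have DD: "((\<lambda>a. D a * D a) has_real_derivative 2 * D a * D1 a) (at a)"
      by (auto intro!: derivative_eq_intros D)
    have "prof_g' m p q = (\<lambda>a. N a / (D a * D a))"
      by (simp add: fun_eq_iff prof_g'_def N_def h_def h1_def D_def D1_def power2_eq_square)
    then show ?thesis
      unfolding g2_def by (simp only:) (rule DERIV_divide[OF N DD ne])
  qed
  define k where "k = \<bar>p\<bar> + \<bar>q\<bar> + \<bar>m\<bar>"
  \<comment> \<open>The constant is not sharp. It is \<open>(2 * (6 * 6 + 5 * 8) * 3 + 5 * 5 * 14) *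
    9 + (2 * 5 * 6 * 3 + 5 * 5 * 6) * 36\<close>, from the coefficient bounds of the factors of
    \<open>g2\<close>.\<close>
  have bound: "\<bar>g2 a\<bar> \<le> 19134 * k\<^sup>2" for a
  proof -
    \<comment> \<open>With \<open>M\<close> at least 1, lower powers of \<open>a\<close> can be
      raised to the top degree of each factor. Numerator and denominator of \<open>g2\<close> then
      both have degree 16, and \<open>D a\<close> is at least \<open>M ^ 4\<close>, so all powers of
      \<open>M\<close> cancel.\<close>
    define M where "M = max 1 \<bar>a\<bar>"
    have M1: "1 \<le> M" and aM: "\<bar>a\<bar> \<le> M" by (auto simp: M_def)
    have pw: "\<bar>a ^ i\<bar> \<le> M ^ j" if "i \<le> j" for i j
    proof -
      have "\<bar>a ^ i\<bar> \<le> M ^ i" using aM by (simp add: power_abs power_mono)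
      also have "\<dots> \<le> M ^ j" using M1 that by (rule power_increasing[rotated])
      finally show ?thesis .
    qed
    have k0: "0 \<le> k" "\<bar>p\<bar> \<le> k" "\<bar>q\<bar> \<le> k" "\<bar>m\<bar> \<le> k" by (auto simp: k_def)
    have t: "\<bar>a ^ i * x\<bar> \<le> M ^ j * k" if "i \<le> j" "\<bar>x\<bar> \<le> k" for x i j
      using abs_mult_le[OF pw[OF that(1)] that(2)] .
    have c: "\<bar>numeral n\<bar> \<le> (numeral n :: real)" for n by simp
    have bh: "\<bar>h a\<bar> \<le> 5 * (M ^ 3 * k)"
    proof -
      have "h a = a ^ 0 * q - a ^ 3 * p - (a ^ 0 * m + a ^ 1 * m + a ^ 2 * m)"
        by (simp add: h_def prof_h_def algebra_simps)
      also have "\<bar>\<dots>\<bar> \<le> M ^ 3 * k + M ^ 3 * k + (M ^ 3 * k + M ^ 3 * k + M ^ 3 * k)"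
        by (intro abs_add_le abs_diff_le t k0) auto
      finally show ?thesis by (simp add: mult.commute)
    qed
    have bh1: "\<bar>h1 a\<bar> \<le> 6 * (M ^ 2 * k)"
    proof -
      have "h1 a = - 3 * (a ^ 2 * p) - (a ^ 0 * m + 2 * (a ^ 1 * m))"
        by (simp add: h1_def prof_h'_def algebra_simps)
      also have "\<bar>\<dots>\<bar> \<le> 3 * (M ^ 2 * k) + (M ^ 2 * k + 2 * (M ^ 2 * k))"
        by (intro abs_add_le abs_diff_le abs_mult_le t k0) auto
      finally show ?thesis by (simp add: mult.commute)
    qed
    have bh2: "\<bar>h2 a\<bar> \<le> 8 * (M ^ 1 * k)"
    proof -
      have "h2 a = - 6 * (a ^ 1 * p) - 2 * (a ^ 0 * m)" by (simp add: h2_def)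
      also have "\<bar>\<dots>\<bar> \<le> 6 * (M ^ 1 * k) + 2 * (M ^ 1 * k)"
        by (intro abs_add_le abs_diff_le abs_mult_le t k0) auto
      finally show ?thesis by (simp add: mult.commute)
    qed
    have bD: "\<bar>D a\<bar> \<le> 3 * M ^ 4"
    proof -
      have "D a = a ^ 0 + a ^ 2 + a ^ 4" by (simp add: D_def prof_D_def)
      also have "\<bar>\<dots>\<bar> \<le> M ^ 4 + M ^ 4 + M ^ 4" by (intro abs_add_le pw) auto
      finally show ?thesis by (simp add: mult.commute)
    qed
    have bD1: "\<bar>D1 a\<bar> \<le> 6 * M ^ 3"
    proof -
      have "D1 a = 2 * a ^ 1 + 4 * a ^ 3" by (simp add: D1_def prof_D'_def)
      also have "\<bar>\<dots>\<bar> \<le> 2 * M ^ 3 + 4 * M ^ 3" by (intro abs_add_le abs_mult_le pw) auto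
      finally show ?thesis by (simp add: mult.commute)
    qed
    have bD2: "\<bar>D2 a\<bar> \<le> 14 * M ^ 2"
    proof -
      have "D2 a = 2 * a ^ 0 + 12 * a ^ 2" by (simp add: D2_def)
      also have "\<bar>\<dots>\<bar> \<le> 2 * M ^ 2 + 12 * M ^ 2" by (intro abs_add_le abs_mult_le pw) auto
      finally show ?thesis by (simp add: mult.commute)
    qed
    have MD: "M ^ 4 \<le> D a"
    proof (cases "\<bar>a\<bar> \<le> 1")
      case True
      then have "M = 1" by (simp add: M_def)
      then show ?thesis by (simp add: D_def prof_D_def)
    next
      case False
      then have "M ^ 4 = a ^ 4" by (simp add: M_def)
      then show ?thesis by (simp add: D_def prof_D_def)
    qed
    have "\<bar>N1 a * (D a * D a) - N a * (2 * D a * D1 a)\<bar>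
       \<le> (2 * (6 * (M ^ 2 * k) * (6 * (M ^ 2 * k)) + 5 * (M ^ 3 * k) * (8 * (M ^ 1 * k))) * (3 * M ^ 4)
            + 5 * (M ^ 3 * k) * (5 * (M ^ 3 * k)) * (14 * M ^ 2)) * (3 * M ^ 4 * (3 * M ^ 4))
        + (2 * (5 * (M ^ 3 * k)) * (6 * (M ^ 2 * k)) * (3 * M ^ 4) + 5 * (M ^ 3 * k) * (5 * (M ^ 3 * k)) * (6 * M ^ 3))
            * (2 * (3 * M ^ 4) * (6 * M ^ 3))"
      unfolding N1_def N_def by (intro abs_add_le abs_diff_le abs_mult_le bh bh1 bh2 bD bD1 bD2 c)
    also have "\<dots> = 19134 * k\<^sup>2 * (M ^ 4 * M ^ 4 * (M ^ 4 * M ^ 4))"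
      by algebra
    also have "\<dots> \<le> 19134 * k\<^sup>2 * (D a * D a * (D a * D a))"
      using M1 MD prof_D_pos[of a, folded D_def] by (intro mult_left_mono mult_mono mult_nonneg_nonneg) auto
    finally show ?thesis
      using prof_D_pos[of a] by (simp add: g2_def D_def abs_divide pos_divide_le_eq)
  qed
  have "\<bar>prof_g' m p q a - prof_g' m p q b\<bar> \<le> (19134 * k\<^sup>2) * \<bar>a - b\<bar>" for a b
    using field_differentiable_bound[of UNIV "prof_g' m p q" g2 "19134 * k\<^sup>2" a b] deriv bound by auto
  then show ?thesis by blast
qed

section \<open>The profile criterion and uniqueness of its minimiser\<close>

lemma Qn_profile:
  "Qn s m n y a (y s + theta1 m (y (s - 1)) (y (s + 2)) a + e1) (y (s + 1) + theta2 m (y (s - 1)) (y (s + 2)) a + e2)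
    = (\<Sum>k \<in> {1..n} - {s, s + 1, s + 2}. (y k - a * y (k - 1) - m)\<^sup>2)
      + (prof_h m (y (s - 1)) (y (s + 2)) a)\<^sup>2 / prof_D a + (e1\<^sup>2 + (a * e1 - e2)\<^sup>2 + (a * e2)\<^sup>2)"
  using outlier_terms_eq[OF prof_D_def, of a "y s" "y (s - 1)" m "y (s + 2)" e1 "y (s + 1)" e2] prof_D_pos[of a]
  unfolding Qn_def theta1_def theta2_def prof_h_def by (simp add: add.assoc)

text \<open>The derivative \<open>d\<close> of the profile increases with slope at least
  \<open>2 * A - c > 0\<close>, so it has exactly one zero, the unique minimum. The position of the
  estimate relative to \<open>x\<close> is then the sign of \<open>d x\<close>, which is linear in
  \<open>A\<close> and \<open>B\<close>; this is the source of the event identity.\<close>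

lemma cls_est_unique:
  fixes y :: "nat \<Rightarrow> real" and s n :: nat and m :: real
  defines "I \<equiv> {1..n} - {s, s + 1, s + 2}"
  defines "A \<equiv> \<Sum>k\<in>I. (y (k - 1))\<^sup>2" and "B \<equiv> \<Sum>k\<in>I. y (k - 1) * (y k - m)"
  defines "p \<equiv> y (s - 1)" and "q \<equiv> y (s + 2)"
  assumes lip: "\<And>a b. \<bar>prof_g' m p q a - prof_g' m p q b\<bar> \<le> c * \<bar>a - b\<bar>" and c: "c < 2 * A"
  shows "\<exists>a. cls_est s m n y = (a, y s + theta1 m p q a, y (s + 1) + theta2 m p q a)
     \<and> (\<forall>x. a \<le> x \<longleftrightarrow> 0 \<le> 2 * A * x - 2 * B + prof_g' m p q x)"
proof -
  define F where "F a = (\<Sum>k\<in>I. (y k - a * y (k - 1) - m)\<^sup>2) + (prof_h m p q a)\<^sup>2 / prof_D a" for a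
  define d where "d a = 2 * A * a - 2 * B + prof_g' m p q a" for a
  have F': "(F has_real_derivative d a) (at a)" for a
  proof -
    have "((\<lambda>a. \<Sum>k\<in>I. (y k - a * y (k - 1) - m)\<^sup>2) has_real_derivative (\<Sum>k\<in>I. 2 * (y k - a * y (k - 1) - m) * (- y (k - 1)))) (at a)"
      by (rule DERIV_sum) (auto intro!: derivative_eq_intros simp: algebra_simps)
    also have "(\<Sum>k\<in>I. 2 * (y k - a * y (k - 1) - m) * (- y (k - 1)))
        = (\<Sum>k\<in>I. 2 * a * (y (k - 1))\<^sup>2 - 2 * (y (k - 1) * (y k - m)))"
      by (intro sum.cong) (auto simp: power2_eq_square algebra_simps)
    also have "\<dots> = 2 * A * a - 2 * B"
      by (simp add: A_def B_def sum_subtractf sum_distrib_left mult_ac)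
    finally show ?thesis unfolding F_def[abs_def] d_def by (intro DERIV_add prof_deriv)
  qed
  have inc: "(2 * A - c) * (b - a) \<le> d b - d a" if "a \<le> b" for a b
    using lip[of a b] that by (simp add: d_def algebra_simps)
  have less: "d a < d b" if "a < b" for a b
    using inc[of a b] that mult_pos_pos[of "2 * A - c" "b - a"] c by linarith
  have contg: "isCont (prof_g' m p q) x" for x
  proof -
    have "((\<lambda>z. c * \<bar>z - x\<bar>) \<longlongrightarrow> c * \<bar>x - x\<bar>) (at x)" by (intro tendsto_intros)
    then have 0: "((\<lambda>z. c * \<bar>z - x\<bar>) \<longlongrightarrow> 0) (at x)" by simp
    have "((\<lambda>z. prof_g' m p q z - prof_g' m p q x) \<longlongrightarrow> 0) (at x)"
      by (rule Lim_null_comparison[OF _ 0]) (simp add: lip)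
    then show ?thesis unfolding isCont_def by (simp add: LIM_zero_iff)
  qed
  then have contd: "isCont d x" for x
    unfolding d_def[abs_def] by (intro continuous_intros)
  obtain a where a: "d a = 0"
  proof -
    \<comment> \<open>The distance over which a slope of \<open>2 * A - c\<close> makes up for
      \<open>d 0\<close>, so that \<open>d\<close> changes sign between \<open>- b\<close> and
      \<open>b\<close>.\<close>
    define b where "b = \<bar>d 0\<bar> / (2 * A - c)"
    have b: "0 \<le> b" "(2 * A - c) * b = \<bar>d 0\<bar>" using c by (auto simp: b_def)
    have "d (- b) \<le> 0" using inc[of "- b" 0] b by simp
    moreover have "0 \<le> d b" using inc[of 0 b] b by simp
    ultimately have "\<exists>x. - b \<le> x \<and> x \<le> b \<and> d x = 0"
      using b contd by (intro IVT) auto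
    then show thesis using that by blast
  qed
  have iff: "a \<le> x \<longleftrightarrow> 0 \<le> d x" for x
    using less[of a x] less[of x a] a by (cases a x rule: linorder_cases) auto
  have Fmin: "F a < F x" if "x \<noteq> a" for x
  proof (cases "a < x")
    case True
    then obtain z where "a < z" "z < x" "F x - F a = (x - a) * d z" using MVT2[of a x F d] F' by auto
    then show ?thesis using less[of a z] a True by (metis diff_gt_0_iff_gt mult_pos_pos)
  next
    case False
    then have xa: "x < a" using that by simp
    then obtain z where "x < z" "z < a" "F a - F x = (a - x) * d z" using MVT2[of x a F d] F' by auto
    then show ?thesis using less[of z a] a xa by (metis diff_gt_0_iff_gt diff_less_0_iff_less mult_pos_neg)
  qed
  have Q: "Qn s m n y x t1 t2 = F x + ((t1 - y s - theta1 m p q x)\<^sup>2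
      + (x * (t1 - y s - theta1 m p q x) - (t2 - y (s + 1) - theta2 m p q x))\<^sup>2 + (x * (t2 - y (s + 1) - theta2 m p q x))\<^sup>2)" for x t1 t2
    using Qn_profile[of s m n y x "t1 - y s - theta1 m p q x" "t2 - y (s + 1) - theta2 m p q x"]
    unfolding F_def I_def p_def q_def by simp
  let ?e = "(a, y s + theta1 m p q a, y (s + 1) + theta2 m p q a)"
  have Qe: "Qn s m n y a (y s + theta1 m p q a) (y (s + 1) + theta2 m p q a) = F a"
    unfolding Q by simp
  have min: "Qn_minimizer s m n y ?e"
  proof -
    have "F a \<le> Qn s m n y x t1 t2" for x t1 t2
    proof -
      have "F a \<le> F x" using Fmin[of x] by (cases "x = a") auto
      also have "\<dots> \<le> Qn s m n y x t1 t2" unfolding Q by simp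
      finally show ?thesis .
    qed
    then show ?thesis unfolding Qn_minimizer_def fst_conv snd_conv Qe by blast
  qed
  have uniq: "z = ?e" if z: "Qn_minimizer s m n y z" for z
  proof -
    obtain x t1 t2 where z_eq: "z = (x, t1, t2)" by (cases z)
    have le: "Qn s m n y x t1 t2 \<le> F a"
      using z Qe unfolding Qn_minimizer_def z_eq by (metis fst_conv snd_conv)
    have "F x \<le> Qn s m n y x t1 t2" unfolding Q by simp
    then have x: "x = a" using Fmin[of x] le by force
    define e1 where "e1 = t1 - y s - theta1 m p q a"
    define e2 where "e2 = t2 - y (s + 1) - theta2 m p q a"
    \<comment> \<open>Since \<open>a\<close> may be 0, the last square does not determine
      \<open>e2\<close>; the first forces \<open>e1 = 0\<close>, and the middle one then becomes the
      square of \<open>e2\<close>.\<close>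
    have 0: "e1\<^sup>2 + (a * e1 - e2)\<^sup>2 + (a * e2)\<^sup>2 \<le> 0"
      using le unfolding Q x e1_def e2_def by simp
    have "e1\<^sup>2 \<le> 0" using 0 zero_le_power2[of "a * e1 - e2"] zero_le_power2[of "a * e2"] by linarith
    then have e1: "e1 = 0" by simp
    then have "e2\<^sup>2 + (a * e2)\<^sup>2 \<le> 0" using 0 by simp
    then have "e2\<^sup>2 \<le> 0" using zero_le_power2[of "a * e2"] by linarith
    then have "e2 = 0" by simp
    then show ?thesis using e1 unfolding z_eq x e1_def e2_def by simp
  qed
  have ex1: "\<exists>!z. Qn_minimizer s m n y z" using min uniq by blast
  have "cls_est s m n y = ?e"
    unfolding cls_est_def if_P[OF ex1] by (rule the1_equality[OF ex1 min])
  then show ?thesis using iff unfolding d_def by blast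
qed

text \<open>At \<open>a = \<alpha>\<close> this is the first entry of the vector \<open>f\<close> in
  the limiting covariance: that vector is the gradient appearing in the delta method.\<close>

lemma theta1_deriv:
  "(theta1 m p q has_real_derivative
     ((a ^ 2 - 1) * (a ^ 4 + 3 * a ^ 2 + 1) * p + 2 * a * (a ^ 4 - 1) * q
       + a * (2 - a) * (1 + a + a ^ 2) ^ 2 * m) / (prof_D a) ^ 2) (at a)"
proof -
  have D: "(prof_D has_real_derivative prof_D' a) (at a)"
    unfolding prof_D_def[abs_def] prof_D'_def by (auto intro!: derivative_eq_intros)
  have ne: "prof_D a \<noteq> 0" using prof_D_pos[of a] by simp
  have N: "((\<lambda>a. - a * (1 + a ^ 2) * p - a ^ 2 * q - (1 - a ^ 3) * m)
      has_real_derivative (- (1 + 3 * a ^ 2) * p - 2 * a * q + 3 * a ^ 2 * m)) (at a)"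
    by (auto intro!: derivative_eq_intros simp: power2_eq_square power3_eq_cube algebra_simps)
  show ?thesis
    unfolding theta1_def[abs_def]
  proof (rule DERIV_cong[OF DERIV_divide[OF N D ne]])
    show "((- (1 + 3 * a ^ 2) * p - 2 * a * q + 3 * a ^ 2 * m) * prof_D a
        - (- a * (1 + a ^ 2) * p - a ^ 2 * q - (1 - a ^ 3) * m) * prof_D' a) / (prof_D a * prof_D a)
      = ((a ^ 2 - 1) * (a ^ 4 + 3 * a ^ 2 + 1) * p + 2 * a * (a ^ 4 - 1) * q
       + a * (2 - a) * (1 + a + a ^ 2) ^ 2 * m) / (prof_D a) ^ 2"
      unfolding power2_eq_square[of "prof_D a"]
      by (rule arg_cong[where f="\<lambda>x. x / (prof_D a * prof_D a)"]) (unfold prof_D_def prof_D'_def, algebra)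
  qed
qed

text \<open>Up to terms free of the two outlier-free states, the three affected squares are
  unchanged when these states are exchanged together with \<open>p\<close> and \<open>q\<close>. One
  derivative thus serves both outliers.\<close>

lemma theta2_eq_theta1: "theta2 m p q = theta1 m q p"
  by (simp add: fun_eq_iff theta1_def theta2_def algebra_simps)

subsection \<open>The model as a Markov chain\<close>

lemma measurable_add_nat:
  fixes f g :: "'a \<Rightarrow> nat"
  assumes f: "f \<in> measurable M (count_space UNIV)" and g: "g \<in> measurable M (count_space UNIV)"
  shows "(\<lambda>x. f x + g x) \<in> measurable M (count_space UNIV)"
proof (rule measurable_compose_countable[OF _ f])
  show "(\<lambda>x. i + g x) \<in> measurable M (count_space UNIV)" for i
    by (rule measurable_compose[OF g]) simp
qed

lemma (in prob_space) indep_pair_law: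
  fixes X :: "'a \<Rightarrow> 'b::countable" and Y :: "'a \<Rightarrow> 'b"
  assumes ind: "indep_var (count_space UNIV) X (count_space UNIV) Y"
    and X: "distr M (count_space UNIV) X = measure_pmf p" and Y: "distr M (count_space UNIV) Y = measure_pmf q"
  shows "distr M (count_space UNIV) (\<lambda>\<omega>. (X \<omega>, Y \<omega>)) = measure_pmf (pair_pmf p q)"
proof -
  note [measurable] = indep_var_rv1[OF ind] indep_var_rv2[OF ind]
  have m: "(\<lambda>\<omega>. (X \<omega>, Y \<omega>)) \<in> measurable M (count_space UNIV)" by measurable
  obtain r where r: "distr M (count_space UNIV) (\<lambda>\<omega>. (X \<omega>, Y \<omega>)) = measure_pmf r"
    using distr_eq_pmf[OF m] .
  have "r = pair_pmf p q"
  proof (rule pmf_eqI)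
    fix z :: "'b \<times> 'b"
    obtain x y where z: "z = (x, y)" by fastforce
    have "pmf r (x, y) = measure (distr M (count_space UNIV) (\<lambda>\<omega>. (X \<omega>, Y \<omega>))) {(x, y)}"
      by (simp add: r measure_pmf_single)
    also have "\<dots> = prob ((\<lambda>\<omega>. (X \<omega>, Y \<omega>)) -` ({x} \<times> {y}) \<inter> space M)"
      using m by (subst measure_distr) auto
    also have "\<dots> = prob (X -` {x} \<inter> space M) * prob (Y -` {y} \<inter> space M)"
      by (rule indep_varD[OF ind]) auto
    also have "prob (X -` {x} \<inter> space M) = measure (distr M (count_space UNIV) X) {x}"
      by (subst measure_distr) auto
    also have "prob (Y -` {y} \<inter> space M) = measure (distr M (count_space UNIV) Y) {y}"
      by (subst measure_distr) auto
    finally show "pmf r z = pmf (pair_pmf p q) z"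
      by (simp add: X Y z pmf_pair measure_pmf_single)
  qed
  then show ?thesis using r by simp
qed

abbreviation coord :: "('a \<Rightarrow> nat) \<Rightarrow> (nat \<Rightarrow> 'a \<Rightarrow> nat) \<Rightarrow> (nat \<Rightarrow> nat \<Rightarrow> 'a \<Rightarrow> nat) \<Rightarrow> inar_idx \<Rightarrow> 'a \<Rightarrow> nat" where
  "coord X0 eps xi i \<omega> \<equiv> (case i of IX0 \<Rightarrow> X0 \<omega> | IEps k \<Rightarrow> eps k \<omega> | IXi k j \<Rightarrow> xi k j \<omega>)"

text \<open>The primitive variables that determine the path up to time \<open>m\<close>. The index
  set is disjoint from the variables of time \<open>Suc m\<close>, so independence follows by
  grouping.\<close>

definition past_idx :: "nat \<Rightarrow> inar_idx set" where
  "past_idx m = {IX0} \<union> {IEps k | k. 1 \<le> k \<and> k \<le> m} \<union> {IXi k j | k j. 1 \<le> k \<and> k \<le> m \<and> 1 \<le> j}"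

text \<open>The same recursion run on coordinate vectors instead of sample points, which exhibits
  \<open>X k\<close> as a measurable function of a restricted independent family.\<close>

definition inar_fun :: "nat \<Rightarrow> (inar_idx \<Rightarrow> nat) \<Rightarrow> nat" where
  "inar_fun = inar (\<lambda>v. v IX0) (\<lambda>k v. v (IEps k)) (\<lambda>k j v. v (IXi k j))"

lemma inar_eq_inar_fun:
  "k \<le> m \<Longrightarrow> inar X0 eps xi k \<omega> = inar_fun k (restrict (\<lambda>i. coord X0 eps xi i \<omega>) (past_idx m))"
  unfolding inar_fun_def by (induction k) (auto simp: past_idx_def)

lemma measurable_inar_fun:
  "k \<le> m \<Longrightarrow> inar_fun k \<in> measurable (PiM (past_idx m) (\<lambda>_. count_space UNIV)) (count_space UNIV)"
proof (induction k)
  case 0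
  have "IX0 \<in> past_idx m" by (simp add: past_idx_def)
  then have "(\<lambda>v. v IX0) \<in> measurable (PiM (past_idx m) (\<lambda>_. count_space UNIV)) (count_space (UNIV :: nat set))"
    by (rule measurable_component_singleton)
  then show ?case by (simp add: inar_fun_def)
next
  case (Suc k)
  then have [measurable]: "inar_fun k \<in> measurable (PiM (past_idx m) (\<lambda>_. count_space UNIV)) (count_space UNIV)" by simp
  have [measurable]: "(\<lambda>v. v (IEps (Suc k))) \<in> measurable (PiM (past_idx m) (\<lambda>_. count_space UNIV)) (count_space (UNIV :: nat set))"
    using Suc.prems by (intro measurable_component_singleton) (auto simp: past_idx_def)
  have s: "(\<lambda>v. \<Sum>j = 1..i. v (IXi (Suc k) j)) \<in> measurable (PiM (past_idx m) (\<lambda>_. count_space UNIV)) (count_space (UNIV :: nat set))" for i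
    using Suc.prems by (intro measurable_sum_nat measurable_component_singleton) (auto simp: past_idx_def)
  have [measurable]: "(\<lambda>v. \<Sum>j = 1..inar_fun k v. v (IXi (Suc k) j)) \<in> measurable (PiM (past_idx m) (\<lambda>_. count_space UNIV)) (count_space (UNIV :: nat set))"
    by (rule measurable_compose_countable[OF s]) simp
  have "(\<lambda>v. (\<Sum>j = 1..inar_fun k v. v (IXi (Suc k) j)) + v (IEps (Suc k))) \<in> measurable (PiM (past_idx m) (\<lambda>_. count_space UNIV)) (count_space (UNIV :: nat set))"
    by (rule measurable_add_nat; measurable)
  then show ?case by (simp add: inar_fun_def)
qed

locale inar_model = inar_law \<alpha> e \<pi> + prob_space M
  for \<alpha> :: real and e \<pi> :: "nat pmf" and M :: "'a measure" +
  fixes X0 :: "'a \<Rightarrow> nat" and eps :: "nat \<Rightarrow> 'a \<Rightarrow> nat" and xi :: "nat \<Rightarrow> nat \<Rightarrow> 'a \<Rightarrow> nat"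
  assumes indep: "indep_vars (\<lambda>_. count_space UNIV) (coord X0 eps xi)
             ({IX0} \<union> {IEps k | k. 1 \<le> k} \<union> {IXi k j | k j. 1 \<le> k \<and> 1 \<le> j})"
    and eps_law: "\<And>k. 1 \<le> k \<Longrightarrow> distr M (count_space UNIV) (eps k) = measure_pmf e"
    and xi_law: "\<And>k j. 1 \<le> k \<Longrightarrow> 1 \<le> j \<Longrightarrow>
             distr M (count_space UNIV) (xi k j)
               = measure_pmf (map_pmf (\<lambda>b. if b then 1 else 0) (bernoulli_pmf \<alpha>))"
    and X0_cube: "integrable M (\<lambda>\<omega>. real (X0 \<omega>) ^ 3)"
begin

abbreviation "X \<equiv> inar X0 eps xi"

lemma coord_measurable:
  "i \<in> {IX0} \<union> {IEps k | k. 1 \<le> k} \<union> {IXi k j | k j. 1 \<le> k \<and> 1 \<le> j}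
     \<Longrightarrow> coord X0 eps xi i \<in> measurable M (count_space UNIV)"
  using indep by (auto simp: indep_vars_def2)

lemma X_measurable[measurable]: "X k \<in> measurable M (count_space UNIV)"
proof -
  have "(\<lambda>\<omega>. restrict (\<lambda>i. coord X0 eps xi i \<omega>) (past_idx k)) \<in> measurable M (PiM (past_idx k) (\<lambda>_. count_space UNIV))"
    by (intro measurable_restrict coord_measurable) (auto simp: past_idx_def)
  from measurable_compose[OF this measurable_inar_fun[of k k]]
  show ?thesis by (simp add: inar_eq_inar_fun[of k k X0 eps xi, symmetric] cong: measurable_cong)
qed

text \<open>The update with the current state frozen at \<open>x\<close>, hence a function of the
  variables of time \<open>Suc m\<close> alone.\<close>

definition next_state :: "nat \<Rightarrow> nat \<Rightarrow> 'a \<Rightarrow> nat" where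
  "next_state m x \<omega> = (\<Sum>j = 1..x. xi (Suc m) j \<omega>) + eps (Suc m) \<omega>"

lemma next_state_law: "distr M (count_space UNIV) (next_state m x) = measure_pmf (K x)"
proof (induction x)
  case 0
  then show ?case using eps_law[of "Suc m"] by (simp add: next_state_def[abs_def] K_0)
next
  case (Suc x)
  let ?A = "{IEps (Suc m)} \<union> {IXi (Suc m) j | j. 1 \<le> j \<and> j \<le> x}" and ?B = "{IXi (Suc m) (Suc x)}"
  let ?R = "\<lambda>C \<omega>. restrict (\<lambda>i. coord X0 eps xi i \<omega>) C"
  have i1: "indep_var (PiM ?A (\<lambda>_. count_space UNIV)) (?R ?A) (PiM ?B (\<lambda>_. count_space UNIV)) (?R ?B)"
    by (rule indep_var_restrict[OF indep]) auto
  have fA: "(\<lambda>v. (\<Sum>j = 1..x. v (IXi (Suc m) j)) + v (IEps (Suc m))) \<in> measurable (PiM ?A (\<lambda>_. count_space UNIV)) (count_space (UNIV :: nat set))"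
    by (intro measurable_add_nat measurable_sum_nat measurable_component_singleton) auto
  have fB: "(\<lambda>v. v (IXi (Suc m) (Suc x))) \<in> measurable (PiM ?B (\<lambda>_. count_space UNIV)) (count_space (UNIV :: nat set))"
    by (intro measurable_component_singleton) auto
  have "indep_var (count_space UNIV) (next_state m x) (count_space UNIV) (xi (Suc m) (Suc x))"
    using indep_var_compose[OF i1 fA fB] by (simp add: comp_def next_state_def[abs_def])
  from indep_pair_law[OF this Suc xi_law]
  have "distr M (count_space UNIV) (\<lambda>\<omega>. (next_state m x \<omega>, xi (Suc m) (Suc x) \<omega>))
     = measure_pmf (pair_pmf (K x) (map_pmf (\<lambda>b. if b then 1 else 0) (bernoulli_pmf \<alpha>)))" by simp
  moreover have "(\<lambda>\<omega>. (next_state m x \<omega>, xi (Suc m) (Suc x) \<omega>)) \<in> measurable M (count_space UNIV)"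
  proof -
    have [measurable]: "next_state m x \<in> measurable M (count_space UNIV)" "xi (Suc m) (Suc x) \<in> measurable M (count_space UNIV)"
      using indep_var_rv1 indep_var_rv2 \<open>indep_var (count_space UNIV) (next_state m x) _ _\<close> by blast+
    show ?thesis by measurable
  qed
  ultimately have "distr M (count_space UNIV) (\<lambda>\<omega>. next_state m x \<omega> + xi (Suc m) (Suc x) \<omega>)
      = measure_pmf (map_pmf (\<lambda>(a, b). a + b) (pair_pmf (K x) (map_pmf (\<lambda>b. if b then 1 else 0) (bernoulli_pmf \<alpha>))))"
    using distr_distr[of "\<lambda>(a, b). a + b" "count_space UNIV" "count_space UNIV" "\<lambda>\<omega>. (next_state m x \<omega>, xi (Suc m) (Suc x) \<omega>)" M]
    by (simp add: map_pmf_rep_eq comp_def)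
  also have "map_pmf (\<lambda>(a, b). a + b) (pair_pmf (K x) (map_pmf (\<lambda>b. if b then 1 else 0) (bernoulli_pmf \<alpha>))) = K (Suc x)"
    unfolding K_Suc pair_pmf_def map_pmf_def bind_assoc_pmf bind_return_pmf
    by (subst bind_commute_pmf) (auto intro!: bind_pmf_cong)
  also have "(\<lambda>\<omega>. next_state m x \<omega> + xi (Suc m) (Suc x) \<omega>) = next_state m (Suc x)"
    by (auto simp: next_state_def)
  finally show ?case .
qed

lemma next_state_measurable: "next_state m x \<in> measurable M (count_space UNIV)"
  unfolding next_state_def[abs_def]
  using coord_measurable[of "IEps (Suc m)"] coord_measurable[of "IXi (Suc m) _"]
  by (intro measurable_add_nat measurable_sum_nat) auto

text \<open>\<open>indep_var\<close> only relates variables of the same type, hence the singleton list.\<close>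
lemma indep_traj_next: "indep_var (count_space UNIV) (traj X m) (count_space UNIV) (\<lambda>\<omega>. [next_state m x \<omega>])"
proof -
  let ?B = "{IEps (Suc m)} \<union> {IXi (Suc m) j | j. 1 \<le> j \<and> j \<le> x}"
  let ?R = "\<lambda>C \<omega>. restrict (\<lambda>i. coord X0 eps xi i \<omega>) C"
  have i1: "indep_var (PiM (past_idx m) (\<lambda>_. count_space UNIV)) (?R (past_idx m)) (PiM ?B (\<lambda>_. count_space UNIV)) (?R ?B)"
    by (rule indep_var_restrict[OF indep]) (auto simp: past_idx_def)
  have fA: "traj inar_fun m \<in> measurable (PiM (past_idx m) (\<lambda>_. count_space UNIV)) (count_space UNIV)"
    by (intro measurable_traj measurable_inar_fun)
  have fB0: "(\<lambda>v. (\<Sum>j = 1..x. v (IXi (Suc m) j)) + v (IEps (Suc m))) \<in> measurable (PiM ?B (\<lambda>_. count_space UNIV)) (count_space (UNIV :: nat set))"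
    by (intro measurable_add_nat measurable_sum_nat measurable_component_singleton) auto
  have fB: "(\<lambda>v. [(\<Sum>j = 1..x. v (IXi (Suc m) j)) + v (IEps (Suc m))]) \<in> measurable (PiM ?B (\<lambda>_. count_space UNIV)) (count_space (UNIV :: nat list set))"
    by (rule measurable_compose[OF fB0, where g="\<lambda>z. [z]"]) simp
  have t: "traj inar_fun m \<circ> ?R (past_idx m) = traj X m"
    by (auto simp: fun_eq_iff traj_def inar_eq_inar_fun[of _ m])
  have "(\<lambda>v. [(\<Sum>j = 1..x. v (IXi (Suc m) j)) + v (IEps (Suc m))]) \<circ> ?R ?B = (\<lambda>\<omega>. [next_state m x \<omega>])"
    by (auto simp: fun_eq_iff next_state_def)
  with t indep_var_compose[OF i1 fA fB] show ?thesis by simp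
qed

text \<open>Stated for a set of paths with common last state: the restarted chain conditions on an
  event of the earlier path together with a prescribed later path, which is such a set.\<close>

lemma model_markov:
  assumes "\<And>l. l \<in> C \<Longrightarrow> last l = x"
  shows "prob {\<omega>\<in>space M. traj X m \<omega> \<in> C \<and> X (Suc m) \<omega> = y}
       = prob {\<omega>\<in>space M. traj X m \<omega> \<in> C} * pmf (K x) y"
proof -
  have ns: "X (Suc m) \<omega> = next_state m x \<omega>" if "traj X m \<omega> \<in> C" for \<omega>
    using assms[OF that] by (simp add: next_state_def)
  have e1: "{\<omega>\<in>space M. traj X m \<omega> \<in> C \<and> X (Suc m) \<omega> = y}
      = (\<lambda>\<omega>. (traj X m \<omega>, [next_state m x \<omega>])) -` (C \<times> {[y]}) \<inter> space M"
    using ns by auto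
  have e2: "(\<lambda>\<omega>. [next_state m x \<omega>]) -` {[y]} \<inter> space M = next_state m x -` {y} \<inter> space M" by auto
  have e3: "{\<omega>\<in>space M. traj X m \<omega> \<in> C} = traj X m -` C \<inter> space M" by auto
  have "prob (next_state m x -` {y} \<inter> space M) = measure (distr M (count_space UNIV) (next_state m x)) {y}"
    by (simp add: measure_distr[OF next_state_measurable])
  also have "\<dots> = pmf (K x) y" by (simp add: next_state_law measure_pmf_single)
  finally have e4: "prob (next_state m x -` {y} \<inter> space M) = pmf (K x) y" .
  have "prob ((\<lambda>\<omega>. (traj X m \<omega>, [next_state m x \<omega>])) -` (C \<times> {[y]}) \<inter> space M)
      = prob (traj X m -` C \<inter> space M) * prob ((\<lambda>\<omega>. [next_state m x \<omega>]) -` {[y]} \<inter> space M)"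
    by (rule indep_varD[OF indep_traj_next[of m x], of C "{[y]}"]) simp_all
  then show ?thesis unfolding e1 e2 e3 e4 .
qed

sublocale chain: inar_chain \<alpha> e \<pi> M X
proof
  fix n y and xs :: "nat list"
  show "prob {\<omega>\<in>space M. traj X n \<omega> = xs \<and> X (Suc n) \<omega> = y} = prob {\<omega>\<in>space M. traj X n \<omega> = xs} * pmf (K (last xs)) y"
    using model_markov[of "{xs}" "last xs" n y] by simp
qed (use X0_cube in auto)

text \<open>An event of the path up to time \<open>N\<close> does not alter the transitions after
  \<open>N\<close>; it only changes the law of the state at \<open>N\<close>, whose third moment
  stays finite because the conditional density is bounded.\<close>

lemma conditioned_chain:
  assumes pos: "0 < prob {\<omega>\<in>space M. traj X N \<omega> \<in> B}"
  shows "inar_chain \<alpha> e \<pi> (uniform_measure M {\<omega>\<in>space M. traj X N \<omega> \<in> B}) (\<lambda>k. X (N + k))"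
proof -
  let ?A = "{\<omega>\<in>space M. traj X N \<omega> \<in> B}"
  let ?P = "uniform_measure M ?A"
  have A[measurable]: "?A \<in> sets M"
    using measurable_sets[OF chain.traj_measurable[of N], of B] by (simp add: vimage_def Int_def conj_commute)
  have eA: "emeasure M ?A \<noteq> 0" "emeasure M ?A \<noteq> \<infinity>" using pos by (auto simp: emeasure_eq_measure)
  interpret P: prob_space ?P by (rule prob_space_uniform_measure[OF eA])
  show ?thesis
  proof
    show "X (N + k) \<in> measurable ?P (count_space UNIV)" for k by simp
    have "integrable M (\<lambda>\<omega>. real (X N \<omega>) ^ 3)"
      by (rule chain.integrable_Z(1)) (rule cubic_growth_power, simp)
    then have fin: "(\<integral>\<^sup>+\<omega>. ennreal (real (X N \<omega>) ^ 3) \<partial>M) < \<infinity>"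
      by (simp add: integrable_iff_bounded)
    have "(\<integral>\<^sup>+\<omega>. ennreal (real (X N \<omega>) ^ 3) \<partial>?P) = (\<integral>\<^sup>+\<omega>. ennreal (real (X N \<omega>) ^ 3) * indicator ?A \<omega> \<partial>M) / emeasure M ?A"
      by (rule nn_integral_uniform_measure) auto
    also have "\<dots> < \<infinity>"
    proof -
      have "(\<integral>\<^sup>+\<omega>. ennreal (real (X N \<omega>) ^ 3) * indicator ?A \<omega> \<partial>M) \<le> (\<integral>\<^sup>+\<omega>. ennreal (real (X N \<omega>) ^ 3) \<partial>M)"
        by (intro nn_integral_mono) (auto split: split_indicator)
      then show ?thesis using fin eA by (auto simp: ennreal_divide_eq_top_iff less_top[symmetric] top_unique)
    qed
    finally show "integrable ?P (\<lambda>\<omega>. real (X (N + 0) \<omega>) ^ 3)"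
      by (simp add: integrable_iff_bounded)
  next
    fix n y and xs :: "nat list"
    assume len: "length xs = Suc n"
    \<comment> \<open>The two pieces overlap: the state at time \<open>N\<close> ends the
      conditioning path and starts the restarted one.\<close>
    let ?C = "{l. length l = Suc (N + n) \<and> take (Suc N) l \<in> B \<and> drop N l = xs}"
    have tr: "traj X N \<omega> = take (Suc N) (traj X (N + n) \<omega>)" "traj (\<lambda>k. X (N + k)) n \<omega> = drop N (traj X (N + n) \<omega>)" for \<omega>
      by (auto simp: list_eq_iff_nth_eq less_Suc_eq_le)
    have E1: "?A \<inter> {\<omega>\<in>space M. traj (\<lambda>k. X (N + k)) n \<omega> = xs} = {\<omega>\<in>space M. traj X (N + n) \<omega> \<in> ?C}"
      by (auto simp: tr)
    have E2: "?A \<inter> {\<omega>\<in>space M. traj (\<lambda>k. X (N + k)) n \<omega> = xs \<and> X (N + Suc n) \<omega> = y}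
        = {\<omega>\<in>space M. traj X (N + n) \<omega> \<in> ?C \<and> X (Suc (N + n)) \<omega> = y}"
      by (auto simp: tr)
    have last: "last l = last xs" if "l \<in> ?C" for l
      using that len by (auto simp: last_drop)
    have m: "traj (\<lambda>k. X (N + k)) n \<in> measurable M (count_space UNIV)" by (rule measurable_traj) simp
    have S1: "{\<omega>\<in>space M. traj (\<lambda>k. X (N + k)) n \<omega> = xs} \<in> sets M"
      using measurable_sets[OF m, of "{xs}"] by (simp add: vimage_def Int_def conj_commute)
    have S2: "{\<omega>\<in>space M. traj (\<lambda>k. X (N + k)) n \<omega> = xs \<and> X (N + Suc n) \<omega> = y} \<in> sets M"
    proof -
      have "{\<omega>\<in>space M. X (N + Suc n) \<omega> = y} \<in> sets M" by measurable
      from sets.Int[OF S1 this] show ?thesis by (rule back_subst[of "\<lambda>S. S \<in> sets M"]) auto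
    qed
    have "P.prob {\<omega>\<in>space M. traj (\<lambda>k. X (N + k)) n \<omega> = xs \<and> X (N + Suc n) \<omega> = y}
        = prob {\<omega>\<in>space M. traj X (N + n) \<omega> \<in> ?C \<and> X (Suc (N + n)) \<omega> = y} / prob ?A"
      using measure_uniform_measure[OF eA S2] by (simp only: E2)
    also have "\<dots> = prob {\<omega>\<in>space M. traj X (N + n) \<omega> \<in> ?C} * pmf (K (last xs)) y / prob ?A"
      using model_markov[of ?C "last xs" "N + n" y] last by simp
    also have "\<dots> = P.prob {\<omega>\<in>space M. traj (\<lambda>k. X (N + k)) n \<omega> = xs} * pmf (K (last xs)) y"
      using measure_uniform_measure[OF eA S1] by (simp only: E1) simp
    finally show "P.prob {\<omega>\<in>space ?P. traj (\<lambda>k. X (N + k)) n \<omega> = xs \<and> X (N + Suc n) \<omega> = y}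
        = P.prob {\<omega>\<in>space ?P. traj (\<lambda>k. X (N + k)) n \<omega> = xs} * pmf (K (last xs)) y"
      by simp
  qed
qed

end

subsection \<open>Limit laws\<close>

text \<open>The mapping theorem for functions varying with \<open>n\<close>: Skorohod's
  representation replaces weak by pointwise convergence, to which continuous convergence and then
  dominated convergence apply.\<close>

lemma weak_conv_continuous_convergence:
  fixes g :: "nat \<Rightarrow> real \<Rightarrow> real"
  assumes rd: "\<And>n. real_distribution (\<mu> n)" "real_distribution M" and wc: "weak_conv_m \<mu> M"
    and [measurable]: "\<And>n. g n \<in> borel_measurable borel" "G \<in> borel_measurable borel"
    and bnd: "\<And>n x. \<bar>g n x\<bar> \<le> B"
    and conv: "\<And>x xs. xs \<longlonglongrightarrow> x \<Longrightarrow> (\<lambda>n. g n (xs n)) \<longlonglongrightarrow> G x"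
  shows "(\<lambda>n. integral\<^sup>L (\<mu> n) (g n)) \<longlonglongrightarrow> integral\<^sup>L M G"
proof -
  note Skorohod[OF rd wc]
  then obtain \<Omega> Ys Y where O: "prob_space \<Omega>"
    and [measurable]: "\<And>n. Ys n \<in> borel_measurable \<Omega>"
    and d1: "\<And>n. distr \<Omega> borel (Ys n) = \<mu> n"
    and [measurable]: "Y \<in> borel_measurable \<Omega>"
    and d2: "distr \<Omega> borel Y = M"
    and lim: "\<And>x :: real. x \<in> space \<Omega> \<Longrightarrow> (\<lambda>n. Ys n x) \<longlonglongrightarrow> Y x"
    by force
  interpret prob_space \<Omega> by (rule O)
  have "(\<lambda>n. integral\<^sup>L \<Omega> (\<lambda>x. g n (Ys n x))) \<longlonglongrightarrow> integral\<^sup>L \<Omega> (\<lambda>x. G (Y x))"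
    by (rule integral_dominated_convergence[where w="\<lambda>_. B"]) (auto intro!: conv lim bnd)
  then show ?thesis by (simp add: d1[symmetric] d2[symmetric] integral_distr)
qed

lemma scaled_difference_lim:
  fixes f :: "real \<Rightarrow> real"
  assumes D: "(f has_real_derivative l) (at a)" and t: "ts \<longlonglongrightarrow> t"
  shows "(\<lambda>n. sqrt (real n) * (f (a + ts n / sqrt (real n)) - f a)) \<longlonglongrightarrow> t * l"
proof -
  \<comment> \<open>Caratheodory's slope function avoids dividing by \<open>ts n\<close>, which may
    vanish.\<close>
  obtain g where g: "\<And>z. f z - f a = g z * (z - a)" "isCont g a" "g a = l"
    using D unfolding CARAT_DERIV by blast
  have "(\<lambda>n. ts n * (1 / sqrt (real n))) \<longlonglongrightarrow> t * 0"
    by (intro tendsto_mult t) real_asymp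
  then have "(\<lambda>n. a + ts n / sqrt (real n)) \<longlonglongrightarrow> a + 0" by (intro tendsto_intros) simp
  then have "(\<lambda>n. g (a + ts n / sqrt (real n))) \<longlonglongrightarrow> l"
    using isCont_tendsto_compose[OF g(2)] g(3) by simp
  then have "(\<lambda>n. ts n * g (a + ts n / sqrt (real n))) \<longlonglongrightarrow> t * l" by (intro tendsto_mult t)
  then show ?thesis
    by (rule Lim_transform_eventually)
      (use eventually_gt_at_top[of 0] in \<open>eventually_elim, simp add: g(1)\<close>)
qed

interpretation std_normal: real_distribution std_normal_distribution
  by (rule real_dist_normal_dist)

lemma normal_eq_distr_std:
  assumes "0 < \<sigma>"
  shows "density lborel (normal_density 0 \<sigma>) = distr std_normal_distribution borel (\<lambda>z. \<sigma> * z)"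
proof -
  have "distributed std_normal_distribution lborel (\<lambda>x. x) std_normal_density"
    unfolding distributed_def by (auto simp: distr_id2 sets_density intro!: measurable_ident_sets)
  from std_normal.normal_density_affine[OF this, of \<sigma> 0] assms
  have "distributed std_normal_distribution lborel (\<lambda>x. \<sigma> * x) (normal_density 0 \<sigma>)" by simp
  from distributed_distr_eq_density[OF this]
  show ?thesis by (simp cong: distr_cong)
qed

text \<open>This makes 0 a continuity point of the limiting distribution function. The case
  \<open>c = 0\<close> covers the degenerate limit of the denominator alone.\<close>

lemma std_normal_affine_atom:
  assumes "c \<noteq> 0 \<or> d \<noteq> (0::real)"
  shows "measure (distr std_normal_distribution borel (\<lambda>z. c * z + d)) {0} = 0"
proof -
  have "measure (distr std_normal_distribution borel (\<lambda>z. c * z + d)) {0} = measure std_normal_distribution {z. c * z + d = 0}"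
    by (subst measure_distr) (auto intro!: arg_cong[where f="measure std_normal_distribution"])
  also have "\<dots> = 0"
  proof (cases "c = 0")
    case True then show ?thesis using assms by simp
  next
    case False
    then have "{z. c * z + d = 0} = {- d / c}" by (auto simp: field_simps eq_neg_iff_add_eq_0)
    moreover have "emeasure std_normal_distribution {- d / c} = 0"
    proof -
      have "AE x in lborel. x \<noteq> - d / c" by (rule AE_lborel_singleton)
      then have "AE x in std_normal_distribution. x \<noteq> - d / c" by (subst AE_density) auto
      then show ?thesis by (subst (asm) AE_iff_measurable[of "{- d / c}"]) auto
    qed
    ultimately show ?thesis by (simp add: measure_def)
  qed
  finally show ?thesis .
qed

lemma char_affine_std_normal:
  "char (distr std_normal_distribution borel (\<lambda>z. c * z + d)) t = exp (of_real (- ((t * c)\<^sup>2) / 2) + \<i> * of_real (t * d))"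
proof -
  have "char (distr std_normal_distribution borel (\<lambda>z. c * z + d)) t = (CLINT z|std_normal_distribution. iexp (t * (c * z + d)))"
    unfolding char_def by (subst integral_distr) auto
  also have "\<dots> = (CLINT z|std_normal_distribution. iexp (t * d) * iexp ((t * c) * z))"
    by (intro Bochner_Integration.integral_cong refl) (simp add: exp_add[symmetric] algebra_simps)
  also have "\<dots> = iexp (t * d) * char std_normal_distribution (t * c)"
    unfolding char_def by simp
  also have "char std_normal_distribution (t * c) = exp (of_real (- ((t * c)\<^sup>2) / 2))"
    by (simp only: char_std_normal_distribution exp_of_real)
  finally show ?thesis by (subst exp_add) (simp only: mult.commute)
qed

section \<open>Weak convergence of the weighted sums with vanishing remainders\<close>

context inar_chain
begin

lemma weak_conv_W:
  assumes [measurable]: "\<And>n. r n \<in> borel_measurable P" and r0: "\<And>\<omega>. (\<lambda>n. r n \<omega>) \<longlonglongrightarrow> 0"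
  shows "weak_conv_m (\<lambda>n. distr P borel (\<lambda>\<omega>. W a b n (n - N) \<omega> + r n \<omega>))
           (distr std_normal_distribution borel (\<lambda>z. a * sqrt V * z + b * EX2))"
proof (rule levy_continuity)
  show "real_distribution (distr P borel (\<lambda>\<omega>. W a b n (n - N) \<omega> + r n \<omega>))" for n
    by (rule real_distribution_distr) measurable
  show "real_distribution (distr std_normal_distribution borel (\<lambda>z. a * sqrt V * z + b * EX2))"
    by (rule std_normal.real_distribution_distr) simp
  fix t
  \<comment> \<open>The frequency is absorbed into the weights, so \<open>char_function_lim\<close>
    for all weights covers every \<open>t\<close>.\<close>
  have Wt: "t * W a b n k \<omega> = W (t * a) (t * b) n k \<omega>" for n k \<omega>
    by (simp add: W_def incr_def sum_distrib_left algebra_simps)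
  have ch: "char (distr P borel (\<lambda>\<omega>. W a b n (n - N) \<omega> + r n \<omega>)) t
      = expectation (\<lambda>\<omega>. iexp (W (t * a) (t * b) n (n - N) \<omega>) * iexp (t * r n \<omega>))" for n
    unfolding char_def by (subst integral_distr) (auto simp: distrib_left exp_add Wt[symmetric])
  have i: "integrable P (\<lambda>\<omega>. iexp (f \<omega>))" if "f \<in> borel_measurable P" for f :: "'a \<Rightarrow> real"
    using that by (intro integrable_const_bound[where B=1]) auto
  have "(\<lambda>n. expectation (\<lambda>\<omega>. iexp (W (t * a) (t * b) n (n - N) \<omega>) * (iexp (t * r n \<omega>) - 1))) \<longlonglongrightarrow> expectation (\<lambda>\<omega>. 0)"
  proof (rule integral_dominated_convergence[where w="\<lambda>_. 2"])
    show "AE \<omega> in P. (\<lambda>n. iexp (W (t * a) (t * b) n (n - N) \<omega>) * (iexp (t * r n \<omega>) - 1)) \<longlonglongrightarrow> 0"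
    proof (intro AE_I2)
      fix \<omega>
      have "(\<lambda>n. iexp (t * r n \<omega>) - 1) \<longlonglongrightarrow> iexp (t * 0) - 1"
        by (intro tendsto_intros r0)
      then have "(\<lambda>n. iexp (t * r n \<omega>) - 1) \<longlonglongrightarrow> 0" by simp
      then show "(\<lambda>n. iexp (W (t * a) (t * b) n (n - N) \<omega>) * (iexp (t * r n \<omega>) - 1)) \<longlonglongrightarrow> 0"
        by (rule Lim_null_comparison[OF always_eventually, rotated, OF tendsto_norm_zero]) (simp add: norm_mult)
    qed
    show "AE \<omega> in P. norm (iexp (W (t * a) (t * b) n (n - N) \<omega>) * (iexp (t * r n \<omega>) - 1)) \<le> 2" for n
    proof (intro AE_I2)
      fix \<omega> show "norm (iexp (W (t * a) (t * b) n (n - N) \<omega>) * (iexp (t * r n \<omega>) - 1)) \<le> 2"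
        using norm_triangle_ineq4[of "iexp (t * r n \<omega>)" 1] by (simp add: norm_mult)
    qed
  qed auto
  then have 1: "(\<lambda>n. expectation (\<lambda>\<omega>. iexp (W (t * a) (t * b) n (n - N) \<omega>) * (iexp (t * r n \<omega>) - 1))) \<longlonglongrightarrow> 0" by simp
  have "expectation (\<lambda>\<omega>. iexp (W (t * a) (t * b) n (n - N) \<omega>) * (iexp (t * r n \<omega>) - 1))
      = char (distr P borel (\<lambda>\<omega>. W a b n (n - N) \<omega> + r n \<omega>)) t - expectation (\<lambda>\<omega>. iexp (W (t * a) (t * b) n (n - N) \<omega>))" for n
  proof -
    have "integrable P (\<lambda>\<omega>. iexp (W (t * a) (t * b) n (n - N) \<omega>) * iexp (t * r n \<omega>))"
      using i[of "\<lambda>\<omega>. W (t * a) (t * b) n (n - N) \<omega> + t * r n \<omega>"] by (simp add: distrib_left exp_add)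
    moreover have "integrable P (\<lambda>\<omega>. iexp (W (t * a) (t * b) n (n - N) \<omega>))" by (rule i) simp
    ultimately show ?thesis unfolding ch by (simp add: right_diff_distrib)
  qed
  from tendsto_add[OF 1[unfolded this] char_function_lim[of "t * a" "t * b" N]]
  have "(\<lambda>n. char (distr P borel (\<lambda>\<omega>. W a b n (n - N) \<omega> + r n \<omega>)) t)
      \<longlonglongrightarrow> exp (of_real (- ((t * a)\<^sup>2) / 2 * V) + \<i> * of_real (t * b * EX2))" by simp
  also have "exp (of_real (- ((t * a)\<^sup>2) / 2 * V) + \<i> * of_real (t * b * EX2))
      = char (distr std_normal_distribution borel (\<lambda>z. a * sqrt V * z + b * EX2)) t"
    unfolding char_affine_std_normal using V_pos by (simp add: power_mult_distrib mult.assoc)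
  finally show "(\<lambda>n. char (distr P borel (\<lambda>\<omega>. W a b n (n - N) \<omega> + r n \<omega>)) t)
      \<longlonglongrightarrow> char (distr std_normal_distribution borel (\<lambda>z. a * sqrt V * z + b * EX2)) t" .
qed

lemma prob_W_nonpos_lim:
  assumes m[measurable]: "\<And>n. r n \<in> borel_measurable P" and r0: "\<And>\<omega>. (\<lambda>n. r n \<omega>) \<longlonglongrightarrow> 0"
    and ab: "a \<noteq> 0 \<or> b \<noteq> 0"
  shows "(\<lambda>n. prob {\<omega>\<in>space P. W a b n (n - N) \<omega> + r n \<omega> \<le> 0})
     \<longlonglongrightarrow> measure std_normal_distribution {z. a * sqrt V * z + b * EX2 \<le> 0}"
proof -
  let ?L = "distr std_normal_distribution borel (\<lambda>z. a * sqrt V * z + b * EX2)"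
  interpret L: real_distribution ?L
    by (rule std_normal.real_distribution_distr) simp
  have "measure ?L {0} = 0"
    by (rule std_normal_affine_atom) (use ab V_pos EX2_pos in auto)
  then have "isCont (cdf ?L) 0" by (simp add: L.isCont_cdf)
  with weak_conv_W[OF m r0, of a b N]
  have "(\<lambda>n. cdf (distr P borel (\<lambda>\<omega>. W a b n (n - N) \<omega> + r n \<omega>)) 0) \<longlonglongrightarrow> cdf ?L 0"
    unfolding weak_conv_m_def weak_conv_def by blast
  moreover have "cdf (distr P borel (\<lambda>\<omega>. W a b n (n - N) \<omega> + r n \<omega>)) 0
      = prob {\<omega>\<in>space P. W a b n (n - N) \<omega> + r n \<omega> \<le> 0}" for n
    unfolding cdf_def by (subst measure_distr) (auto intro!: arg_cong[where f=prob])
  moreover have "cdf ?L 0 = measure std_normal_distribution {z. a * sqrt V * z + b * EX2 \<le> 0}"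
    unfolding cdf_def by (subst measure_distr) (auto intro!: arg_cong[where f="measure std_normal_distribution"])
  ultimately show ?thesis by simp
qed

end

context inar_law
begin

lemma sqrt_sigma2: "sqrt (inar_sigma2 \<alpha> e \<pi>) = sqrt V / EX2" "0 < sqrt V / EX2"
proof -
  have i: "integrable e real" "integrable e (\<lambda>x. (real x)\<^sup>2)"
    using integrable_e[OF cubic_growth_power[of 1]] integrable_e[OF cubic_growth_power[of 2]] by auto
  have "measure_pmf.variance e real = \<sigma>e"
    by (subst measure_pmf.variance_eq[OF i]) (simp add: \<sigma>e_def m2_def \<mu>_def)
  then have "inar_sigma2 \<alpha> e \<pi> = V / EX2 ^ 2"
    by (simp add: inar_sigma2_def V_def EX2_def EX3_def)
  then show "sqrt (inar_sigma2 \<alpha> e \<pi>) = sqrt V / EX2" using EX2_pos by (simp add: real_sqrt_divide)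
  show "0 < sqrt V / EX2" using V_pos EX2_pos by simp
qed

end

declare inar.simps(2) [simp del]

text \<open>The bound exceeds \<open>n\<close> because \<open>Qn\<close> mentions the observation at
  \<open>s + 2\<close> even for small \<open>n\<close>. Dependence on finitely many observations is
  what makes the estimator measurable.\<close>

lemma cls_est_cong:
  assumes "\<And>k. k \<le> n + s + 2 \<Longrightarrow> y k = y' k"
  shows "cls_est s m n y = cls_est s m n y'"
proof -
  have "Qn s m n y = Qn s m n y'"
    unfolding Qn_def using assms by (auto simp: fun_eq_iff intro!: sum.cong)
  then show ?thesis unfolding cls_est_def Qn_minimizer_def by simp
qed

text \<open>Any choice works: the constant is applied to states that take countably many values, so
  measurability is automatic.\<close>

definition lip_const :: "real \<Rightarrow> real \<Rightarrow> real \<Rightarrow> real" where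
  "lip_const m p q = (SOME c. \<forall>a b. \<bar>prof_g' m p q a - prof_g' m p q b\<bar> \<le> c * \<bar>a - b\<bar>)"

lemma lip_const: "\<bar>prof_g' m p q a - prof_g' m p q b\<bar> \<le> lip_const m p q * \<bar>a - b\<bar>"
  using someI_ex[OF prof_g'_lipschitz[of m p q]] unfolding lip_const_def by blast

text \<open>The residuals \<open>s\<close>, \<open>s + 1\<close>, \<open>s + 2\<close> involve
  outliers, so the first clean transition after them leads from \<open>s + 2\<close> to
  \<open>s + 3\<close>. This fixes the restart time and the number of its steps.\<close>

lemma sum_observed_split:
  fixes f :: "nat \<Rightarrow> real"
  assumes "1 \<le> s" "s + 2 \<le> n"
  shows "(\<Sum>k \<in> {1..n} - {s, s + 1, s + 2}. f k) = (\<Sum>k = 1..<s. f k) + (\<Sum>j < n - (s + 2). f (s + 2 + Suc j))"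
proof -
  have "{1..n} - {s, s + 1, s + 2} = {1..<s} \<union> {s + 3..n}" using assms by auto
  moreover have "sum f ({1..<s} \<union> {s + 3..n}) = (\<Sum>k = 1..<s. f k) + (\<Sum>k = s + 3..n. f k)"
    by (rule sum.union_disjoint) auto
  ultimately have "(\<Sum>k \<in> {1..n} - {s, s + 1, s + 2}. f k) = (\<Sum>k = 1..<s. f k) + (\<Sum>k = s + 3..n. f k)"
    by (simp only:)
  also have "(\<Sum>k = s + 3..n. f k) = (\<Sum>j < n - (s + 2). f (s + 2 + Suc j))"
    by (rule sum.reindex_bij_witness[of _ "\<lambda>j. s + 2 + Suc j" "\<lambda>k. k - (s + 3)"]) (auto intro!: arg_cong[where f=f])
  finally show ?thesis .
qed

context inar_model
begin

definition denom :: "nat \<Rightarrow> nat \<Rightarrow> 'a \<Rightarrow> real" where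
  "denom s n \<omega> = (\<Sum>k \<in> {1..n} - {s, s + 1, s + 2}. (real (X (k - 1) \<omega>))\<^sup>2)"

definition numer :: "nat \<Rightarrow> nat \<Rightarrow> 'a \<Rightarrow> real" where
  "numer s n \<omega> = (\<Sum>k \<in> {1..n} - {s, s + 1, s + 2}. real (X (k - 1) \<omega>) * (real (X k \<omega>) - \<mu>))"

text \<open>The estimator factors through the discrete trajectory, on which every function is
  measurable, including one defined by a unique choice.\<close>

lemma cls_est_measurable:
  "(\<lambda>\<omega>. cls_est s m n (\<lambda>k. outl_Y s \<theta>1 \<theta>2 X k \<omega>)) \<in> measurable M (count_space UNIV)"
proof -
  let ?L = "n + s + 2"
  let ?G = "\<lambda>l. cls_est s m n (\<lambda>k. real (l ! k) + (if k = s then real \<theta>1 else 0) + (if k = s + 1 then real \<theta>2 else 0))"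
  have "(\<lambda>\<omega>. ?G (traj X ?L \<omega>)) \<in> measurable M (count_space UNIV)"
    by (rule measurable_compose[OF chain.traj_measurable, where g="?G"]) simp
  also have "(\<lambda>\<omega>. ?G (traj X ?L \<omega>)) = (\<lambda>\<omega>. cls_est s m n (\<lambda>k. outl_Y s \<theta>1 \<theta>2 X k \<omega>))"
    by (intro ext cls_est_cong) (simp add: outl_Y_def)
  finally show ?thesis .
qed

text \<open>For the remaining residuals neither \<open>k\<close> nor \<open>k - 1\<close> is an
  outlier time, so both sums and the two neighbours are those of the chain itself.\<close>

lemma cls_est_on_good:
  fixes \<theta>1 \<theta>2 :: nat
  assumes s: "1 \<le> s" and good: "lip_const \<mu> (real (X (s - 1) \<omega>)) (real (X (s + 2) \<omega>)) < 2 * denom s n \<omega>"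
  shows "\<exists>a. cls_est s \<mu> n (\<lambda>k. outl_Y s \<theta>1 \<theta>2 X k \<omega>)
        = (a, outl_Y s \<theta>1 \<theta>2 X s \<omega> + theta1 \<mu> (real (X (s - 1) \<omega>)) (real (X (s + 2) \<omega>)) a,
              outl_Y s \<theta>1 \<theta>2 X (s + 1) \<omega> + theta2 \<mu> (real (X (s - 1) \<omega>)) (real (X (s + 2) \<omega>)) a)
     \<and> (\<forall>x. a \<le> x \<longleftrightarrow> 0 \<le> 2 * denom s n \<omega> * x - 2 * numer s n \<omega>
          + prof_g' \<mu> (real (X (s - 1) \<omega>)) (real (X (s + 2) \<omega>)) x)"
proof -
  let ?y = "\<lambda>k. outl_Y s \<theta>1 \<theta>2 X k \<omega>"
  have p: "?y (s - 1) = real (X (s - 1) \<omega>)" and q: "?y (s + 2) = real (X (s + 2) \<omega>)"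
    using s by (auto simp: outl_Y_def)
  have A: "(\<Sum>k \<in> {1..n} - {s, s + 1, s + 2}. (?y (k - 1))\<^sup>2) = denom s n \<omega>"
    unfolding denom_def by (intro sum.cong) (auto simp: outl_Y_def)
  have B: "(\<Sum>k \<in> {1..n} - {s, s + 1, s + 2}. ?y (k - 1) * (?y k - \<mu>)) = numer s n \<omega>"
    unfolding numer_def by (intro sum.cong) (auto simp: outl_Y_def)
  show ?thesis
    using cls_est_unique[of \<mu> ?y s "lip_const \<mu> (real (X (s - 1) \<omega>)) (real (X (s + 2) \<omega>))" n] lip_const good
    unfolding p q A B by blast
qed

end

text \<open>\<open>B\<close> is a set of paths up to \<open>s + 2\<close>, so that one development
  serves both claims: \<open>UNIV\<close> returns the original measure, and prescribed states at
  \<open>s - 1\<close> and \<open>s + 2\<close> give the conditional one.\<close>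

locale inar_outlier = inar_model \<alpha> e \<pi> M X0 eps xi
  for \<alpha> :: real and e \<pi> :: "nat pmf" and M :: "'a measure" and X0 eps xi +
  fixes s \<theta>1 \<theta>2 :: nat and B :: "nat list set"
  assumes s_pos: "1 \<le> s"
    and B_pos: "0 < measure M {\<omega>\<in>space M. traj X (s + 2) \<omega> \<in> B}"
begin

definition "P = uniform_measure M {\<omega>\<in>space M. traj X (s + 2) \<omega> \<in> B}"

lemma chain_P: "inar_chain \<alpha> e \<pi> P (\<lambda>k. X (s + 2 + k))"
  unfolding P_def by (rule conditioned_chain[OF B_pos])

sublocale P: inar_chain \<alpha> e \<pi> P "\<lambda>k. X (s + 2 + k)"
  by (rule chain_P)

lemma measurable_P: "f \<in> measurable M N \<Longrightarrow> f \<in> measurable P N"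
  by (simp add: P_def)

lemma X_measurable_P[measurable]: "X k \<in> measurable P (count_space UNIV)"
  by (rule measurable_P) simp

lemma AE_P: "AE \<omega> in P. traj X (s + 2) \<omega> \<in> B"
proof -
  have "{\<omega>\<in>space M. traj X (s + 2) \<omega> \<in> B} \<in> sets M"
    using measurable_sets[OF chain.traj_measurable[of "s + 2"], of B] by (simp add: vimage_def Int_def conj_commute)
  moreover have "AE \<omega> in M. \<omega> \<in> {\<omega>\<in>space M. traj X (s + 2) \<omega> \<in> B} \<longrightarrow> traj X (s + 2) \<omega> \<in> B" by auto
  ultimately show ?thesis
    unfolding P_def using B_pos by (intro AE_uniform_measureI) auto
qed

abbreviation "p \<omega> \<equiv> real (X (s - 1) \<omega>)"
abbreviation "q \<omega> \<equiv> real (X (s + 2) \<omega>)"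

definition "D0 \<omega> = (\<Sum>k = 1..<s. (real (X (k - 1) \<omega>))\<^sup>2)"
definition "S0 \<omega> = (\<Sum>k = 1..<s. real (X (k - 1) \<omega>) * (real (X k \<omega>) - \<alpha> * real (X (k - 1) \<omega>) - \<mu>))"

lemma D0_measurable[measurable]: "D0 \<in> borel_measurable P"
  unfolding D0_def[abs_def] by measurable

lemma S0_measurable[measurable]: "S0 \<in> borel_measurable P"
  unfolding S0_def[abs_def] by measurable

lemma pq_measurable:
  fixes f :: "real \<Rightarrow> real \<Rightarrow> real"
  shows "(\<lambda>\<omega>. f (p \<omega>) (q \<omega>)) \<in> borel_measurable P"
proof -
  have "(\<lambda>\<omega>. (\<lambda>l. f (real (l ! (s - 1))) (real (l ! (s + 2)))) (traj X (s + 2) \<omega>)) \<in> borel_measurable P"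
    by (rule measurable_compose[OF measurable_P[OF chain.traj_measurable]]) simp
  then show ?thesis by simp
qed

lemma denom_split: "s + 2 \<le> n \<Longrightarrow> denom s n \<omega> = D0 \<omega> + (\<Sum>j < n - (s + 2). (real (X (s + 2 + j) \<omega>))\<^sup>2)"
  unfolding denom_def D0_def using sum_observed_split[OF s_pos, of n "\<lambda>k. (real (X (k - 1) \<omega>))\<^sup>2"] by simp

lemma numer_split: "s + 2 \<le> n \<Longrightarrow> numer s n \<omega> - \<alpha> * denom s n \<omega>
    = S0 \<omega> + (\<Sum>j < n - (s + 2). real (X (s + 2 + j) \<omega>) * (real (X (s + 2 + Suc j) \<omega>) - \<alpha> * real (X (s + 2 + j) \<omega>) - \<mu>))"
proof -
  assume n: "s + 2 \<le> n"
  have "numer s n \<omega> - \<alpha> * denom s n \<omega>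
      = (\<Sum>k \<in> {1..n} - {s, s + 1, s + 2}. real (X (k - 1) \<omega>) * (real (X k \<omega>) - \<alpha> * real (X (k - 1) \<omega>) - \<mu>))"
    unfolding numer_def denom_def sum_distrib_left sum_subtractf[symmetric]
    by (intro sum.cong refl) (simp add: power2_eq_square algebra_simps)
  then show ?thesis
    unfolding S0_def using sum_observed_split[OF s_pos n, of "\<lambda>k. real (X (k - 1) \<omega>) * (real (X k \<omega>) - \<alpha> * real (X (k - 1) \<omega>) - \<mu>)"]
    by simp
qed

lemma W_eq:
  assumes "s + 2 \<le> n"
  shows "P.W a b n (n - (s + 2)) \<omega> = a * (numer s n \<omega> - \<alpha> * denom s n \<omega> - S0 \<omega>) / sqrt (real n) + b * (denom s n \<omega> - D0 \<omega>) / real n"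
proof -
  have "P.W a b n (n - (s + 2)) \<omega>
    = a * (\<Sum>j < n - (s + 2). real (X (s + 2 + j) \<omega>) * (real (X (s + 2 + Suc j) \<omega>) - \<alpha> * real (X (s + 2 + j) \<omega>) - \<mu>)) / sqrt (real n)
      + b * (\<Sum>j < n - (s + 2). (real (X (s + 2 + j) \<omega>))\<^sup>2) / real n"
    unfolding P.W_def incr_def
    by (simp only: sum.distrib sum_distrib_left sum_divide_distrib times_divide_eq_right)
  then show ?thesis using denom_split[OF assms] numer_split[OF assms] by simp
qed

definition "good n = {\<omega>. lip_const \<mu> (p \<omega>) (q \<omega>) < 2 * denom s n \<omega>}"

lemma good_measurable: "{\<omega>\<in>space P. \<omega> \<in> good n} \<in> sets P"
proof -
  note [measurable] = pq_measurable[of "lip_const \<mu>"]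
  have [measurable]: "denom s n \<in> borel_measurable P" unfolding denom_def[abs_def] by measurable
  show ?thesis unfolding good_def by measurable
qed

text \<open>With weights 0 and 1 the limit is the point mass at \<open>EX2 > 0\<close>; after
  division by \<open>n\<close> the threshold in \<open>good\<close> is a pathwise vanishing
  remainder.\<close>

lemma prob_bad: "(\<lambda>n. P.prob {\<omega>\<in>space P. \<omega> \<notin> good n}) \<longlonglongrightarrow> 0"
proof -
  define r where "r n \<omega> = (D0 \<omega> - lip_const \<mu> (p \<omega>) (q \<omega>) / 2) / real n" for n \<omega>
  note [measurable] = pq_measurable[of "lip_const \<mu>"]
  have rm: "r n \<in> borel_measurable P" for n unfolding r_def[abs_def] by measurable
  have r0: "(\<lambda>n. r n \<omega>) \<longlonglongrightarrow> 0" for \<omega> unfolding r_def by (rule lim_const_over_n)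
  have "(\<lambda>n. P.prob {\<omega>\<in>space P. P.W 0 1 n (n - (s + 2)) \<omega> + r n \<omega> \<le> 0}) \<longlonglongrightarrow> 0"
    using P.prob_W_nonpos_lim[OF rm r0, of 0 1 "s + 2"] EX2_pos by simp
  then show ?thesis
  proof (rule Lim_transform_eventually)
    show "\<forall>\<^sub>F n in sequentially. P.prob {\<omega>\<in>space P. P.W 0 1 n (n - (s + 2)) \<omega> + r n \<omega> \<le> 0} = P.prob {\<omega>\<in>space P. \<omega> \<notin> good n}"
      using eventually_ge_at_top[of "s + 2"]
    proof eventually_elim
      case (elim n)
      have "P.W 0 1 n (n - (s + 2)) \<omega> + r n \<omega> = (denom s n \<omega> - lip_const \<mu> (p \<omega>) (q \<omega>) / 2) / real n" for \<omega>
        unfolding W_eq[OF elim] r_def by (simp add: add_divide_distrib diff_divide_distrib)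
      then have "{\<omega>\<in>space P. P.W 0 1 n (n - (s + 2)) \<omega> + r n \<omega> \<le> 0} = {\<omega>\<in>space P. \<omega> \<notin> good n}"
        using elim by (auto simp: good_def divide_le_0_iff)
      then show ?case by simp
    qed
  qed
qed

definition "est n \<omega> = cls_est s \<mu> n (\<lambda>k. outl_Y s \<theta>1 \<theta>2 X k \<omega>)"
definition "T n \<omega> = sqrt (real n) * (fst (est n \<omega>) - \<alpha>)"

lemma est_measurable: "(\<lambda>\<omega>. f (est n \<omega>)) \<in> borel_measurable P"
  unfolding est_def by (rule measurable_compose[OF measurable_P[OF cls_est_measurable]]) simp

lemma T_measurable[measurable]: "T n \<in> borel_measurable P"
  unfolding T_def[abs_def] by (rule est_measurable)

lemma prob_T_lim: "(\<lambda>n. P.prob {\<omega>\<in>space P. T n \<omega> \<le> x}) \<longlonglongrightarrow> measure std_normal_distribution {z. sqrt V / EX2 * z \<le> x}"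
proof -
  \<comment> \<open>Everything in the event identity that is not a sum over the restarted chain: the
    terms before the outliers and the derivative of the profile term, which converges by its
    Lipschitz bound and is divided by \<open>sqrt n\<close>.\<close>
  define r where "r n \<omega> = S0 \<omega> / sqrt (real n) - x * D0 \<omega> / real n
      - prof_g' \<mu> (p \<omega>) (q \<omega>) (\<alpha> + x / sqrt (real n)) / (2 * sqrt (real n))" for n \<omega>
  have rm: "r n \<in> borel_measurable P" for n
    using pq_measurable[of "\<lambda>p q. prof_g' \<mu> p q (\<alpha> + x / sqrt (real n))"]
    unfolding r_def[abs_def] by measurable
  have r0: "(\<lambda>n. r n \<omega>) \<longlonglongrightarrow> 0" for \<omega>
  proof -
    let ?g = "prof_g' \<mu> (p \<omega>) (q \<omega>)" and ?c = "lip_const \<mu> (p \<omega>) (q \<omega>)"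
    have i: "(\<lambda>n. 1 / sqrt (real n)) \<longlonglongrightarrow> 0" by real_asymp
    have "(\<lambda>n. ?c * (\<bar>x\<bar> * (1 / sqrt (real n)))) \<longlonglongrightarrow> ?c * (\<bar>x\<bar> * 0)"
      by (intro tendsto_intros i)
    then have 1: "(\<lambda>n. ?c * (\<bar>x\<bar> / sqrt (real n))) \<longlonglongrightarrow> 0" by simp
    have "(\<lambda>n. ?g (\<alpha> + x / sqrt (real n)) - ?g \<alpha>) \<longlonglongrightarrow> 0"
    proof (rule Lim_null_comparison[OF _ 1], rule always_eventually, rule allI)
      fix n show "norm (?g (\<alpha> + x / sqrt (real n)) - ?g \<alpha>) \<le> ?c * (\<bar>x\<bar> / sqrt (real n))"
        using lip_const[of \<mu> "p \<omega>" "q \<omega>" "\<alpha> + x / sqrt (real n)" \<alpha>] by simp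
    qed
    then have g: "(\<lambda>n. ?g (\<alpha> + x / sqrt (real n))) \<longlonglongrightarrow> ?g \<alpha>" by (simp add: LIM_zero_iff)
    have "(\<lambda>n. S0 \<omega> * (1 / sqrt (real n)) - x * D0 \<omega> / real n
        - ?g (\<alpha> + x / sqrt (real n)) * (1 / sqrt (real n)) / 2) \<longlonglongrightarrow> S0 \<omega> * 0 - 0 - ?g \<alpha> * 0 / 2"
      by (intro tendsto_intros i g lim_const_over_n) simp
    then show ?thesis by (simp add: r_def mult.commute)
  qed
  let ?E1 = "\<lambda>n. {\<omega>\<in>space P. T n \<omega> \<le> x}"
  let ?E2 = "\<lambda>n. {\<omega>\<in>space P. P.W 1 (- x) n (n - (s + 2)) \<omega> + r n \<omega> \<le> 0}"
  let ?bad = "\<lambda>n. {\<omega>\<in>space P. \<omega> \<notin> good n}"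
  have Es: "?E1 n \<in> sets P" "?E2 n \<in> sets P" for n using rm by measurable
  have bm: "?bad n \<in> sets P" for n
  proof -
    have "?bad n = space P - {\<omega>\<in>space P. \<omega> \<in> good n}" by auto
    then show ?thesis using good_measurable by auto
  qed
  have l2: "(\<lambda>n. P.prob (?E2 n)) \<longlonglongrightarrow> measure std_normal_distribution {z. sqrt V / EX2 * z \<le> x}"
  proof -
    have "{z. 1 * sqrt V * z + - x * EX2 \<le> 0} = {z. sqrt V / EX2 * z \<le> x}"
      using EX2_pos by (auto simp: field_simps)
    then show ?thesis
      using P.prob_W_nonpos_lim[OF rm r0, of 1 "- x" "s + 2"] by simp
  qed
  \<comment> \<open>The two events coincide off the bad event, so their probabilities differ by at
    most that of the bad event.\<close>
  have "(\<lambda>n. P.prob (?E1 n) - P.prob (?E2 n)) \<longlonglongrightarrow> 0"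
  proof (rule Lim_null_comparison[OF _ prob_bad])
    show "\<forall>\<^sub>F n in sequentially. norm (P.prob (?E1 n) - P.prob (?E2 n)) \<le> P.prob (?bad n)"
      using eventually_ge_at_top[of "s + 2"]
    proof eventually_elim
      case (elim n)
      have eq: "T n \<omega> \<le> x \<longleftrightarrow> P.W 1 (- x) n (n - (s + 2)) \<omega> + r n \<omega> \<le> 0" if "\<omega> \<in> good n" for \<omega>
      proof -
        have g: "lip_const \<mu> (p \<omega>) (q \<omega>) < 2 * denom s n \<omega>" using that by (simp add: good_def)
        obtain a where a: "est n \<omega> = (a, outl_Y s \<theta>1 \<theta>2 X s \<omega> + theta1 \<mu> (p \<omega>) (q \<omega>) a, outl_Y s \<theta>1 \<theta>2 X (s + 1) \<omega> + theta2 \<mu> (p \<omega>) (q \<omega>) a)"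
          and ax: "\<And>x. a \<le> x \<longleftrightarrow> 0 \<le> 2 * denom s n \<omega> * x - 2 * numer s n \<omega> + prof_g' \<mu> (p \<omega>) (q \<omega>) x"
          using cls_est_on_good[OF s_pos g, of \<theta>1 \<theta>2] unfolding est_def by blast
        define t where "t = sqrt (real n)"
        have t: "0 < t" "real n = t * t" using elim by (auto simp: t_def)
        define G where "G = prof_g' \<mu> (p \<omega>) (q \<omega>) (\<alpha> + x / t)"
        have rt: "r n \<omega> = S0 \<omega> / t - x * D0 \<omega> / (t * t) - G / (2 * t)"
          by (simp add: r_def G_def t_def)
        have Wt: "P.W 1 (- x) n (n - (s + 2)) \<omega>
            = (numer s n \<omega> - \<alpha> * denom s n \<omega> - S0 \<omega>) / t - x * (denom s n \<omega> - D0 \<omega>) / (t * t)"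
          unfolding W_eq[OF elim] by (simp add: t_def)
        have "T n \<omega> \<le> x \<longleftrightarrow> a \<le> \<alpha> + x / t"
          using t(1) by (simp add: T_def a t_def[symmetric] field_simps)
        also have "\<dots> \<longleftrightarrow> 0 \<le> 2 * denom s n \<omega> * (\<alpha> + x / t) - 2 * numer s n \<omega> + G"
          unfolding ax G_def ..
        \<comment> \<open>In the sum of \<open>W\<close> and \<open>r\<close> the terms
          \<open>S0\<close> and \<open>D0\<close> cancel; the factor \<open>- (2 * t)\<close> turns
          the rest into the derivative of the criterion at \<open>\<alpha> + x / t\<close>.\<close>
        also have "\<dots> \<longleftrightarrow> 0 \<le> - (2 * t) * (P.W 1 (- x) n (n - (s + 2)) \<omega> + r n \<omega>)"
        proof -
          have "- (2 * t) * (P.W 1 (- x) n (n - (s + 2)) \<omega> + r n \<omega>) = 2 * denom s n \<omega> * (\<alpha> + x / t) - 2 * numer s n \<omega> + G"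
            unfolding Wt rt using t(1) by (simp add: field_simps)
          then show ?thesis by simp
        qed
        also have "\<dots> \<longleftrightarrow> P.W 1 (- x) n (n - (s + 2)) \<omega> + r n \<omega> \<le> 0"
          using t(1) by (simp add: mult_le_0_iff)
        finally show ?thesis .
      qed
      have "P.prob (?E1 n) \<le> P.prob (?E2 n \<union> ?bad n)"
        using eq by (intro P.finite_measure_mono sets.Un Es bm) auto
      also have "\<dots> \<le> P.prob (?E2 n) + P.prob (?bad n)"
        by (intro measure_Un_le Es bm)
      finally have 1: "P.prob (?E1 n) \<le> P.prob (?E2 n) + P.prob (?bad n)" .
      have "P.prob (?E2 n) \<le> P.prob (?E1 n \<union> ?bad n)"
        using eq by (intro P.finite_measure_mono sets.Un Es bm) auto
      also have "\<dots> \<le> P.prob (?E1 n) + P.prob (?bad n)"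
        by (intro measure_Un_le Es bm)
      finally show ?case using 1 by simp
    qed
  qed
  from tendsto_add[OF this l2] show ?thesis by simp
qed

lemma weak_conv_T:
  "weak_conv_m (\<lambda>n. distr P borel (T n)) (distr std_normal_distribution borel (\<lambda>z. sqrt V / EX2 * z))"
  unfolding weak_conv_m_def weak_conv_def
proof (intro allI impI)
  fix x
  have "cdf (distr P borel (T n)) x = P.prob {\<omega>\<in>space P. T n \<omega> \<le> x}" for n
    unfolding cdf_def by (subst measure_distr) (auto intro!: arg_cong[where f=P.prob])
  moreover have "cdf (distr std_normal_distribution borel (\<lambda>z. sqrt V / EX2 * z)) x
      = measure std_normal_distribution {z. sqrt V / EX2 * z \<le> x}"
    unfolding cdf_def by (subst measure_distr) (auto intro!: arg_cong[where f="measure std_normal_distribution"])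
  ultimately show "(\<lambda>n. cdf (distr P borel (T n)) x) \<longlonglongrightarrow> cdf (distr std_normal_distribution borel (\<lambda>z. sqrt V / EX2 * z)) x"
    using prob_T_lim by simp
qed

lemma outlier_error_measurable:
  "(\<lambda>\<omega>. (sqrt (real n) * (fst (snd (est n \<omega>)) - (outl_Y s \<theta>1 \<theta>2 X s \<omega> + theta1 \<mu> (p \<omega>) (q \<omega>) \<alpha>)),
            sqrt (real n) * (snd (snd (est n \<omega>)) - (outl_Y s \<theta>1 \<theta>2 X (s + 1) \<omega> + theta2 \<mu> (p \<omega>) (q \<omega>) \<alpha>))))
     \<in> borel_measurable P"
proof -
  note [measurable] = est_measurable[of "\<lambda>z. fst (snd z)"] est_measurable[of "\<lambda>z. snd (snd z)"]
    pq_measurable[of "\<lambda>p q. theta1 \<mu> p q \<alpha>"] pq_measurable[of "\<lambda>p q. theta2 \<mu> p q \<alpha>"]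
  show ?thesis unfolding outl_Y_def by measurable
qed

lemma outlier_limit:
  fixes m1 m2 :: real and f :: "real \<times> real \<Rightarrow> real" and l1 l2 :: real
  assumes B: "\<And>\<omega>. traj X (s + 2) \<omega> \<in> B \<Longrightarrow> p \<omega> = m1 \<and> q \<omega> = m2"
    and l1: "(theta1 \<mu> m1 m2 has_real_derivative l1) (at \<alpha>)"
    and l2: "(theta2 \<mu> m1 m2 has_real_derivative l2) (at \<alpha>)"
    and f: "continuous_on UNIV f" "bounded (range f)"
  shows "(\<lambda>n. P.expectation (\<lambda>\<omega>. f (sqrt (real n) * (fst (snd (est n \<omega>)) - (outl_Y s \<theta>1 \<theta>2 X s \<omega> + theta1 \<mu> (p \<omega>) (q \<omega>) \<alpha>)),
            sqrt (real n) * (snd (snd (est n \<omega>)) - (outl_Y s \<theta>1 \<theta>2 X (s + 1) \<omega> + theta2 \<mu> (p \<omega>) (q \<omega>) \<alpha>)))))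
     \<longlonglongrightarrow> (\<integral>z. f (z * (sqrt V / EX2 * l1), z * (sqrt V / EX2 * l2)) \<partial>std_normal_distribution)"
proof -
  obtain C where C: "\<And>x. \<bar>f x\<bar> \<le> C" using f(2) by (auto simp: bounded_iff)
  have [measurable]: "f \<in> borel_measurable borel" by (rule borel_measurable_continuous_onI[OF f(1)])
  have ct: "continuous_on UNIV (theta1 m p q)" for m p q
    using theta1_deriv DERIV_isCont by (intro continuous_at_imp_continuous_on ballI) blast
  have [measurable]: "theta1 m p q \<in> borel_measurable borel" for m p q
    by (rule borel_measurable_continuous_onI[OF ct])
  have [measurable]: "theta2 m p q \<in> borel_measurable borel" for m p q
    unfolding theta2_eq_theta1 by measurable
  \<comment> \<open>Scaled increments of \<open>theta1\<close> and \<open>theta2\<close> at the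
    constants fixed by the conditioning: deterministic functions, converging continuously to a
    linear map.\<close>
  define \<Phi> where "\<Phi> n t = (sqrt (real n) * (theta1 \<mu> m1 m2 (\<alpha> + t / sqrt (real n)) - theta1 \<mu> m1 m2 \<alpha>),
      sqrt (real n) * (theta2 \<mu> m1 m2 (\<alpha> + t / sqrt (real n)) - theta2 \<mu> m1 m2 \<alpha>))" for n t
  define Vn where "Vn n \<omega> = (sqrt (real n) * (fst (snd (est n \<omega>)) - (outl_Y s \<theta>1 \<theta>2 X s \<omega> + theta1 \<mu> (p \<omega>) (q \<omega>) \<alpha>)),
            sqrt (real n) * (snd (snd (est n \<omega>)) - (outl_Y s \<theta>1 \<theta>2 X (s + 1) \<omega> + theta2 \<mu> (p \<omega>) (q \<omega>) \<alpha>)))" for n \<omega>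
  have [measurable]: "(\<lambda>t. f (\<Phi> n t)) \<in> borel_measurable borel" for n
    unfolding \<Phi>_def by measurable
  have [measurable]: "(\<lambda>\<omega>. f (Vn n \<omega>)) \<in> borel_measurable P" for n
    unfolding Vn_def by (rule measurable_compose[OF outlier_error_measurable]) measurable
  have 1: "(\<lambda>n. integral\<^sup>L (distr P borel (T n)) (\<lambda>t. f (\<Phi> n t)))
      \<longlonglongrightarrow> integral\<^sup>L (distr std_normal_distribution borel (\<lambda>z. sqrt V / EX2 * z)) (\<lambda>t. f (t * l1, t * l2))"
  proof (rule weak_conv_continuous_convergence[OF _ _ weak_conv_T])
    show "real_distribution (distr P borel (T n))" for n by (rule P.real_distribution_distr) simp
    show "real_distribution (distr std_normal_distribution borel (\<lambda>z. sqrt V / EX2 * z))"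
      by (rule std_normal.real_distribution_distr) simp
    show "\<bar>f (\<Phi> n t)\<bar> \<le> C" for n t by (rule C)
    fix t ts assume ts: "ts \<longlonglongrightarrow> (t :: real)"
    have lim: "(\<lambda>n. \<Phi> n (ts n)) \<longlonglongrightarrow> (t * l1, t * l2)"
      unfolding \<Phi>_def by (intro tendsto_Pair scaled_difference_lim l1 l2 ts)
    show "(\<lambda>n. f (\<Phi> n (ts n))) \<longlonglongrightarrow> f (t * l1, t * l2)"
      by (rule continuous_on_tendsto_compose[OF f(1) lim]) auto
  qed measurable
  have 2: "integral\<^sup>L (distr P borel (T n)) (\<lambda>t. f (\<Phi> n t)) = P.expectation (\<lambda>\<omega>. f (\<Phi> n (T n \<omega>)))" for n
    by (subst integral_distr) auto
  have 3: "integral\<^sup>L (distr std_normal_distribution borel (\<lambda>z. sqrt V / EX2 * z)) (\<lambda>t. f (t * l1, t * l2))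
      = (\<integral>z. f (z * (sqrt V / EX2 * l1), z * (sqrt V / EX2 * l2)) \<partial>std_normal_distribution)"
    by (subst integral_distr) (auto simp: mult_ac)
  have i1: "integrable P (\<lambda>\<omega>. f (Vn n \<omega>))" for n
    using C by (intro P.integrable_const_bound[where B=C]) auto
  have i2: "integrable P (\<lambda>\<omega>. f (\<Phi> n (T n \<omega>)))" for n
    using C by (intro P.integrable_const_bound[where B=C]) auto
  have bm: "{\<omega>\<in>space P. \<omega> \<notin> good n} \<in> sets P" for n
  proof -
    have "{\<omega>\<in>space P. \<omega> \<notin> good n} = space P - {\<omega>\<in>space P. \<omega> \<in> good n}" by auto
    then show ?thesis using good_measurable by auto
  qed
  \<comment> \<open>On the good event the errors equal \<open>\<Phi> n (T n \<omega>)\<close>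
    exactly. Off it the estimate may even be the default \<open>(0, 0, 0)\<close>, and the bound on
    \<open>f\<close> limits the difference to \<open>2 * C\<close>.\<close>
  have "(\<lambda>n. P.expectation (\<lambda>\<omega>. f (Vn n \<omega>)) - P.expectation (\<lambda>\<omega>. f (\<Phi> n (T n \<omega>)))) \<longlonglongrightarrow> 0"
  proof (rule Lim_null_comparison[OF _ tendsto_mult_right_zero[OF prob_bad, of "2 * C"]])
    show "\<forall>\<^sub>F n in sequentially. norm (P.expectation (\<lambda>\<omega>. f (Vn n \<omega>)) - P.expectation (\<lambda>\<omega>. f (\<Phi> n (T n \<omega>))))
        \<le> 2 * C * P.prob {\<omega>\<in>space P. \<omega> \<notin> good n}"
      using eventually_gt_at_top[of 0]
    proof eventually_elim
      case (elim n)
      have eq: "Vn n \<omega> = \<Phi> n (T n \<omega>)" if "\<omega> \<in> good n" "traj X (s + 2) \<omega> \<in> B" for \<omega>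
      proof -
        have g: "lip_const \<mu> (p \<omega>) (q \<omega>) < 2 * denom s n \<omega>" using that by (simp add: good_def)
        obtain a where a: "est n \<omega> = (a, outl_Y s \<theta>1 \<theta>2 X s \<omega> + theta1 \<mu> (p \<omega>) (q \<omega>) a, outl_Y s \<theta>1 \<theta>2 X (s + 1) \<omega> + theta2 \<mu> (p \<omega>) (q \<omega>) a)"
          using cls_est_on_good[OF s_pos g, of \<theta>1 \<theta>2] unfolding est_def by blast
        have "\<alpha> + T n \<omega> / sqrt (real n) = a" using elim by (simp add: T_def a)
        then show ?thesis using B[OF that(2)] unfolding Vn_def \<Phi>_def a by simp
      qed
      have "norm (P.expectation (\<lambda>\<omega>. f (Vn n \<omega>)) - P.expectation (\<lambda>\<omega>. f (\<Phi> n (T n \<omega>))))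
          = norm (P.expectation (\<lambda>\<omega>. f (Vn n \<omega>) - f (\<Phi> n (T n \<omega>))))"
        using i1 i2 by simp
      also have "\<dots> \<le> P.expectation (\<lambda>\<omega>. norm (f (Vn n \<omega>) - f (\<Phi> n (T n \<omega>))))"
        by (rule integral_norm_bound)
      also have "\<dots> \<le> P.expectation (\<lambda>\<omega>. 2 * C * indicator {\<omega>\<in>space P. \<omega> \<notin> good n} \<omega>)"
      proof (rule integral_mono_AE)
        show "integrable P (\<lambda>\<omega>. norm (f (Vn n \<omega>) - f (\<Phi> n (T n \<omega>))))" using i1 i2 by auto
        show "integrable P (\<lambda>\<omega>. 2 * C * indicator {\<omega>\<in>space P. \<omega> \<notin> good n} \<omega>)"
          using bm[of n] by (intro integrable_mult_right integrable_real_indicator) (auto simp: P.emeasure_eq_measure)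
        show "AE \<omega> in P. norm (f (Vn n \<omega>) - f (\<Phi> n (T n \<omega>))) \<le> 2 * C * indicator {\<omega>\<in>space P. \<omega> \<notin> good n} \<omega>"
          using AE_P AE_space
        proof eventually_elim
          case (elim \<omega>)
          show ?case
          proof (cases "\<omega> \<in> good n")
            case True then show ?thesis using eq elim by simp
          next
            case False
            then show ?thesis using elim C[of "Vn n \<omega>"] C[of "\<Phi> n (T n \<omega>)"] by (auto simp: abs_le_iff)
          qed
        qed
      qed
      also have "\<dots> = 2 * C * P.prob {\<omega>\<in>space P. \<omega> \<notin> good n}"
        using bm[of n] by simp
      finally show ?case .
    qed
  qed
  from tendsto_add[OF this 1[unfolded 2 3]] show ?thesis by (simp add: Vn_def)
qed

end

lemma (in prob_space) uniform_measure_space: "uniform_measure M (space M) = M"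
  by (rule measure_eqI) (auto simp: emeasure_space_1 Int_absorb1 sets.sets_into_space divide_ennreal_def)

theorem theorem3p5p2:
  fixes M :: "'a measure"
    and \<alpha> :: real
    and X0 :: "'a \<Rightarrow> nat"
    and eps :: "nat \<Rightarrow> 'a \<Rightarrow> nat"
    and xi :: "nat \<Rightarrow> nat \<Rightarrow> 'a \<Rightarrow> nat"
    and e :: "nat pmf"
    and \<pi> :: "nat pmf"
    and s \<theta>1 \<theta>2 :: nat
  defines "X \<equiv> inar X0 eps xi"
      and "Y \<equiv> outl_Y s \<theta>1 \<theta>2 (inar X0 eps xi)"
      and "\<mu> \<equiv> measure_pmf.expectation e real"
      and "\<sigma>2 \<equiv> inar_sigma2 \<alpha> e \<pi>"
  assumes "prob_space M"
      and "0 < \<alpha>" and "\<alpha> < 1"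
      and indep: "prob_space.indep_vars M (\<lambda>_. count_space UNIV)
             (\<lambda>i \<omega>. case i of IX0 \<Rightarrow> X0 \<omega> | IEps k \<Rightarrow> eps k \<omega> | IXi k j \<Rightarrow> xi k j \<omega>)
             ({IX0} \<union> {IEps k | k. 1 \<le> k} \<union> {IXi k j | k j. 1 \<le> k \<and> 1 \<le> j})"
      and eps_law: "\<And>k. 1 \<le> k \<Longrightarrow> distr M (count_space UNIV) (eps k) = measure_pmf e"
      and xi_law: "\<And>k j. 1 \<le> k \<Longrightarrow> 1 \<le> j \<Longrightarrow>
             distr M (count_space UNIV) (xi k j)
               = measure_pmf (map_pmf (\<lambda>b. if b then 1 else 0) (bernoulli_pmf \<alpha>))"
      and eps_sq: "integrable (measure_pmf e) (\<lambda>x. real x ^ 2)"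
      and eps_cube: "integrable (measure_pmf e) (\<lambda>x. real x ^ 3)"
      and eps_nontriv: "pmf e 0 < 1"
      and X0_sq: "integrable M (\<lambda>\<omega>. real (X0 \<omega>) ^ 2)"
      and X0_cube: "integrable M (\<lambda>\<omega>. real (X0 \<omega>) ^ 3)"
      and stat: "inar_stationary \<alpha> e \<pi>"
      and "1 \<le> s" and "1 \<le> \<theta>1" and "1 \<le> \<theta>2"
  shows "weak_conv_m
           (\<lambda>n. distr M borel
              (\<lambda>\<omega>. sqrt (real n) * (fst (cls_est s \<mu> n (\<lambda>k. Y k \<omega>)) - \<alpha>)))
           (density lborel (normal_density 0 (sqrt \<sigma>2)))
       \<and> (\<forall>m1 m2 :: nat.
            measure M {\<omega> \<in> space M. Y (s - 1) \<omega> = real m1 \<and> Y (s + 2) \<omega> = real m2} > 0 \<longrightarrow>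
            (let
               D = 1 + \<alpha>^2 + \<alpha>^4;
               L1 = (\<lambda>\<omega>. Y s \<omega> + (- \<alpha> * (1 + \<alpha>^2) * Y (s - 1) \<omega> - \<alpha>^2 * Y (s + 2) \<omega>
                                      - (1 - \<alpha>^3) * \<mu>) / D);
               L2 = (\<lambda>\<omega>. Y (s + 1) \<omega> + (- (\<alpha>^2) * Y (s - 1) \<omega> - \<alpha> * (1 + \<alpha>^2) * Y (s + 2) \<omega>
                                      - (1 - \<alpha>^3) * \<mu>) / D);
               f1 = ((\<alpha>^2 - 1) * (\<alpha>^4 + 3 * \<alpha>^2 + 1) * real m1 + 2 * \<alpha> * (\<alpha>^4 - 1) * real m2
                     + \<alpha> * (2 - \<alpha>) * (1 + \<alpha> + \<alpha>^2)^2 * \<mu>) / D^2;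
               f2 = (2 * \<alpha> * (\<alpha>^4 - 1) * real m1 + (\<alpha>^2 - 1) * (\<alpha>^4 + 3 * \<alpha>^2 + 1) * real m2
                     + \<alpha> * (2 - \<alpha>) * (1 + \<alpha> + \<alpha>^2)^2 * \<mu>) / D^2;
               A = {\<omega> \<in> space M. Y (s - 1) \<omega> = real m1 \<and> Y (s + 2) \<omega> = real m2}
             in weak_conv_gen
                  (\<lambda>n. distr (uniform_measure M A) borel
                     (\<lambda>\<omega>. (sqrt (real n) * (fst (snd (cls_est s \<mu> n (\<lambda>k. Y k \<omega>))) - L1 \<omega>),
                            sqrt (real n) * (snd (snd (cls_est s \<mu> n (\<lambda>k. Y k \<omega>))) - L2 \<omega>))))
                  (normal2_rank1 (sqrt \<sigma>2 * f1, sqrt \<sigma>2 * f2))))"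
proof -
  interpret prob_space M by fact
  interpret inar_model \<alpha> e \<pi> M X0 eps xi
    by (intro inar_model.intro inar_law.intro inar_model_axioms.intro) fact+
  have \<mu>: "\<mu> = inar_law.\<mu> e" by (simp add: assms(3) \<mu>_def)
  have \<sigma>2: "sqrt \<sigma>2 = sqrt V / EX2" by (simp add: assms(4) sqrt_sigma2)
  have part1: "weak_conv_m
           (\<lambda>n. distr M borel
              (\<lambda>\<omega>. sqrt (real n) * (fst (cls_est s \<mu> n (\<lambda>k. Y k \<omega>)) - \<alpha>)))
           (density lborel (normal_density 0 (sqrt \<sigma>2)))"
  proof -
    \<comment> \<open>The unconditional claim is the case of conditioning on the sure event.\<close>
    interpret O: inar_outlier \<alpha> e \<pi> M X0 eps xi s \<theta>1 \<theta>2 UNIV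
      by unfold_locales (use \<open>1 \<le> s\<close> prob_space in auto)
    have "O.P = M" unfolding O.P_def by (simp add: uniform_measure_space)
    then show ?thesis
      using O.weak_conv_T
      by (simp add: \<sigma>2 normal_eq_distr_std[OF sqrt_sigma2(2)] O.T_def[abs_def] O.est_def \<mu> assms(2))
  qed
  show ?thesis
  proof (intro conjI part1 allI impI, goal_cases)
    case (1 m1 m2)
    let ?A = "{\<omega> \<in> space M. Y (s - 1) \<omega> = real m1 \<and> Y (s + 2) \<omega> = real m2}"
    \<comment> \<open>The outliers leave the observations at \<open>s - 1\<close> and
      \<open>s + 2\<close> untouched, so the conditioning event is an event of the path up to
      \<open>s + 2\<close>.\<close>
    define C where "C = {l :: nat list. l ! (s - 1) = m1 \<and> l ! (s + 2) = m2}"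
    have Y: "Y (s - 1) \<omega> = real (inar X0 eps xi (s - 1) \<omega>)" "Y (s + 2) \<omega> = real (inar X0 eps xi (s + 2) \<omega>)" for \<omega>
      using \<open>1 \<le> s\<close> by (auto simp: assms(2) outl_Y_def)
    have C: "traj (inar X0 eps xi) (s + 2) \<omega> \<in> C
        \<longleftrightarrow> inar X0 eps xi (s - 1) \<omega> = m1 \<and> inar X0 eps xi (s + 2) \<omega> = m2" for \<omega>
      by (simp add: C_def)
    have A: "?A = {\<omega>\<in>space M. traj (inar X0 eps xi) (s + 2) \<omega> \<in> C}"
      unfolding C Y by simp
    interpret O: inar_outlier \<alpha> e \<pi> M X0 eps xi s \<theta>1 \<theta>2 C
      by unfold_locales (use \<open>1 \<le> s\<close> 1 A in auto)
    have P: "uniform_measure M ?A = O.P" unfolding O.P_def A ..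
    define Err where "Err n \<omega> = (sqrt (real n) * (fst (snd (O.est n \<omega>)) - (outl_Y s \<theta>1 \<theta>2 (inar X0 eps xi) s \<omega>
          + theta1 \<mu> (O.p \<omega>) (O.q \<omega>) \<alpha>)),
        sqrt (real n) * (snd (snd (O.est n \<omega>)) - (outl_Y s \<theta>1 \<theta>2 (inar X0 eps xi) (s + 1) \<omega>
          + theta2 \<mu> (O.p \<omega>) (O.q \<omega>) \<alpha>)))" for n \<omega>
    have Err_meas: "Err n \<in> borel_measurable O.P" for n
      unfolding Err_def[abs_def] \<mu> by (rule O.outlier_error_measurable)
    have Err_eq: "(\<lambda>\<omega>. (sqrt (real n) * (fst (snd (cls_est s \<mu> n (\<lambda>k. Y k \<omega>))) -
           (Y s \<omega> + (- \<alpha> * (1 + \<alpha>^2) * Y (s - 1) \<omega> - \<alpha>^2 * Y (s + 2) \<omega> - (1 - \<alpha>^3) * \<mu>) / (1 + \<alpha>^2 + \<alpha>^4))),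
         sqrt (real n) * (snd (snd (cls_est s \<mu> n (\<lambda>k. Y k \<omega>))) -
           (Y (s + 1) \<omega> + (- (\<alpha>^2) * Y (s - 1) \<omega> - \<alpha> * (1 + \<alpha>^2) * Y (s + 2) \<omega> - (1 - \<alpha>^3) * \<mu>) / (1 + \<alpha>^2 + \<alpha>^4)))))
      = Err n" for n
      unfolding Err_def[abs_def] Y theta1_def theta2_def prof_D_def O.est_def \<mu>[symmetric]
      unfolding assms(2) ..
    have int_rank1: "integral\<^sup>L (normal2_rank1 v) f = (\<integral>z. f (z * fst v, z * snd v) \<partial>std_normal_distribution)"
      if "continuous_on UNIV f" for f :: "real \<times> real \<Rightarrow> real" and v
      unfolding normal2_rank1_def using borel_measurable_continuous_onI[OF that]
      by (subst integral_distr) auto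
    have lim: "(\<lambda>n. integral\<^sup>L (distr O.P borel (Err n)) f) \<longlonglongrightarrow> integral\<^sup>L (normal2_rank1
         (sqrt \<sigma>2 * (((\<alpha>^2 - 1) * (\<alpha>^4 + 3 * \<alpha>^2 + 1) * real m1 + 2 * \<alpha> * (\<alpha>^4 - 1) * real m2
                     + \<alpha> * (2 - \<alpha>) * (1 + \<alpha> + \<alpha>^2)^2 * \<mu>) / (1 + \<alpha>^2 + \<alpha>^4)^2),
          sqrt \<sigma>2 * ((2 * \<alpha> * (\<alpha>^4 - 1) * real m1 + (\<alpha>^2 - 1) * (\<alpha>^4 + 3 * \<alpha>^2 + 1) * real m2
                     + \<alpha> * (2 - \<alpha>) * (1 + \<alpha> + \<alpha>^2)^2 * \<mu>) / (1 + \<alpha>^2 + \<alpha>^4)^2))) f"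
      if f: "continuous_on UNIV f" "bounded (range f)" for f :: "real \<times> real \<Rightarrow> real"
    proof -
      have HC: "O.p \<omega> = real m1 \<and> O.q \<omega> = real m2" if "traj (inar X0 eps xi) (s + 2) \<omega> \<in> C" for \<omega>
        using that unfolding C by simp
      \<comment> \<open>Exchanging \<open>m1\<close> and \<open>m2\<close> in
        \<open>theta1_deriv\<close> gives the second entry of \<open>f\<close>, with its first two
        summands reordered.\<close>
      have l2: "(theta2 \<mu> (real m1) (real m2) has_real_derivative
          (2 * \<alpha> * (\<alpha>^4 - 1) * real m1 + (\<alpha>^2 - 1) * (\<alpha>^4 + 3 * \<alpha>^2 + 1) * real m2
            + \<alpha> * (2 - \<alpha>) * (1 + \<alpha> + \<alpha>^2)^2 * \<mu>) / (prof_D \<alpha>)^2) (at \<alpha>)"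
        using theta1_deriv[of \<mu> "real m2" "real m1" \<alpha>] unfolding theta2_eq_theta1 by (simp only: add.commute)
      have "integral\<^sup>L (distr O.P borel (Err n)) f = O.P.expectation (\<lambda>\<omega>. f (Err n \<omega>))" for n
        using borel_measurable_continuous_onI[OF f(1)] Err_meas by (subst integral_distr) auto
      then show ?thesis
        using O.outlier_limit[OF HC theta1_deriv l2[unfolded \<mu>] f]
        unfolding int_rank1[OF f(1)] \<sigma>2 prof_D_def Err_def \<mu> fst_conv snd_conv by simp
    qed
    show ?case
      unfolding Let_def weak_conv_gen_def P Err_eq using lim by blast
  qed
qed

end
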